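(* Let $\Gamma=(V(\Gamma),E(\Gamma),w_{\Gamma})$ be a weighted multigraph with binomial weights (that is, $w_\Gamma\colon E(\Gamma)\to\{0,1\}$). Let $(\tau(\Gamma),t(\Gamma))$ be the output of the reduction algorithm described in the context, applied to $\Gamma$. Then $$\operatorname{gap}^{*}(\Gamma)=\operatorname{gap}^{*}(\tau(\Gamma))+t(\Gamma).$$
   Context: All graphs and multigraphs are finite and undirected. **Simple graphs, gap.** A graph $G=(V(G),E(G))$ has no multiple edges but may have loops $\{u,u\}$. $N_G[v]=\{w:\{v,w\}\in E(G)\}$ (so $v\in N_G[v]$ iff $v$ has a loop). $\deg_G(v)=|N_G[v]|$ if $v$ has no loop and $|N_G[v]|+1$ if it has one. For nonempty $\mathcal K,\mathcal L\subseteq V(G)$ (possibly intersecting), the set-join $\mathcal K\vee\mathcal L$ is the graph on $V(G)$ with edges $\{i,j\}$, $i\in\mathcal K$, $j\in\mathcal L$. A set-join cover of $G$ is $\mathscr C=\{\mathcal K_i\vee\mathcal L_i: i\in[t]\}$ with $E(G)=\bigcup_i E(\mathcal K_i\vee\mathcal L_i)$; its component set is $V(\mathscr C)=\{\mathcal K_i\}_i\cup\{\mathcal L_i\}_i$. The SNT-rank is $\mathrm{st}_+(G)=\min|V(\mathscr C)|$ over all set-join covers of $G$ (the empty cover is used for an edgeless graph), and $\operatorname{gap}(G)=|V(G)|-\mathrm{st}_+(G)$; the graph with no vertices has gap $0$. (Known equivalent definition: $\mathrm{st}_+(G)$ is the least $r$ such that some symmetric entrywise nonnegative matrix $A$ with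 $a_{ij}>0\iff\{i,j\}\in E(G)$ is $A=BCB^{\top}$ with $B\ge0$ having $r$ columns and $C\ge 0$ symmetric.) **Multigraphs.** Multigraphs may have parallel edges and several loops at a vertex. If a vertex is incident to $s$ loops and $t$ non-loop edges, its degree is $t+2s$. A leaf is a vertex of degree $1$; $V_{d=1}(\Gamma)$, $V_{d=0}(\Gamma)$ are the sets of vertices of degree $1$, $0$. $N_\Gamma[v]$ is the set of neighbours of $v$. For $S\subseteq V(\Gamma)$, $\Gamma(S)$ is obtained by deleting $S$ and all edges incident to $S$. An $i$-edge (or $i$-loop) is an edge (loop) of weight $i$. **$\zeta$ and $\operatorname{gap}^*$.** For $\Gamma$ with weights in $\{0,1\}$, $\zeta(\Gamma)$ is the simple loopless graph obtained from $\Gamma$ by replacing each weight-$0$ edge or loop $\{u,v\}$ (possibly $u=v$) by a path $u-x_1-x_2-v$, each weight-$1$ non-loop edge $\{u,v\}$ by a path $u-x_1-x_2-x_3-v$, and each weight-$1$ loop at $u$ by a closed path $u-x_1-\cdots-x_5-u$; all $x_i$ are new distinct vertices of degree $2$. Define $\operatorname{gap}^*(\Gamma)=\operatorname{gap}(\zeta(\Gamma))$. **$\kappa$.** Let $\mathcal G$ be the family of graphs $G$ with no vertices $u_1\ne u_2$, $v_1\neq v_2$ such that $\{u_i,v_j\}\in E(G)$ for all $i,j\in\{1,2\}$. For $G\in\mathcal G$, $\kappa(G)$ is the weighted multigraph with vertex set $\{v\in V(G):\deg_G(v)\neq2\}$, whose edges with endpoints $u,v$ (possibly $u=v$) are in bijection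 with the walks $u-x_1-\cdots-x_k-v$ in $G$, $k\ge0$, with $x_1,\dots,x_k$ distinct vertices of degree $2$ in $G$ (walks do not traverse an edge twice and are taken up to reversal); such an edge has weight $k \bmod 2$. Components of $G$ all of whose vertices have degree $2$ disappear. **Operation $\tau_1$.** A $1$-component of $\Gamma$ is an induced subgraph $\Gamma'$ containing a spanning tree all of whose edges have weight $1$ and such that all edges between $V(\Gamma')$ and $V(\Gamma)\setminus V(\Gamma')$ have weight $0$ (a single vertex is allowed). Every vertex lies in exactly one $1$-component. Let $\varepsilon_1(\Gamma')$ be the number of edges, including loops, of weight $1$ in $\Gamma'$. Order the $1$-components $\Gamma_1,\dots,\Gamma_k$ so that $\varepsilon_1(\Gamma_i)=|V(\Gamma_i)|-1$ for $i\le\ell$ and $\varepsilon_1(\Gamma_i)\ge|V(\Gamma_i)|$ for $i>\ell$. Put $t_1(\Gamma)=\sum_{i=\ell+1}^k(\varepsilon_1(\Gamma_i)-|V(\Gamma_i)|)$. The graph $\tau_1(\Gamma)$ has vertices $w_1,\dots,w_\ell$, and for $i,j\in[\ell]$ (with $i=j$ allowed) a unique edge $\{w_i,w_j\}$ iff $\Gamma$ has a weight-$0$ edge with one endpoint in $\Gamma_i$ and the other in $\Gamma_j$; all weights are $0$. **Operation $\tau_2$.** Let $N_\Gamma[V_{d=1}(\Gamma)]=\bigcup_{v\in V_{d=1}(\Gamma)}N_\Gamma[v]$. Then $\tau_2(\Gamma)=\Gamma\bigl(V_{d=1}(\Gamma)\cup N_\Gamma[V_{d=1}(\Gamma)]\bigr)$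 and $t_2(\Gamma)=|V_{d=1}(\Gamma)|-|N_\Gamma[V_{d=1}(\Gamma)]|$. **Operation $\tau_3$.** $\tau_3(\Gamma)=\kappa(\zeta(\Gamma(V_{d=0}(\Gamma))))$ and $t_3(\Gamma)=|V_{d=0}(\Gamma)|$. **Algorithm.** On input $\Gamma_0$, set $\Gamma:=\Gamma_0$, $t:=0$. Repeat: $\Gamma_{\rm old}:=\Gamma$; then successively $(\Gamma,t):=(\tau_1(\Gamma),t+t_1(\Gamma))$, $(\Gamma,t):=(\tau_2(\Gamma),t+t_2(\Gamma))$, $(\Gamma,t):=(\tau_3(\Gamma),t+t_3(\Gamma))$; until $\Gamma_{\rm old}=\Gamma$ (up to the natural identification of vertices). Return $(\tau(\Gamma_0),t(\Gamma_0)):=(\Gamma,t)$. *)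

theory Defs
  imports "HOL-Library.Multiset"
begin

section \<open>Simple graphs with loops, set-join covers and the gap\<close>

text \<open>An edge is the set \<open>{u, v}\<close> of its endpoints, so a loop at \<open>u\<close> is the singleton \<open>{u}\<close>.\<close>

record 'a graph =
  verts :: "'a set"
  edges :: "'a set set"

definition wf_graph :: "'a graph \<Rightarrow> bool" where
  "wf_graph G \<longleftrightarrow> finite (verts G) \<and> (\<forall>e \<in> edges G. \<exists>u \<in> verts G. \<exists>v \<in> verts G. e = {u, v})"

definition nbrs :: "'a graph \<Rightarrow> 'a \<Rightarrow> 'a set" where
  "nbrs G v = {w. {v, w} \<in> edges G}"

definition deg :: "'a graph \<Rightarrow> 'a \<Rightarrow> nat" where
  "deg G v = (if {v, v} \<in> edges G then card (nbrs G v) + 1 else card (nbrs G v))"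

definition set_join :: "'a graph \<Rightarrow> 'a set \<Rightarrow> 'a set \<Rightarrow> 'a graph" where
  "set_join G K L = \<lparr>verts = verts G, edges = {{i, j} |i j. i \<in> K \<and> j \<in> L}\<rparr>"

text \<open>A cover is given by the set of pairs \<open>(K\<^sub>i, L\<^sub>i)\<close> that define its set-joins.\<close>

definition set_join_cover :: "'a graph \<Rightarrow> ('a set \<times> 'a set) set \<Rightarrow> bool" where
  "set_join_cover G \<C> \<longleftrightarrow>
     (\<forall>(K, L) \<in> \<C>. K \<noteq> {} \<and> K \<subseteq> verts G \<and> L \<noteq> {} \<and> L \<subseteq> verts G) \<and>
     edges G = (\<Union>(K, L) \<in> \<C>. edges (set_join G K L))"

definition component_set :: "('a set \<times> 'a set) set \<Rightarrow> 'a set set" where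
  "component_set \<C> = fst ` \<C> \<union> snd ` \<C>"

definition SNT_rank :: "'a graph \<Rightarrow> nat" where
  "SNT_rank G = (LEAST r. \<exists>\<C>. set_join_cover G \<C> \<and> r = card (component_set \<C>))"

definition gap :: "'a graph \<Rightarrow> int" where
  "gap G = int (card (verts G)) - int (SNT_rank G)"


section \<open>Walks and trees\<close>

definition walk_edges :: "'a list \<Rightarrow> 'a set list" where
  "walk_edges xs = map (\<lambda>(x, y). {x, y}) (zip xs (tl xs))"

definition walk :: "'a graph \<Rightarrow> 'a list \<Rightarrow> bool" where
  "walk G xs \<longleftrightarrow> xs \<noteq> [] \<and> set xs \<subseteq> verts G \<and> set (walk_edges xs) \<subseteq> edges G"

definition connected_graph :: "'a graph \<Rightarrow> bool" where
  "connected_graph G \<longleftrightarrow> verts G \<noteq> {} \<and>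
     (\<forall>u \<in> verts G. \<forall>v \<in> verts G. \<exists>xs. walk G xs \<and> hd xs = u \<and> last xs = v)"

text \<open>A loop at \<open>u\<close> counts as the cycle \<open>[u, u]\<close>; \<open>[u, v, u]\<close> is no cycle, since it uses an
  edge twice.\<close>

definition cycle :: "'a graph \<Rightarrow> 'a list \<Rightarrow> bool" where
  "cycle G xs \<longleftrightarrow> walk G xs \<and> 2 \<le> length xs \<and> hd xs = last xs \<and>
     distinct (tl xs) \<and> distinct (walk_edges xs)"

definition tree :: "'a graph \<Rightarrow> bool" where
  "tree G \<longleftrightarrow> wf_graph G \<and> connected_graph G \<and> (\<nexists>xs. cycle G xs)"


section \<open>Weighted multigraphs\<close>

text \<open>The edges form a multiset of pairs (set of endpoints, weight). Parallel edges of equal weight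
  are not named individually, so that equality of multigraphs on the same vertices is the equality
  of weighted edge multiplicities.\<close>

record 'v mgraph =
  mverts :: "'v set"
  medges :: "('v set \<times> nat) multiset"

definition wf_mgraph :: "'v mgraph \<Rightarrow> bool" where
  "wf_mgraph \<Gamma> \<longleftrightarrow> finite (mverts \<Gamma>) \<and>
     (\<forall>e \<in># medges \<Gamma>. \<exists>u \<in> mverts \<Gamma>. \<exists>v \<in> mverts \<Gamma>. fst e = {u, v})"

definition binomial_weights :: "'v mgraph \<Rightarrow> bool" where
  "binomial_weights \<Gamma> \<longleftrightarrow> (\<forall>e \<in># medges \<Gamma>. snd e \<in> {0, 1})"

text \<open>Loops are incident to their vertex as well, hence counted twice.\<close>

definition mdeg :: "'v mgraph \<Rightarrow> 'v \<Rightarrow> nat" where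
  "mdeg \<Gamma> v = size {#e \<in># medges \<Gamma>. v \<in> fst e#} + size {#e \<in># medges \<Gamma>. fst e = {v}#}"

definition mnbrs :: "'v mgraph \<Rightarrow> 'v \<Rightarrow> 'v set" where
  "mnbrs \<Gamma> v = {w. \<exists>e \<in># medges \<Gamma>. fst e = {v, w}}"

definition deg_verts :: "nat \<Rightarrow> 'v mgraph \<Rightarrow> 'v set" where
  "deg_verts d \<Gamma> = {v \<in> mverts \<Gamma>. mdeg \<Gamma> v = d}"

text \<open>The multigraph written \<open>\<Gamma>(S)\<close>: the vertices in \<open>S\<close> are removed, not kept.\<close>

definition delete :: "'v mgraph \<Rightarrow> 'v set \<Rightarrow> 'v mgraph" where
  "delete \<Gamma> S = \<lparr>mverts = mverts \<Gamma> - S, medges = {#e \<in># medges \<Gamma>. fst e \<inter> S = {}#}\<rparr>"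

definition map_mgraph :: "('v \<Rightarrow> 'w) \<Rightarrow> 'v mgraph \<Rightarrow> 'w mgraph" where
  "map_mgraph f \<Gamma> = \<lparr>mverts = f ` mverts \<Gamma>, medges = image_mset (\<lambda>(s, w). (f ` s, w)) (medges \<Gamma>)\<rparr>"


section \<open>The operations \<open>\<zeta>\<close> and \<open>\<kappa>\<close>\<close>

text \<open>\<open>New e i j\<close> is the \<open>j\<close>-th new vertex on the path that replaces the \<open>i\<close>-th copy of the
  weighted edge \<open>e\<close>.\<close>

datatype 'v zvert = Orig (orig: 'v) | New "'v set \<times> nat" nat nat

definition path_len :: "'v set \<times> nat \<Rightarrow> nat" where
  "path_len e = (if snd e = 0 then 2 else if \<exists>u. fst e = {u} then 5 else 3)"

text \<open>The direction in which a path is numbered is arbitrary.\<close>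

definition edge_path :: "'v set \<times> nat \<Rightarrow> nat \<Rightarrow> 'v zvert list" where
  "edge_path e i =
     (let (u, v) = (SOME p. fst e = {fst p, snd p})
      in Orig u # map (New e i) [1..<Suc (path_len e)] @ [Orig v])"

definition zeta :: "'v mgraph \<Rightarrow> 'v zvert graph" where
  "zeta \<Gamma> =
     \<lparr>verts = Orig ` mverts \<Gamma> \<union>
        {New e i j |e i j. e \<in># medges \<Gamma> \<and> i < count (medges \<Gamma>) e \<and> 1 \<le> j \<and> j \<le> path_len e},
      edges = (\<Union>e \<in> set_mset (medges \<Gamma>). \<Union>i < count (medges \<Gamma>) e.
        set (walk_edges (edge_path e i)))\<rparr>"

definition gap_star :: "'v mgraph \<Rightarrow> int" where
  "gap_star \<Gamma> = gap (zeta \<Gamma>)"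

text \<open>The walks \<open>u - x\<^sub>1 - \<dots> - x\<^sub>k - v\<close> that become edges under \<open>\<kappa>\<close>.\<close>

definition kappa_walk :: "'a graph \<Rightarrow> 'a list \<Rightarrow> bool" where
  "kappa_walk G p \<longleftrightarrow> walk G p \<and> distinct (walk_edges p) \<and>
     (\<exists>u xs v. p = u # xs @ [v] \<and> deg G u \<noteq> 2 \<and> deg G v \<noteq> 2 \<and>
        distinct xs \<and> (\<forall>x \<in> set xs. deg G x = 2))"

text \<open>Walks up to reversal are the classes \<open>{p, rev p}\<close>. The endpoints and the number \<open>k\<close> of inner
  vertices, \<open>length p = k + 2\<close>, do not depend on the representative. The definition is applied to
  graphs \<open>G = \<zeta>(\<Gamma>)\<close> only; these satisfy the condition that no two vertices \<open>u\<^sub>1 \<noteq> u\<^sub>2\<close> are both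
  joined to the same two vertices \<open>v\<^sub>1 \<noteq> v\<^sub>2\<close>.\<close>

definition kappa :: "'a graph \<Rightarrow> 'a mgraph" where
  "kappa G =
     \<lparr>mverts = {v \<in> verts G. deg G v \<noteq> 2},
      medges = image_mset (\<lambda>c. let p = (SOME p. p \<in> c) in ({hd p, last p}, (length p - 2) mod 2))
        (mset_set {{p, rev p} |p. kappa_walk G p})\<rparr>"


section \<open>The operations \<open>\<tau>\<^sub>1\<close>, \<open>\<tau>\<^sub>2\<close>, \<open>\<tau>\<^sub>3\<close>\<close>

definition one_component :: "'v mgraph \<Rightarrow> 'v mgraph \<Rightarrow> bool" where
  "one_component \<Gamma> \<Gamma>' \<longleftrightarrow>
     mverts \<Gamma>' \<subseteq> mverts \<Gamma> \<and> \<Gamma>' = delete \<Gamma> (mverts \<Gamma> - mverts \<Gamma>') \<and>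
     (\<exists>T. tree T \<and> verts T = mverts \<Gamma>' \<and> (\<forall>s \<in> edges T. (s, 1) \<in># medges \<Gamma>')) \<and>
     (\<forall>e \<in># medges \<Gamma>. fst e \<inter> mverts \<Gamma>' \<noteq> {} \<and> fst e - mverts \<Gamma>' \<noteq> {} \<longrightarrow> snd e = 0)"

definition eps1 :: "'v mgraph \<Rightarrow> nat" where
  "eps1 \<Gamma> = size {#e \<in># medges \<Gamma>. snd e = 1#}"

text \<open>The components \<open>\<Gamma>\<^sub>i\<close> with \<open>i \<le> \<ell>\<close> and those with \<open>i > \<ell>\<close>.\<close>

definition tree_components :: "'v mgraph \<Rightarrow> 'v mgraph set" where
  "tree_components \<Gamma> = {\<Gamma>'. one_component \<Gamma> \<Gamma>' \<and> int (eps1 \<Gamma>') = int (card (mverts \<Gamma>')) - 1}"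

definition cyclic_components :: "'v mgraph \<Rightarrow> 'v mgraph set" where
  "cyclic_components \<Gamma> = {\<Gamma>'. one_component \<Gamma> \<Gamma>' \<and> eps1 \<Gamma>' \<ge> card (mverts \<Gamma>')}"

text \<open>The vertex \<open>w\<^sub>i\<close> that stands for \<open>\<Gamma>\<^sub>i\<close> is taken to be some vertex of \<open>\<Gamma>\<^sub>i\<close>; components are
  disjoint, so different components get different vertices. If \<open>\<Gamma>\<^sub>i\<close> has a single vertex, then
  \<open>w\<^sub>i\<close> is this vertex, which is the natural identification in the stopping criterion below.\<close>

definition rep :: "'v mgraph \<Rightarrow> 'v" where
  "rep \<Gamma>' = (SOME v. v \<in> mverts \<Gamma>')"

definition tau1 :: "'v mgraph \<Rightarrow> 'v mgraph" where
  "tau1 \<Gamma> =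
     \<lparr>mverts = rep ` tree_components \<Gamma>,
      medges = mset_set {({rep A, rep B}, 0) |A B.
        A \<in> tree_components \<Gamma> \<and> B \<in> tree_components \<Gamma> \<and>
        (\<exists>a \<in> mverts A. \<exists>b \<in> mverts B. ({a, b}, 0) \<in># medges \<Gamma>)}\<rparr>"

definition t1 :: "'v mgraph \<Rightarrow> int" where
  "t1 \<Gamma> = (\<Sum>\<Gamma>' \<in> cyclic_components \<Gamma>. int (eps1 \<Gamma>') - int (card (mverts \<Gamma>')))"

definition leaf_nbrs :: "'v mgraph \<Rightarrow> 'v set" where
  "leaf_nbrs \<Gamma> = (\<Union>v \<in> deg_verts 1 \<Gamma>. mnbrs \<Gamma> v)"

definition tau2 :: "'v mgraph \<Rightarrow> 'v mgraph" where
  "tau2 \<Gamma> = delete \<Gamma> (deg_verts 1 \<Gamma> \<union> leaf_nbrs \<Gamma>)"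

definition t2 :: "'v mgraph \<Rightarrow> int" where
  "t2 \<Gamma> = int (card (deg_verts 1 \<Gamma>)) - int (card (leaf_nbrs \<Gamma>))"

text \<open>The new vertices of \<open>\<zeta>\<close> have degree 2, so \<open>\<kappa>\<close> only keeps vertices of the form \<open>Orig v\<close>, which
  are renamed back to \<open>v\<close>.\<close>

definition tau3 :: "'v mgraph \<Rightarrow> 'v mgraph" where
  "tau3 \<Gamma> = map_mgraph orig (kappa (zeta (delete \<Gamma> (deg_verts 0 \<Gamma>))))"

definition t3 :: "'v mgraph \<Rightarrow> int" where
  "t3 \<Gamma> = int (card (deg_verts 0 \<Gamma>))"


section \<open>The reduction algorithm\<close>

definition pass :: "'v mgraph \<times> int \<Rightarrow> 'v mgraph \<times> int" where
  "pass s =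
     (let (\<Gamma>, t) = s;
          (\<Gamma>, t) = (tau1 \<Gamma>, t + t1 \<Gamma>);
          (\<Gamma>, t) = (tau2 \<Gamma>, t + t2 \<Gamma>);
          (\<Gamma>, t) = (tau3 \<Gamma>, t + t3 \<Gamma>)
      in (\<Gamma>, t))"

text \<open>The value of a non-terminating run is unspecified, so a statement about \<open>tau\<close> and
  \<open>tau_t\<close> for all inputs includes that the loop terminates.\<close>

partial_function (tailrec) repeat_pass :: "'v mgraph \<times> int \<Rightarrow> 'v mgraph \<times> int" where
  "repeat_pass s = (let s' = pass s in if fst s = fst s' then s' else repeat_pass s')"

definition tau :: "'v mgraph \<Rightarrow> 'v mgraph" where
  "tau \<Gamma> = fst (repeat_pass (\<Gamma>, 0))"

definition tau_t :: "'v mgraph \<Rightarrow> int" where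
  "tau_t \<Gamma> = snd (repeat_pass (\<Gamma>, 0))"

end

theory Submission
  imports Defs
begin

text \<open>A cover of a graph without 4-cycles consists of stars, so the gap of such a graph is the largest
  total of a labelling by -1, 0, 1 in which adjacent labels sum to at most 0: the centres of the stars
  get -1, and the vertices occurring in no singleton component get 1. The labels on a path with
  \<open>n \<ge> 1\<close> inner vertices whose ends carry labels \<open>a\<close> and \<open>b\<close> sum to at most \<open>- max 0 (a + b)\<close> for even
  \<open>n\<close> and \<open>- max a b\<close> for odd \<open>n\<close>. So \<open>gap\<^sup>*\<close> is the maximum, over labellings of the multigraph, of
  the sum of the labels minus such a penalty for every edge. This explains why suppressing vertices
  of degree 2 is harmless and why labels may be taken constant on a 1-component (lower them to their
  minimum and compare along a spanning tree), with value -1 if it contains a cycle. Leaves are matched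
  with their neighbours. The loop terminates since a pass that keeps all vertices only removes
  parallel edges.\<close>

subsection \<open>Labellings and set-join covers\<close>

text \<open>The gap enters only through the equivalence of \<open>k \<le> gap G\<close> with the
  existence of a labelling of total at least \<open>k\<close>. Two graphs are then compared by
  carrying labellings over in both directions, and no maximum has to be exhibited. A class of
  \<open>n\<close> vertices joined by \<open>m\<close> edges of weight 1 and carrying a constant
  label \<open>c\<close> has value \<open>c * (n - m)\<close>. The factor is 1 for a tree and at
  most 0 otherwise, so \<open>c = -1\<close> is the best choice on a cyclic class. Its value
  \<open>m - n\<close> is the summand of \<open>t1\<close>, and all its edges of weight 0 become
  free, because no label exceeds 1. The obstacle in \<open>tau1\<close> is that parallel edges of
  weight 0 are merged, which loses penalties. This is harmless because, when all weights are 0, some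
  optimal labelling pays no penalty at all, and such labellings do not see multiplicities.\<close>

definition admissible :: "'a graph \<Rightarrow> ('a \<Rightarrow> int) \<Rightarrow> bool" where
  "admissible G g \<longleftrightarrow> (\<forall>v. \<bar>g v\<bar> \<le> 1) \<and> (\<forall>u v. {u, v} \<in> edges G \<longrightarrow> g u + g v \<le> 0)"

text \<open>The family of graphs on which \<kappa> is defined. The \<open>u\<close>s may coincide
  with the \<open>v\<close>s, so two adjacent vertices with loops are excluded as well as
  4-cycles.\<close>

definition K22_free :: "'a graph \<Rightarrow> bool" where
  "K22_free G \<longleftrightarrow> (\<forall>u\<^sub>1 u\<^sub>2 v\<^sub>1 v\<^sub>2. {u\<^sub>1, v\<^sub>1} \<in> edges G \<and> {u\<^sub>1, v\<^sub>2} \<in> edges G \<and>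
     {u\<^sub>2, v\<^sub>1} \<in> edges G \<and> {u\<^sub>2, v\<^sub>2} \<in> edges G \<longrightarrow> u\<^sub>1 = u\<^sub>2 \<or> v\<^sub>1 = v\<^sub>2)"

lemma wf_graph_edge_verts:
  assumes "wf_graph G" "{u, v} \<in> edges G"
  shows "u \<in> verts G" "v \<in> verts G"
  using assms by (fastforce simp: wf_graph_def doubleton_eq_iff)+

lemma nbrs_subset_verts: "wf_graph G \<Longrightarrow> nbrs G v \<subseteq> verts G"
  by (auto simp: nbrs_def dest: wf_graph_edge_verts)

lemma finite_nbrs: "wf_graph G \<Longrightarrow> finite (nbrs G v)"
  using nbrs_subset_verts finite_subset wf_graph_def by metis

text \<open>An integer x in {-1, 0, 1} equals 1 - [x \<le> 0] - [x = -1]. The two sets are the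
  vertices that form singleton components and the centres of proper stars, so the two cardinalities
  add up to the size of a component set.\<close>

lemma sum_label_eq:
  fixes g :: "'a \<Rightarrow> int"
  assumes "finite V" "\<forall>v. \<bar>g v\<bar> \<le> 1"
  shows "sum g V = int (card V) - int (card {v \<in> V. g v \<le> 0}) - int (card {v \<in> V. g v = -1})"
proof -
  have "g v = 1 - of_bool (g v \<le> 0) - of_bool (g v = -1)" for v
    using assms(2)[rule_format, of v] by (auto split: if_splits)
  then have "sum g V = (\<Sum>v\<in>V. 1 - of_bool (g v \<le> 0) - of_bool (g v = -1))"
    by (rule sum.cong[OF refl])
  then show ?thesis
    using assms(1) by (simp add: sum_subtractf of_bool_def sum.If_cases Int_def)
qed

text \<open>The vertices of label -1 become the centres of full stars; edges between two vertices of label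
  0 are covered one by one.\<close>

lemma admissible_imp_cover:
  assumes wf: "wf_graph G" and g: "admissible G g"
  obtains \<C> where "set_join_cover G \<C>"
    "sum g (verts G) \<le> int (card (verts G)) - int (card (component_set \<C>))"
proof -
  define P where "P = {v \<in> verts G. g v \<le> 0}"
  define S where "S = {v \<in> verts G. g v = -1}"
  define \<C> where "\<C> = {({v}, nbrs G v) |v. v \<in> S \<and> nbrs G v \<noteq> {}} \<union>
    {({u}, {v}) |u v. {u, v} \<in> edges G \<and> u \<in> P \<and> v \<in> P}"
  have fin: "finite (verts G)" using wf by (simp add: wf_graph_def)
  have "edges G = (\<Union>(K, L) \<in> \<C>. edges (set_join G K L))"
  proof (intro equalityI subsetI)
    fix e assume e: "e \<in> edges G"
    then obtain u v where uv: "u \<in> verts G" "v \<in> verts G" "e = {u, v}"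
      using wf by (auto simp: wf_graph_def)
    then have "g u + g v \<le> 0" "\<bar>g u\<bar> \<le> 1" "\<bar>g v\<bar> \<le> 1" using g e by (auto simp: admissible_def)
    then consider "u \<in> P" "v \<in> P" | "u \<in> S" | "v \<in> S"
      using uv by (fastforce simp: P_def S_def)
    then show "e \<in> (\<Union>(K, L) \<in> \<C>. edges (set_join G K L))"
    proof cases
      case 1
      then have "({u}, {v}) \<in> \<C>" using e uv by (auto simp: \<C>_def)
      then show ?thesis using uv by (force simp: set_join_def)
    next
      case 2
      then have "v \<in> nbrs G u" using e uv by (simp add: nbrs_def)
      moreover have "({u}, nbrs G u) \<in> \<C>" using 2 calculation by (auto simp: \<C>_def)
      ultimately show ?thesis using uv by (force simp: set_join_def)
    next
      case 3
      then have "u \<in> nbrs G v" using e uv by (simp add: nbrs_def insert_commute)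
      moreover have "({v}, nbrs G v) \<in> \<C>" using 3 calculation by (auto simp: \<C>_def)
      moreover have "e = {v, u}" using uv by auto
      ultimately show ?thesis by (force simp: set_join_def)
    qed
  next
    fix e assume "e \<in> (\<Union>(K, L) \<in> \<C>. edges (set_join G K L))"
    then show "e \<in> edges G" by (auto simp: \<C>_def set_join_def nbrs_def)
  qed
  moreover have "K \<noteq> {} \<and> K \<subseteq> verts G \<and> L \<noteq> {} \<and> L \<subseteq> verts G" if "(K, L) \<in> \<C>" for K L
    using that nbrs_subset_verts[OF wf, THEN subsetD] by (auto simp: \<C>_def P_def S_def)
  ultimately have cover: "set_join_cover G \<C>"
    unfolding set_join_cover_def by blast
  \<comment> \<open>The star at a vertex v of \<open>S\<close> contributes {v}, which is already
    counted in \<open>P\<close>, and one further set, its neighbourhood.\<close>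
  have "component_set \<C> \<subseteq> (\<lambda>v. {v}) ` P \<union> nbrs G ` S"
    by (auto simp: component_set_def \<C>_def P_def S_def)
  then have "card (component_set \<C>) \<le> card ((\<lambda>v. {v}) ` P \<union> nbrs G ` S)"
    using fin by (intro card_mono) (auto simp: P_def S_def)
  also have "\<dots> \<le> card ((\<lambda>v. {v}) ` P) + card (nbrs G ` S)" by (rule card_Un_le)
  also have "\<dots> \<le> card P + card S"
    using fin by (intro add_mono card_image_le) (auto simp: P_def S_def)
  finally have "sum g (verts G) \<le> int (card (verts G)) - int (card (component_set \<C>))"
    using sum_label_eq[OF fin, of g] g by (simp add: admissible_def P_def S_def)
  with cover show thesis by (rule that)
qed

text \<open>Without the forbidden pattern, one side of each set-join is a singleton. A star whose
  other side is not a singleton has that side as a component outside the count of \<open>P\<close>,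
  and different centres have different such sides, since two vertices with two common neighbours are
  forbidden. Hence \<open>card P + card S\<close> is at most the number of components.\<close>

lemma cover_imp_admissible:
  assumes wf: "wf_graph G" and K22: "K22_free G" and cover: "set_join_cover G \<C>"
  obtains g where "admissible G g"
    "int (card (verts G)) - int (card (component_set \<C>)) \<le> sum g (verts G)"
proof -
  define P where "P = {v. {v} \<in> component_set \<C>}"
  \<comment> \<open>Set-joins of two singletons are left out: their components are both counted in
    \<open>P\<close> and put label at most 0 on both ends of the edge.\<close>
  define big where "big v L \<longleftrightarrow> (({v}, L) \<in> \<C> \<or> (L, {v}) \<in> \<C>) \<and> (\<nexists>w. L = {w})" for v L
  define S where "S = {v. \<exists>L. big v L}"
  define g where "g v = 1 - of_bool (v \<in> P) - (of_bool (v \<in> S) :: int)" for v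
  have fin: "finite (verts G)" using wf by (simp add: wf_graph_def)
  have sub: "K \<noteq> {} \<and> K \<subseteq> verts G \<and> L \<noteq> {} \<and> L \<subseteq> verts G" if "(K, L) \<in> \<C>" for K L
    using cover that by (auto simp: set_join_cover_def)
  have edge: "{i, j} \<in> edges G" if "(K, L) \<in> \<C>" "i \<in> K" "j \<in> L" for K L i j
  proof -
    have "{i, j} \<in> edges (set_join G K L)" using that(2,3) by (auto simp: set_join_def)
    then show ?thesis using cover that(1) unfolding set_join_cover_def by blast
  qed
  have "\<C> \<subseteq> Pow (verts G) \<times> Pow (verts G)" using sub by auto
  then have finC: "finite (component_set \<C>)"
    using fin finite_subset by (fastforce simp: component_set_def)
  have PV: "P \<subseteq> verts G" using sub by (fastforce simp: P_def component_set_def)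
  have SP: "S \<subseteq> P" by (force simp: S_def P_def big_def component_set_def)
  have big_edge: "{v, w} \<in> edges G" if "big v L" "w \<in> L" for v L w
    using that edge[of "{v}" L v w] edge[of L "{v}" w v] by (auto simp: big_def insert_commute)
  have big_two: "\<exists>w\<^sub>1 w\<^sub>2. w\<^sub>1 \<in> L \<and> w\<^sub>2 \<in> L \<and> w\<^sub>1 \<noteq> w\<^sub>2" if "big v L" for v L
  proof -
    have "L \<noteq> {}" using that sub by (auto simp: big_def)
    then show ?thesis using that unfolding big_def by blast
  qed
  define \<L> where "\<L> v = (SOME L. big v L)" for v
  have \<L>: "big v (\<L> v)" if "v \<in> S" for v
    using that unfolding \<L>_def S_def by (auto intro: someI)
  have "inj_on \<L> S"
  proof (rule inj_onI)
    fix v w assume vw: "v \<in> S" "w \<in> S" "\<L> v = \<L> w"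
    obtain w\<^sub>1 w\<^sub>2 where "w\<^sub>1 \<in> \<L> v" "w\<^sub>2 \<in> \<L> v" "w\<^sub>1 \<noteq> w\<^sub>2" using big_two \<L> vw(1) by blast
    then show "v = w" using big_edge[OF \<L>] vw K22 unfolding K22_free_def by metis
  qed
  then have "card P + card S = card ((\<lambda>v. {v}) ` P) + card (\<L> ` S)"
    by (simp add: card_image)
  also have "\<dots> = card ((\<lambda>v. {v}) ` P \<union> \<L> ` S)"
  proof (rule card_Un_disjoint[symmetric])
    show "finite ((\<lambda>v. {v}) ` P)" "finite (\<L> ` S)"
      using PV SP fin by (meson finite_imageI finite_subset)+
    show "(\<lambda>v. {v}) ` P \<inter> \<L> ` S = {}" using \<L> by (fastforce simp: big_def)
  qed
  also have "\<dots> \<le> card (component_set \<C>)"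
    using \<L> by (intro card_mono finC) (force simp: P_def big_def component_set_def)
  finally have card: "card P + card S \<le> card (component_set \<C>)" .
  have g1: "\<bar>g v\<bar> \<le> 1" for v using SP by (auto simp: g_def)
  have "g u + g v \<le> 0" if "{u, v} \<in> edges G" for u v
  proof -
    obtain K L i j where KL: "(K, L) \<in> \<C>" "i \<in> K" "j \<in> L" "{u, v} = {i, j}"
      using cover \<open>{u, v} \<in> edges G\<close> by (auto simp: set_join_cover_def set_join_def)
    have ij: "g u + g v = g i + g j" using KL(4) by (auto simp: doubleton_eq_iff)
    have single: "K = {i} \<or> L = {j}"
      using K22 edge[OF KL(1)] KL(2,3) unfolding K22_free_def by (smt (verit) insertI1 singletonD set_eq_iff)
    have "(i \<in> P \<and> j \<in> P) \<or> i \<in> S \<or> j \<in> S"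
    proof (cases "K = {i} \<and> L = {j}")
      case True
      then have "({i}, {j}) \<in> \<C>" using KL(1) by blast
      then show ?thesis unfolding P_def component_set_def by force
    next
      case False
      then have "big i L \<or> big j K" using single KL by (auto simp: big_def)
      then show ?thesis by (auto simp: S_def)
    qed
    then show ?thesis using SP ij by (auto simp: g_def)
  qed
  then have "admissible G g" using g1 by (simp add: admissible_def)
  moreover have "{v \<in> verts G. g v \<le> 0} = P" "{v \<in> verts G. g v = -1} = S"
    using PV SP by (auto simp: g_def of_bool_def split: if_splits)
  then have "int (card (verts G)) - int (card (component_set \<C>)) \<le> sum g (verts G)"
    using sum_label_eq[OF fin, of g] g1 card by simp
  ultimately show thesis by (rule that)
qed

lemma le_gap_iff:
  assumes wf: "wf_graph G" and K22: "K22_free G"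
  shows "k \<le> gap G \<longleftrightarrow> (\<exists>g. admissible G g \<and> k \<le> sum g (verts G))"
proof
  assume k: "k \<le> gap G"
  have "admissible G (\<lambda>_. 0)" by (simp add: admissible_def)
  then obtain \<C> where "set_join_cover G \<C>" using admissible_imp_cover[OF wf] by blast
  then have "\<exists>r \<C>. set_join_cover G \<C> \<and> r = card (component_set \<C>)" by blast
  then have "\<exists>\<C>. set_join_cover G \<C> \<and> SNT_rank G = card (component_set \<C>)"
    unfolding SNT_rank_def by (rule LeastI_ex)
  then obtain \<C> where \<C>: "set_join_cover G \<C>" "SNT_rank G = card (component_set \<C>)" by blast
  obtain g where "admissible G g"
    "int (card (verts G)) - int (card (component_set \<C>)) \<le> sum g (verts G)"
    using cover_imp_admissible[OF wf K22 \<C>(1)] .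
  then show "\<exists>g. admissible G g \<and> k \<le> sum g (verts G)"
    using k \<C>(2) by (intro exI[of _ g]) (simp add: gap_def)
next
  assume "\<exists>g. admissible G g \<and> k \<le> sum g (verts G)"
  then obtain g where g: "admissible G g" "k \<le> sum g (verts G)" by blast
  obtain \<C> where \<C>: "set_join_cover G \<C>"
    "sum g (verts G) \<le> int (card (verts G)) - int (card (component_set \<C>))"
    using admissible_imp_cover[OF wf g(1)] .
  have "SNT_rank G \<le> card (component_set \<C>)"
    unfolding SNT_rank_def using \<C>(1) by (intro Least_le) blast
  then show "k \<le> gap G" using g(2) \<C>(2) by (simp add: gap_def)
qed


subsection \<open>Optimal labels along paths\<close>

abbreviation opposed :: "('a \<Rightarrow> int) \<Rightarrow> 'a \<Rightarrow> 'a \<Rightarrow> bool" where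
  "opposed g x y \<equiv> g x + g y \<le> 0"

definition path_cost :: "nat \<Rightarrow> int \<Rightarrow> int \<Rightarrow> int" where
  "path_cost n a b = (if even n then max 0 (a + b) else max a b)"

lemma walk_edges_simps [simp]:
  "walk_edges [] = []" "walk_edges [x] = []"
  "walk_edges (x # y # xs) = {x, y} # walk_edges (y # xs)"
  by (simp_all add: walk_edges_def)

lemma walk_edges_subset_iff:
  "set (walk_edges p) \<subseteq> E \<longleftrightarrow> successively (\<lambda>x y. {x, y} \<in> E) p"
  by (induction p rule: induct_list012) auto

lemma sum_list_opposed_even:
  assumes "successively (opposed g) p" "even (length p)"
  shows "sum_list (map g p) \<le> 0"
  using assms by (induction p rule: induct_list012) (auto simp: successively_Cons)

text \<open>Split a list of even length into consecutive pairs, each of sum at most 0. For an even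
  number of inner vertices this applies to these alone and to the path with both ends; for an odd
  number, to the inner vertices with either one of the ends.\<close>

lemma inner_sum_le_path_cost:
  assumes "successively (opposed g) (u # xs @ [v])"
  shows "sum_list (map g xs) \<le> - path_cost (length xs) (g u) (g v)"
proof -
  have "successively (opposed g) ((u # xs) @ [v])" "successively (opposed g) ([u] @ xs @ [v])"
    using assms by simp_all
  then have "successively (opposed g) (u # xs)" "successively (opposed g) (xs @ [v])"
    "successively (opposed g) xs"
    unfolding successively_append_iff by blast+
  then show ?thesis
    using assms sum_list_opposed_even[of g "u # xs @ [v]"] sum_list_opposed_even[of g xs]
      sum_list_opposed_even[of g "u # xs"] sum_list_opposed_even[of g "xs @ [v]"]
    by (auto simp: path_cost_def)
qed

text \<open>Blocks \<open>[- m, m]\<close> of sum 0 lengthen a path by two vertices without changing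
  its total; only the first inequality \<open>c - m \<le> 0\<close> needs an assumption.\<close>

lemma alternating_opposed:
  fixes c m :: int
  assumes "c \<le> m" "successively (opposed id) (- m # zs)"
  shows "successively (opposed id) (c # concat (replicate j [- m, m]) @ - m # zs)"
  using assms by (induction j arbitrary: c) auto

text \<open>For odd \<open>n\<close> the labels alternate with the larger end as amplitude and
  finish with its negative. For even \<open>n\<close> they alternate with amplitude \<open>a\<close>
  up to \<open>- a\<close>, followed by \<open>min a (- b)\<close>, the largest label compatible
  with \<open>- a\<close> before it and \<open>b\<close> after it. With \<open>n = 0\<close> there
  would be no vertex to absorb a positive \<open>a + b\<close>.\<close>

lemma path_cost_attained:
  assumes "0 < n" "\<bar>a\<bar> \<le> 1" "\<bar>b\<bar> \<le> 1"
  obtains ys where "length ys = n" "\<forall>y \<in> set ys. \<bar>y\<bar> \<le> 1"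
    "successively (opposed id) (a # ys @ [b])" "sum_list ys = - path_cost n a b"
proof -
  define alt :: "nat \<Rightarrow> int \<Rightarrow> int list" where "alt j m = concat (replicate j [- m, m])" for j m
  have alt: "length (alt j m) = 2 * j" "sum_list (alt j m) = 0" "set (alt j m) \<subseteq> {- m, m}" for j m
    by (induction j) (auto simp: alt_def)
  show thesis
  proof (cases "even n")
    case True
    then obtain j where "n = 2 * j + 2"
      using assms(1) by (metis dvdE mult_Suc_right not_gr_zero old.nat.exhaust add.commute mult_0_right)
    moreover have "successively (opposed id) (a # alt j a @ - a # [min a (- b), b])"
      unfolding alt_def by (rule alternating_opposed) auto
    ultimately show thesis
      using assms alt[of j a] True
      by (intro that[of "alt j a @ [- a, min a (- b)]"]) (auto simp: path_cost_def)
  next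
    case False
    then obtain j where "n = 2 * j + 1" using oddE by blast
    moreover have "successively (opposed id) (a # alt j (max a b) @ - max a b # [b])"
      unfolding alt_def by (rule alternating_opposed) auto
    ultimately show thesis
      using assms alt[of j "max a b"] False
      by (intro that[of "alt j (max a b) @ [- max a b]"]) (auto simp: path_cost_def)
  qed
qed

text \<open>Turns the list of labels into a function on vertices. The ends may coincide, as on a
  path that replaces a loop.\<close>

lemma path_labels_exist:
  assumes "xs \<noteq> []" "distinct xs" "u \<notin> set xs" "v \<notin> set xs" "\<bar>g u\<bar> \<le> 1" "\<bar>g v\<bar> \<le> 1"
  shows "\<exists>h. (\<forall>x. \<bar>h x\<bar> \<le> 1) \<and> h u = g u \<and> h v = g v \<and>
    successively (opposed h) (u # xs @ [v]) \<and>
    sum_list (map h xs) = - path_cost (length xs) (g u) (g v)"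
proof -
  obtain ys where ys: "length ys = length xs" "\<forall>y \<in> set ys. \<bar>y\<bar> \<le> 1"
    "successively (opposed id) (g u # ys @ [g v])" "sum_list ys = - path_cost (length xs) (g u) (g v)"
    using path_cost_attained[of "length xs" "g u" "g v"] assms by auto
  define h where "h x = (if x \<in> set xs then the (map_of (zip xs ys) x)
    else if x = u \<or> x = v then g x else 0)" for x
  have "map (\<lambda>x. the (map_of (zip xs ys) x)) xs = ys"
    using ys(1) assms(2) by (intro nth_equalityI) (auto simp: map_of_zip_nth)
  then have h: "map h xs = ys" by (simp add: h_def cong: map_cong)
  then have "\<bar>h x\<bar> \<le> 1" if "x \<in> set xs" for x
    using that ys(2) by (metis image_eqI list.set_map)
  then have "\<forall>x. \<bar>h x\<bar> \<le> 1" using assms(5,6) by (auto simp: h_def)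
  moreover have uv: "h u = g u" "h v = g v" using assms by (auto simp: h_def)
  moreover have "successively (opposed h) (u # xs @ [v])"
  proof -
    have "successively (opposed id) (map h (u # xs @ [v]))" using ys(3) uv h by simp
    then show ?thesis unfolding successively_map by simp
  qed
  ultimately show ?thesis using ys(4) h by (intro exI[of _ h]) auto
qed

text \<open>The residual set \<open>R\<close> will consist of the cyclic components of a graph, where the edge
  inequalities force the labels to sum to at most 0.\<close>

locale path_system =
  fixes G :: "'a graph" and B R :: "'a set" and I :: "'c set"
    and src tgt :: "'c \<Rightarrow> 'a" and inner :: "'c \<Rightarrow> 'a list"
  assumes fin: "finite B" "finite R" "finite I"
    and verts_eq: "verts G = B \<union> (\<Union>c \<in> I. set (inner c)) \<union> R"
    and disj: "B \<inter> R = {}" "\<And>c. c \<in> I \<Longrightarrow> set (inner c) \<inter> (B \<union> R) = {}"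
      "\<And>c d. c \<in> I \<Longrightarrow> d \<in> I \<Longrightarrow> c \<noteq> d \<Longrightarrow> set (inner c) \<inter> set (inner d) = {}"
    and inner: "\<And>c. c \<in> I \<Longrightarrow> distinct (inner c) \<and> inner c \<noteq> []"
    and ends: "\<And>c. c \<in> I \<Longrightarrow> src c \<in> B \<and> tgt c \<in> B"
    and path_edges: "\<And>c. c \<in> I \<Longrightarrow> set (walk_edges (src c # inner c @ [tgt c])) \<subseteq> edges G"
    and edge_cases: "\<And>e. e \<in> edges G \<Longrightarrow>
      e \<subseteq> R \<or> (\<exists>c \<in> I. e \<in> set (walk_edges (src c # inner c @ [tgt c])))"
    and residual: "\<And>g. admissible G g \<Longrightarrow> sum g R \<le> 0"
begin

lemma sum_verts: "sum g (verts G) = sum g B + (\<Sum>c \<in> I. sum_list (map g (inner c))) + sum g R"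
  for g :: "'a \<Rightarrow> int"
proof -
  have "sum g (\<Union>c \<in> I. set (inner c)) = (\<Sum>c \<in> I. sum g (set (inner c)))"
    using fin disj by (intro sum.UNION_disjoint) auto
  also have "\<dots> = (\<Sum>c \<in> I. sum_list (map g (inner c)))"
    using inner by (intro sum.cong refl) (simp add: sum_list_distinct_conv_sum_set)
  finally have "sum g (B \<union> (\<Union>c \<in> I. set (inner c))) = sum g B + (\<Sum>c \<in> I. sum_list (map g (inner c)))"
    using fin disj by (subst sum.union_disjoint) auto
  then show ?thesis unfolding verts_eq using fin disj by (subst sum.union_disjoint) auto
qed

text \<open>Inner labels are eliminated: once the labels on \<open>B\<close> are fixed, the paths
  can be optimised independently. Two decompositions of the same subdivided graph use this: into the
  paths that replace edges, and into the maximal paths through vertices of degree 2.\<close>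

lemma admissible_iff:
  "(\<exists>g. admissible G g \<and> k \<le> sum g (verts G)) \<longleftrightarrow>
   (\<exists>g. (\<forall>v. \<bar>g v\<bar> \<le> 1) \<and>
     k \<le> sum g B - (\<Sum>c \<in> I. path_cost (length (inner c)) (g (src c)) (g (tgt c))))"
  (is "_ \<longleftrightarrow> (\<exists>g. _ \<and> k \<le> _ - sum (?cost g) I)")
proof
  assume "\<exists>g. admissible G g \<and> k \<le> sum g (verts G)"
  then obtain g where g: "admissible G g" "k \<le> sum g (verts G)" by blast
  have "sum_list (map g (inner c)) \<le> - ?cost g c" if "c \<in> I" for c
  proof (rule inner_sum_le_path_cost)
    have "successively (\<lambda>x y. {x, y} \<in> edges G) (src c # inner c @ [tgt c])"
      using path_edges[OF that] by (simp only: walk_edges_subset_iff)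
    then show "successively (opposed g) (src c # inner c @ [tgt c])"
      using g(1) by (elim successively_mono) (auto simp: admissible_def)
  qed
  then have "(\<Sum>c \<in> I. sum_list (map g (inner c))) \<le> (\<Sum>c \<in> I. - ?cost g c)" by (rule sum_mono)
  then have "sum g (verts G) \<le> sum g B - sum (?cost g) I"
    using residual[OF g(1)] by (simp add: sum_verts sum_negf)
  then show "\<exists>g. (\<forall>v. \<bar>g v\<bar> \<le> 1) \<and> k \<le> sum g B - sum (?cost g) I"
    using g by (intro exI[of _ g]) (auto simp: admissible_def)
next
  assume "\<exists>g. (\<forall>v. \<bar>g v\<bar> \<le> 1) \<and> k \<le> sum g B - sum (?cost g) I"
  then obtain g where g: "\<forall>v. \<bar>g v\<bar> \<le> 1" "k \<le> sum g B - sum (?cost g) I" by blast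
  have "\<forall>c \<in> I. \<exists>h. (\<forall>x. \<bar>h x\<bar> \<le> 1) \<and> h (src c) = g (src c) \<and> h (tgt c) = g (tgt c) \<and>
    successively (opposed h) (src c # inner c @ [tgt c]) \<and>
    sum_list (map h (inner c)) = - ?cost g c"
    using inner disj(2) ends g(1) by (intro ballI path_labels_exist) auto
  then obtain h where "\<forall>c \<in> I. (\<forall>x. \<bar>h c x\<bar> \<le> 1) \<and> h c (src c) = g (src c) \<and> h c (tgt c) = g (tgt c) \<and>
    successively (opposed (h c)) (src c # inner c @ [tgt c]) \<and>
    sum_list (map (h c) (inner c)) = - ?cost g c"
    by (rule bchoice[THEN exE])
  then have h: "\<And>c x. c \<in> I \<Longrightarrow> \<bar>h c x\<bar> \<le> 1"
    "\<And>c. c \<in> I \<Longrightarrow> h c (src c) = g (src c)" "\<And>c. c \<in> I \<Longrightarrow> h c (tgt c) = g (tgt c)"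
    "\<And>c. c \<in> I \<Longrightarrow> successively (opposed (h c)) (src c # inner c @ [tgt c])"
    "\<And>c. c \<in> I \<Longrightarrow> sum_list (map (h c) (inner c)) = - ?cost g c"
    by auto
  \<comment> \<open>The labellings chosen path by path are glued. They agree on shared ends, where
    all equal \<open>g\<close>, and the choice of \<open>c\<close> is unique since inner vertices of
    different paths are disjoint. Label 0 on \<open>R\<close> satisfies every edge inside
    \<open>R\<close>.\<close>
  define f where "f x = (if x \<in> B then g x else if x \<in> R then 0
    else if \<exists>c \<in> I. x \<in> set (inner c) then h (SOME c. c \<in> I \<and> x \<in> set (inner c)) x else 0)" for x
  have f_inner: "f x = h c x" if "c \<in> I" "x \<in> set (inner c)" for c x
  proof -
    have "(SOME c. c \<in> I \<and> x \<in> set (inner c)) = c"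
      using that disj(3) by (intro some_equality) auto
    then show ?thesis using that disj(2)[OF that(1)] by (auto simp: f_def)
  qed
  have f_path: "f x = h c x" if "c \<in> I" "x \<in> set (src c # inner c @ [tgt c])" for c x
  proof -
    have "f y = g y" if "y \<in> B" for y using that by (simp add: f_def)
    then have "f (src c) = h c (src c)" "f (tgt c) = h c (tgt c)"
      using h(2,3) ends that(1) by simp_all
    then show ?thesis using that f_inner by auto
  qed
  have opp: "successively (opposed f) (src c # inner c @ [tgt c])" if "c \<in> I" for c
    using h(4)[OF that] f_path[OF that] by (elim successively_mono) auto
  have "\<bar>f x\<bar> \<le> 1" for x
  proof (cases "\<exists>c \<in> I. x \<in> set (inner c)")
    case True
    then show ?thesis using f_inner h(1) by metis
  qed (use g(1) in \<open>auto simp: f_def\<close>)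
  moreover have "f u + f v \<le> 0" if "{u, v} \<in> edges G" for u v
    using edge_cases[OF that]
  proof
    assume "{u, v} \<subseteq> R"
    then show ?thesis using disj(1) by (auto simp: f_def)
  next
    assume "\<exists>c \<in> I. {u, v} \<in> set (walk_edges (src c # inner c @ [tgt c]))"
    then obtain c where c: "c \<in> I" "{u, v} \<in> set (walk_edges (src c # inner c @ [tgt c]))" by blast
    have "successively (\<lambda>x y. {x, y} \<in> {{x, y} |x y. opposed f x y}) (src c # inner c @ [tgt c])"
      using opp[OF c(1)] by (elim successively_mono) blast+
    then have "{u, v} \<in> {{x, y} |x y. opposed f x y}"
      using c(2) unfolding walk_edges_subset_iff[symmetric] by blast
    then show ?thesis by (auto simp: doubleton_eq_iff)
  qed
  ultimately have "admissible G f" by (simp add: admissible_def)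
  moreover have "sum f B = sum g B" by (intro sum.cong) (auto simp: f_def)
  moreover have "sum f R = 0" using disj(1) by (intro sum.neutral) (auto simp: f_def)
  moreover have "(\<Sum>c \<in> I. sum_list (map f (inner c))) = (\<Sum>c \<in> I. - ?cost g c)"
    using h(5) f_inner by (intro sum.cong refl) (simp cong: map_cong)
  ultimately show "\<exists>g. admissible G g \<and> k \<le> sum g (verts G)"
    using g(2) by (intro exI[of _ f]) (simp add: sum_verts sum_negf)
qed

end


subsection \<open>The subdivided graph\<close>

text \<open>The choice term is that of \<open>edge_path\<close>, so that both orient the edge in the
  same way.\<close>

definition edge_src :: "'v set \<times> nat \<Rightarrow> 'v" where
  "edge_src e = fst (SOME p. fst e = {fst p, snd p})"

definition edge_tgt :: "'v set \<times> nat \<Rightarrow> 'v" where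
  "edge_tgt e = snd (SOME p. fst e = {fst p, snd p})"

definition edge_inner :: "'v set \<times> nat \<Rightarrow> nat \<Rightarrow> 'v zvert list" where
  "edge_inner e i = map (New e i) [1..<Suc (path_len e)]"

text \<open>Entry number \<open>m\<close> of the list \<open>edge_path e i\<close>, given by cases
  so that adjacency on the path can be analysed without list indexing.\<close>

definition edge_pos :: "'v set \<times> nat \<Rightarrow> nat \<Rightarrow> nat \<Rightarrow> 'v zvert" where
  "edge_pos e i m = (if m = 0 then Orig (edge_src e)
    else if m \<le> path_len e then New e i m else Orig (edge_tgt e))"

text \<open>Parallel edges of equal weight have no names of their own; the copy number supplies an
  index set for the replacing paths.\<close>

definition copies :: "'v mgraph \<Rightarrow> (('v set \<times> nat) \<times> nat) set" where
  "copies \<Gamma> = (SIGMA e:set_mset (medges \<Gamma>). {..<count (medges \<Gamma>) e})"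

text \<open>Maximum plus minimum over the set of endpoints is the sum of the two end labels, also
  for a loop, where both equal the label of its vertex. Thus no orientation has to be
  chosen.\<close>

definition edge_cost :: "('v \<Rightarrow> int) \<Rightarrow> 'v set \<times> nat \<Rightarrow> int" where
  "edge_cost g e = (if snd e = 0 then max 0 (Max (g ` fst e) + Min (g ` fst e)) else Max (g ` fst e))"

definition potential :: "'v mgraph \<Rightarrow> ('v \<Rightarrow> int) \<Rightarrow> int" where
  "potential \<Gamma> g = sum g (mverts \<Gamma>) - (\<Sum>e \<in># medges \<Gamma>. edge_cost g e)"

lemma wf_mgraph_ends:
  assumes "wf_mgraph \<Gamma>" "e \<in># medges \<Gamma>"
  shows "fst e = {edge_src e, edge_tgt e}" "edge_src e \<in> mverts \<Gamma>" "edge_tgt e \<in> mverts \<Gamma>"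
proof -
  obtain u v where uv: "u \<in> mverts \<Gamma>" "v \<in> mverts \<Gamma>" "fst e = {u, v}"
    using assms by (auto simp: wf_mgraph_def)
  then have "fst e = {fst (u, v), snd (u, v)}" by simp
  then show *: "fst e = {edge_src e, edge_tgt e}"
    unfolding edge_src_def edge_tgt_def by (rule someI)
  show "edge_src e \<in> mverts \<Gamma>" "edge_tgt e \<in> mverts \<Gamma>"
    using uv * by (auto simp: doubleton_eq_iff)
qed

lemma edge_path_eq:
  "edge_path e i = Orig (edge_src e) # edge_inner e i @ [Orig (edge_tgt e)]"
  by (simp add: edge_path_def edge_src_def edge_tgt_def edge_inner_def case_prod_beta Let_def del: upt_Suc)

lemma length_edge_path [simp]: "length (edge_path e i) = path_len e + 2"
  by (simp add: edge_path_eq edge_inner_def)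

lemma edge_path_nth: "m < path_len e + 2 \<Longrightarrow> edge_path e i ! m = edge_pos e i m"
  by (auto simp: edge_path_eq edge_inner_def edge_pos_def nth_append nth_Cons' simp del: upt_Suc)

lemma set_edge_inner: "set (edge_inner e i) = {New e i j |j. 1 \<le> j \<and> j \<le> path_len e}"
  by (auto simp: edge_inner_def simp del: upt_Suc)

lemma set_walk_edges_nth: "set (walk_edges p) = {{p ! i, p ! Suc i} |i. Suc i < length p}"
  by (force simp: walk_edges_def set_zip nth_tl)

lemma set_walk_edges_edge_path:
  "set (walk_edges (edge_path e i)) = {{edge_pos e i m, edge_pos e i (Suc m)} |m. m \<le> path_len e}"
proof -
  have "(edge_path e i ! m = edge_pos e i m) \<and> (edge_path e i ! Suc m = edge_pos e i (Suc m))"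
    if "m \<le> path_len e" for m using that by (simp add: edge_path_nth)
  then have "{{edge_path e i ! m, edge_path e i ! Suc m} |m. m \<le> path_len e} =
    {{edge_pos e i m, edge_pos e i (Suc m)} |m. m \<le> path_len e}"
    by (intro Collect_cong ex_cong1) auto
  then show ?thesis unfolding set_walk_edges_nth by (simp add: less_Suc_eq_le)
qed

lemma finite_copies [simp]: "finite (copies \<Gamma>)"
  by (simp add: copies_def)

lemma edges_zeta: "edges (zeta \<Gamma>) = (\<Union>(e, i) \<in> copies \<Gamma>. set (walk_edges (edge_path e i)))"
  by (auto simp: zeta_def copies_def)

lemma verts_zeta: "verts (zeta \<Gamma>) = Orig ` mverts \<Gamma> \<union> (\<Union>(e, i) \<in> copies \<Gamma>. set (edge_inner e i))"
  by (auto simp: zeta_def copies_def set_edge_inner)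

lemma zeta_edge_cases:
  assumes "{x, y} \<in> edges (zeta \<Gamma>)"
  obtains e i m where "(e, i) \<in> copies \<Gamma>" "m \<le> path_len e"
    "x = edge_pos e i m \<and> y = edge_pos e i (Suc m) \<or> y = edge_pos e i m \<and> x = edge_pos e i (Suc m)"
  using assms unfolding edges_zeta set_walk_edges_edge_path by (auto simp: doubleton_eq_iff)

lemma path_len_ge2: "2 \<le> path_len e"
  by (simp add: path_len_def)

lemma path_len_cases: "path_len e = 2 \<or> path_len e = 3 \<or> path_len e = 5"
  by (simp add: path_len_def)

lemma even_path_len: "even (path_len e) \<longleftrightarrow> snd e = 0"
  by (simp add: path_len_def)

lemma edge_pos_New: "m \<le> path_len e' + 1 \<Longrightarrow>
    edge_pos e' i' m = New e i j \<longleftrightarrow> e' = e \<and> i' = i \<and> m = j \<and> 1 \<le> j \<and> j \<le> path_len e"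
  by (auto simp: edge_pos_def)

lemma copies_edge: "(e, i) \<in> copies \<Gamma> \<Longrightarrow> e \<in># medges \<Gamma>"
  by (simp add: copies_def)

section \<open>Degrees and 4-cycles in subdivided graphs\<close>

lemma wf_zeta:
  assumes "wf_mgraph \<Gamma>" shows "wf_graph (zeta \<Gamma>)"
proof -
  have "edge_pos e i m \<in> verts (zeta \<Gamma>)" if "(e, i) \<in> copies \<Gamma>" for e i m
    using wf_mgraph_ends[OF assms copies_edge[OF that]] that
    by (force simp: edge_pos_def verts_zeta set_edge_inner)
  then have "\<exists>u \<in> verts (zeta \<Gamma>). \<exists>v \<in> verts (zeta \<Gamma>). e = {u, v}" if "e \<in> edges (zeta \<Gamma>)" for e
    using that unfolding edges_zeta set_walk_edges_edge_path by blast
  moreover have "finite (verts (zeta \<Gamma>))"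
    using assms by (auto simp: verts_zeta wf_mgraph_def)
  ultimately show ?thesis by (auto simp: wf_graph_def)
qed

lemma zeta_no_Orig_edge: "{Orig u, Orig v} \<notin> edges (zeta \<Gamma>)"
proof
  assume "{Orig u, Orig v} \<in> edges (zeta \<Gamma>)"
  then obtain e i m where "m \<le> path_len e" "(Orig u = edge_pos e i m \<and> Orig v = edge_pos e i (Suc m) \<or>
    Orig v = edge_pos e i m \<and> Orig u = edge_pos e i (Suc m))"
    by (rule zeta_edge_cases)
  then show False using path_len_ge2[of e] by (auto simp: edge_pos_def split: if_splits)
qed

lemma zeta_no_loop: "{x, x} \<notin> edges (zeta \<Gamma>)"
proof
  assume "{x, x} \<in> edges (zeta \<Gamma>)"
  then obtain e i m where "m \<le> path_len e" "(x = edge_pos e i m \<and> x = edge_pos e i (Suc m) \<or>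
    x = edge_pos e i m \<and> x = edge_pos e i (Suc m))"
    by (rule zeta_edge_cases)
  then show False using path_len_ge2[of e] by (auto simp: edge_pos_def split: if_splits)
qed

lemma nbrs_New:
  assumes "(e, i) \<in> copies \<Gamma>" "1 \<le> j" "j \<le> path_len e"
  shows "nbrs (zeta \<Gamma>) (New e i j) = {edge_pos e i (j - 1), edge_pos e i (j + 1)}"
proof (intro equalityI subsetI)
  fix w assume "w \<in> nbrs (zeta \<Gamma>) (New e i j)"
  then have "{New e i j, w} \<in> edges (zeta \<Gamma>)" by (simp add: nbrs_def)
  then obtain e' i' m where m: "m \<le> path_len e'"
    "New e i j = edge_pos e' i' m \<and> w = edge_pos e' i' (Suc m) \<or>
     w = edge_pos e' i' m \<and> New e i j = edge_pos e' i' (Suc m)"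
    by (rule zeta_edge_cases)
  have "edge_pos e' i' m = New e i j \<longleftrightarrow> e' = e \<and> i' = i \<and> m = j \<and> 1 \<le> j \<and> j \<le> path_len e"
    "edge_pos e' i' (Suc m) = New e i j \<longleftrightarrow> e' = e \<and> i' = i \<and> Suc m = j \<and> 1 \<le> j \<and> j \<le> path_len e"
    using m(1) by (intro edge_pos_New; simp)+
  moreover have "Suc m = j \<Longrightarrow> m = j - 1" by simp
  ultimately show "w \<in> {edge_pos e i (j - 1), edge_pos e i (j + 1)}"
    using m(2) by (metis Suc_eq_plus1 insertCI)
next
  have edge: "{edge_pos e i m, edge_pos e i (Suc m)} \<in> edges (zeta \<Gamma>)" if "m \<le> path_len e" for m
    using assms(1) that unfolding edges_zeta set_walk_edges_edge_path by blast
  have "edge_pos e i j = New e i j" using assms by (simp add: edge_pos_def)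
  moreover have "Suc (j - 1) = j" using assms by simp
  ultimately have "{New e i j, edge_pos e i (j - 1)} \<in> edges (zeta \<Gamma>)"
    "{New e i j, edge_pos e i (j + 1)} \<in> edges (zeta \<Gamma>)"
    using edge[of "j - 1"] edge[of j] assms by (simp_all add: insert_commute)
  then show "w \<in> nbrs (zeta \<Gamma>) (New e i j)" if "w \<in> {edge_pos e i (j - 1), edge_pos e i (j + 1)}" for w
    using that by (auto simp: nbrs_def)
qed

lemma New_in_verts_zeta:
  "New e i j \<in> verts (zeta \<Gamma>) \<longleftrightarrow> (e, i) \<in> copies \<Gamma> \<and> 1 \<le> j \<and> j \<le> path_len e"
  by (auto simp: verts_zeta set_edge_inner)

lemma Orig_in_verts_zeta: "Orig v \<in> verts (zeta \<Gamma>) \<longleftrightarrow> v \<in> mverts \<Gamma>"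
  by (auto simp: verts_zeta set_edge_inner)

lemma deg_New: "New e i j \<in> verts (zeta \<Gamma>) \<Longrightarrow> deg (zeta \<Gamma>) (New e i j) = 2"
  using nbrs_New[of e i \<Gamma> j] zeta_no_loop path_len_ge2[of e]
  by (auto simp: New_in_verts_zeta deg_def edge_pos_def split: if_splits)

text \<open>The core of the absence of 4-cycles: two new vertices with two common neighbours have
  equal neighbourhoods, since new vertices have degree 2.\<close>

lemma nbrs_New_inj:
  assumes wf: "wf_mgraph \<Gamma>" and x: "New e i j \<in> verts (zeta \<Gamma>)" and y: "New e' i' j' \<in> verts (zeta \<Gamma>)"
    and eq: "nbrs (zeta \<Gamma>) (New e i j) = nbrs (zeta \<Gamma>) (New e' i' j')"
  shows "New e i j = New e' i' j'"
proof -
  have xr: "(e, i) \<in> copies \<Gamma>" "1 \<le> j" "j \<le> path_len e" using x by (auto simp: New_in_verts_zeta)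
  have yr: "(e', i') \<in> copies \<Gamma>" "1 \<le> j'" "j' \<le> path_len e'" using y by (auto simp: New_in_verts_zeta)
  have eq': "{edge_pos e i (j - 1), edge_pos e i (j + 1)} = {edge_pos e' i' (j' - 1), edge_pos e' i' (j' + 1)}"
    using eq by (simp only: nbrs_New[OF xr] nbrs_New[OF yr])
  \<comment> \<open>A path has at least two inner vertices, so some neighbour is new as well and
    reveals the copy of the edge.\<close>
  have "\<exists>m. New e i m \<in> {edge_pos e i (j - 1), edge_pos e i (j + 1)}"
    using xr path_len_ge2[of e] by (auto simp: edge_pos_def)
  then have same: "e' = e" "i' = i"
    unfolding eq' by (auto simp: edge_pos_def split: if_splits)
  \<comment> \<open>With three inner vertices and equal ends, positions 1 and 3 would have the same
    neighbours.\<close>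
  have "path_len e = 3 \<Longrightarrow> edge_src e \<noteq> edge_tgt e"
    using wf_mgraph_ends(1)[OF wf copies_edge[OF xr(1)]] by (auto simp: path_len_def split: if_splits)
  then have "j = j'"
    using eq' xr(2,3) yr(2,3) path_len_cases[of e] unfolding same edge_pos_def doubleton_eq_iff
    by (auto split: if_splits)
  then show ?thesis using same by simp
qed

text \<open>Replacing a weight-1 loop by a path with only three inner vertices would create a 4-cycle.\<close>

lemma K22_free_zeta:
  assumes wf: "wf_mgraph \<Gamma>" shows "K22_free (zeta \<Gamma>)"
proof -
  have New_case: "v\<^sub>1 = v\<^sub>2"
    if edges: "{u\<^sub>1, v\<^sub>1} \<in> edges (zeta \<Gamma>)" "{u\<^sub>1, v\<^sub>2} \<in> edges (zeta \<Gamma>)"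
      "{u\<^sub>2, v\<^sub>1} \<in> edges (zeta \<Gamma>)" "{u\<^sub>2, v\<^sub>2} \<in> edges (zeta \<Gamma>)"
      and neq: "u\<^sub>1 \<noteq> u\<^sub>2" and New: "v\<^sub>1 = New e i j" "v\<^sub>2 = New e' i' j'" for u\<^sub>1 u\<^sub>2 v\<^sub>1 v\<^sub>2 e i j e' i' j'
  proof -
    have v: "v\<^sub>1 \<in> verts (zeta \<Gamma>)" "v\<^sub>2 \<in> verts (zeta \<Gamma>)"
      using edges wf_graph_edge_verts[OF wf_zeta[OF wf]] by blast+
    have two: "nbrs (zeta \<Gamma>) v = {u\<^sub>1, u\<^sub>2}"
      if "v \<in> verts (zeta \<Gamma>)" "v = New e i j" "{u\<^sub>1, v} \<in> edges (zeta \<Gamma>)" "{u\<^sub>2, v} \<in> edges (zeta \<Gamma>)" for v e i j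
    proof -
      have "u\<^sub>1 \<in> nbrs (zeta \<Gamma>) v" "u\<^sub>2 \<in> nbrs (zeta \<Gamma>) v"
        using that(3,4) by (simp_all add: nbrs_def insert_commute)
      moreover have "nbrs (zeta \<Gamma>) v = {edge_pos e i (j - 1), edge_pos e i (j + 1)}"
        using that(1,2) by (simp add: New_in_verts_zeta nbrs_New)
      ultimately show ?thesis using neq by auto
    qed
    have "nbrs (zeta \<Gamma>) v\<^sub>1 = nbrs (zeta \<Gamma>) v\<^sub>2" using two v New edges by metis
    then show ?thesis using nbrs_New_inj[OF wf] v New by metis
  qed
  show ?thesis
    unfolding K22_free_def
  proof (intro allI impI)
    fix u\<^sub>1 u\<^sub>2 v\<^sub>1 v\<^sub>2
    assume *: "{u\<^sub>1, v\<^sub>1} \<in> edges (zeta \<Gamma>) \<and> {u\<^sub>1, v\<^sub>2} \<in> edges (zeta \<Gamma>) \<and>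
      {u\<^sub>2, v\<^sub>1} \<in> edges (zeta \<Gamma>) \<and> {u\<^sub>2, v\<^sub>2} \<in> edges (zeta \<Gamma>)"
    then have **: "{v\<^sub>1, u\<^sub>1} \<in> edges (zeta \<Gamma>)" "{v\<^sub>2, u\<^sub>1} \<in> edges (zeta \<Gamma>)"
      "{v\<^sub>1, u\<^sub>2} \<in> edges (zeta \<Gamma>)" "{v\<^sub>2, u\<^sub>2} \<in> edges (zeta \<Gamma>)"
      by (simp_all add: insert_commute)
    \<comment> \<open>Original vertices are never adjacent. Hence if one of the \<open>v\<close>s is
      original, then both \<open>u\<close>s are new.\<close>
    have "(\<exists>e i j e' i' j'. v\<^sub>1 = New e i j \<and> v\<^sub>2 = New e' i' j') \<or>
      (\<exists>e i j e' i' j'. u\<^sub>1 = New e i j \<and> u\<^sub>2 = New e' i' j')"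
      using * by (cases u\<^sub>1; cases u\<^sub>2; cases v\<^sub>1; cases v\<^sub>2; simp add: zeta_no_Orig_edge)
    then show "u\<^sub>1 = u\<^sub>2 \<or> v\<^sub>1 = v\<^sub>2"
      using New_case * ** by metis
  qed
qed

section \<open>The gap of a subdivided graph as an optimum of the potential\<close>

lemma sum_mset_conv_count:
  fixes f :: "'a \<Rightarrow> int"
  assumes "finite A" "set_mset M \<subseteq> A"
  shows "(\<Sum>x \<in># M. f x) = (\<Sum>x \<in> A. int (count M x) * f x)"
  using assms(2)
proof (induction M)
  case (add y M)
  have "(\<Sum>x \<in> A. int (count (add_mset y M) x) * f x) =
    (\<Sum>x \<in> A. int (count M x) * f x + (if x = y then f x else 0))"
    by (intro sum.cong) (auto simp: algebra_simps)
  then show ?case using add assms(1) by (simp add: sum.distrib)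
qed simp

lemma sum_copies: "(\<Sum>c \<in> copies \<Gamma>. f (fst c)) = (\<Sum>e \<in># medges \<Gamma>. f e)" for f :: "_ \<Rightarrow> int"
proof -
  have "(\<Sum>c \<in> copies \<Gamma>. f (fst c)) = (\<Sum>e \<in> set_mset (medges \<Gamma>). \<Sum>i < count (medges \<Gamma>) e. f e)"
    unfolding copies_def by (subst sum.Sigma) (auto simp: case_prod_beta)
  also have "\<dots> = (\<Sum>e \<in># medges \<Gamma>. f e)"
    by (simp add: sum_mset_conv_count[of "set_mset (medges \<Gamma>)"])
  finally show ?thesis .
qed

lemma edge_cost_eq:
  "fst e = {u, v} \<Longrightarrow> even n \<longleftrightarrow> snd e = 0 \<Longrightarrow> edge_cost g e = path_cost n (g u) (g v)"
  by (auto simp: edge_cost_def path_cost_def max_def min_def)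

lemma path_system_zeta:
  assumes wf: "wf_mgraph \<Gamma>"
  shows "path_system (zeta \<Gamma>) (Orig ` mverts \<Gamma>) {} (copies \<Gamma>)
    (\<lambda>c. Orig (edge_src (fst c))) (\<lambda>c. Orig (edge_tgt (fst c))) (\<lambda>c. edge_inner (fst c) (snd c))"
proof
  show "finite (Orig ` mverts \<Gamma>)" using wf by (simp add: wf_mgraph_def)
  show "verts (zeta \<Gamma>) = Orig ` mverts \<Gamma> \<union> (\<Union>c\<in>copies \<Gamma>. set (edge_inner (fst c) (snd c))) \<union> {}"
    by (auto simp: verts_zeta)
  show "e \<subseteq> {} \<or> (\<exists>c\<in>copies \<Gamma>. e \<in> set (walk_edges (Orig (edge_src (fst c)) #
    edge_inner (fst c) (snd c) @ [Orig (edge_tgt (fst c))])))" if "e \<in> edges (zeta \<Gamma>)" for e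
    using that by (force simp: edges_zeta edge_path_eq)
  fix c assume c: "c \<in> copies \<Gamma>"
  show "set (edge_inner (fst c) (snd c)) \<inter> (Orig ` mverts \<Gamma> \<union> {}) = {}"
    by (auto simp: set_edge_inner)
  show "distinct (edge_inner (fst c) (snd c)) \<and> edge_inner (fst c) (snd c) \<noteq> []"
    using path_len_ge2[of "fst c"] by (auto simp: edge_inner_def distinct_map inj_on_def simp del: upt_Suc)
  show "Orig (edge_src (fst c)) \<in> Orig ` mverts \<Gamma> \<and> Orig (edge_tgt (fst c)) \<in> Orig ` mverts \<Gamma>"
    using wf_mgraph_ends[OF wf copies_edge] c by (metis image_eqI prod.collapse)
  show "set (walk_edges (Orig (edge_src (fst c)) # edge_inner (fst c) (snd c) @
    [Orig (edge_tgt (fst c))])) \<subseteq> edges (zeta \<Gamma>)"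
    unfolding edges_zeta edge_path_eq[symmetric] using c by (auto simp: case_prod_beta)
  fix d assume d: "d \<in> copies \<Gamma>" "c \<noteq> d"
  show "set (edge_inner (fst c) (snd c)) \<inter> set (edge_inner (fst d) (snd d)) = {}"
    using d(2) by (auto simp: set_edge_inner prod_eq_iff)
qed simp_all

lemma le_gap_star_iff:
  assumes wf: "wf_mgraph \<Gamma>"
  shows "k \<le> gap_star \<Gamma> \<longleftrightarrow> (\<exists>g. (\<forall>v. \<bar>g v\<bar> \<le> 1) \<and> k \<le> potential \<Gamma> g)"
proof -
  interpret path_system "zeta \<Gamma>" "Orig ` mverts \<Gamma>" "{}" "copies \<Gamma>" "\<lambda>c. Orig (edge_src (fst c))"
    "\<lambda>c. Orig (edge_tgt (fst c))" "\<lambda>c. edge_inner (fst c) (snd c)"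
    by (rule path_system_zeta[OF wf])
  have pot: "sum g (Orig ` mverts \<Gamma>) - (\<Sum>c \<in> copies \<Gamma>. path_cost (length (edge_inner (fst c) (snd c)))
      (g (Orig (edge_src (fst c)))) (g (Orig (edge_tgt (fst c))))) = potential \<Gamma> (g \<circ> Orig)" for g
  proof -
    have "path_cost (length (edge_inner (fst c) (snd c)))
      (g (Orig (edge_src (fst c)))) (g (Orig (edge_tgt (fst c)))) = edge_cost (g \<circ> Orig) (fst c)"
      if "c \<in> copies \<Gamma>" for c
    proof -
      have "fst c \<in># medges \<Gamma>" using that by (metis copies_edge prod.collapse)
      then show ?thesis
        using edge_cost_eq[OF wf_mgraph_ends(1)[OF wf], of "fst c" "path_len (fst c)" "g \<circ> Orig"]
        by (simp add: even_path_len edge_inner_def del: upt_Suc)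
    qed
    then show ?thesis
      by (simp add: potential_def sum_copies[symmetric] sum.reindex inj_on_def)
  qed
  have "k \<le> gap_star \<Gamma> \<longleftrightarrow> (\<exists>g. (\<forall>v. \<bar>g v\<bar> \<le> 1) \<and> k \<le> potential \<Gamma> (g \<circ> Orig))"
    unfolding gap_star_def le_gap_iff[OF wf_zeta[OF wf] K22_free_zeta[OF wf]] admissible_iff pot ..
  also have "\<dots> \<longleftrightarrow> (\<exists>g. (\<forall>v. \<bar>g v\<bar> \<le> 1) \<and> k \<le> potential \<Gamma> g)" (is "?L \<longleftrightarrow> ?R")
  proof
    show "?L \<Longrightarrow> ?R" by (metis comp_apply)
    assume ?R
    then obtain g where g: "\<forall>v. \<bar>g v\<bar> \<le> 1" "k \<le> potential \<Gamma> g" by blast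
    \<comment> \<open>Labels of new vertices are arbitrary here: their optimal contribution is
      already contained in the penalties.\<close>
    define f :: "'a zvert \<Rightarrow> int" where "f x = (case x of Orig v \<Rightarrow> g v | New _ _ _ \<Rightarrow> 0)" for x
    have "f \<circ> Orig = g" by (auto simp: f_def)
    moreover have "\<forall>v. \<bar>f v\<bar> \<le> 1" using g(1) by (auto simp: f_def split: zvert.split)
    ultimately show ?L using g(2) by metis
  qed
  finally show ?thesis .
qed


subsection \<open>Walks through vertices of degree 2\<close>

lemma length_walk_edges [simp]: "length (walk_edges p) = length p - 1"
  by (simp add: walk_edges_def)

lemma walk_edges_nth: "Suc i < length p \<Longrightarrow> walk_edges p ! i = {p ! i, p ! Suc i}"
  by (simp add: walk_edges_def nth_tl)

lemma walk_edges_rev: "walk_edges (rev p) = rev (walk_edges p)"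
proof (rule nth_equalityI)
  fix i assume "i < length (walk_edges (rev p))"
  then have i: "Suc i < length p" by simp
  then have "Suc (length p - Suc (Suc i)) = length p - Suc i" by simp
  then show "walk_edges (rev p) ! i = rev (walk_edges p) ! i"
    using i by (simp add: walk_edges_nth rev_nth insert_commute)
qed simp

lemma walk_edges_snoc: "p \<noteq> [] \<Longrightarrow> walk_edges (p @ [z]) = walk_edges p @ [{last p, z}]"
  by (induction p rule: induct_list012) auto

lemma walk_edge_subset: "e \<in> set (walk_edges p) \<Longrightarrow> e \<subseteq> set p"
  by (auto simp: set_walk_edges_nth)

lemma distinct_walk_edges: "distinct p \<Longrightarrow> distinct (walk_edges p)"
proof (induction p rule: induct_list012)
  case (3 x y zs)
  then show ?case using walk_edge_subset[of "{x, y}" "y # zs"] by auto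
qed simp_all

text \<open>The only edge at the last vertex \<open>y\<close> of a simple path is
  \<open>{w, y}\<close>. The vertex \<open>z\<close> may lie further back on the path, which occurs
  when a walk closes up at its starting point.\<close>

lemma new_walk_edge:
  assumes "distinct (p @ [w, y])" "z \<noteq> w" "z \<noteq> y"
  shows "{y, z} \<notin> set (walk_edges (p @ [w, y]))"
proof
  assume "{y, z} \<in> set (walk_edges (p @ [w, y]))"
  then have "{y, z} = {w, y} \<or> {y, z} \<in> set (walk_edges (p @ [w]))"
    using walk_edges_snoc[of "p @ [w]" y] by auto
  then have "{y, z} = {w, y} \<or> {y, z} \<subseteq> set (p @ [w])" using walk_edge_subset by blast
  then show False using assms by (auto simp: doubleton_eq_iff)
qed

locale loopless_graph =
  fixes G :: "'a graph"
  assumes wf: "wf_graph G" and no_loop: "{x, x} \<notin> edges G"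
begin

abbreviation (input) nbr :: "'a \<Rightarrow> 'a \<Rightarrow> bool" where "nbr x y \<equiv> {x, y} \<in> edges G"

lemma deg_card: "deg G v = card (nbrs G v)"
  using no_loop[of v] by (simp add: deg_def)

lemma nbrs_deg_2:
  assumes "deg G x = 2" "nbr x y" "nbr x z" "y \<noteq> z"
  shows "nbrs G x = {y, z}"
proof -
  have "{y, z} \<subseteq> nbrs G x" using assms by (simp add: nbrs_def)
  moreover have "card {y, z} = card (nbrs G x)" using assms by (simp add: deg_card)
  ultimately show ?thesis using card_subset_eq[OF finite_nbrs[OF wf]] by metis
qed

section \<open>Walks between branch vertices and their uniqueness\<close>

lemma kappa_walk_iff:
  "kappa_walk G p \<longleftrightarrow> successively nbr p \<and> distinct (walk_edges p) \<and>
     (\<exists>u xs v. p = u # xs @ [v] \<and> deg G u \<noteq> 2 \<and> deg G v \<noteq> 2 \<and>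
        distinct xs \<and> (\<forall>x \<in> set xs. deg G x = 2))"
proof -
  have verts: "set p \<subseteq> verts G" if "successively nbr p" "2 \<le> length p"
  proof
    fix x assume "x \<in> set p"
    then obtain i where i: "i < length p" "p ! i = x" by (auto simp: in_set_conv_nth)
    then have "(Suc i < length p) \<or> (i = Suc (i - 1))" using that(2) by auto
    then show "x \<in> verts G"
      using i that(1) wf_graph_edge_verts[OF wf] unfolding successively_conv_nth by metis
  qed
  have "2 \<le> length p \<Longrightarrow> p \<noteq> []" by auto
  moreover have "(\<exists>u xs v. p = u # xs @ [v] \<and> deg G u \<noteq> 2 \<and> deg G v \<noteq> 2 \<and>
    distinct xs \<and> (\<forall>x \<in> set xs. deg G x = 2)) \<Longrightarrow> 2 \<le> length p" by auto
  ultimately show ?thesis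
    unfolding kappa_walk_def walk_def walk_edges_subset_iff using verts by blast
qed

lemma kappa_walk_rev: "kappa_walk G p \<Longrightarrow> kappa_walk G (rev p)"
proof -
  assume "kappa_walk G p"
  then obtain u xs v where p: "successively nbr p" "distinct (walk_edges p)" "p = u # xs @ [v]"
      "deg G u \<noteq> 2" "deg G v \<noteq> 2" "distinct xs" "\<forall>x \<in> set xs. deg G x = 2"
    unfolding kappa_walk_iff by blast
  have "successively nbr (rev p)" using p(1) by (simp add: insert_commute)
  moreover have "distinct (walk_edges (rev p))" using p(2) by (simp add: walk_edges_rev)
  moreover have "rev p = v # rev xs @ [u]" using p(3) by simp
  ultimately show ?thesis using p(4-7) unfolding kappa_walk_iff by (metis distinct_rev set_rev)
qed

lemma kappa_walkD:
  assumes "kappa_walk G p"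
  shows "2 \<le> length p" "p = hd p # butlast (tl p) @ [last p]"
    "deg G (hd p) \<noteq> 2" "deg G (last p) \<noteq> 2"
    "distinct (butlast (tl p))" "x \<in> set (butlast (tl p)) \<Longrightarrow> deg G x = 2"
    "deg G (p ! 0) \<noteq> 2" "deg G (p ! (length p - 1)) \<noteq> 2"
    "\<lbrakk>0 < i; Suc i < length p\<rbrakk> \<Longrightarrow> deg G (p ! i) = 2"
    "Suc i < length p \<Longrightarrow> nbr (p ! i) (p ! Suc i)"
    "Suc (Suc i) < length p \<Longrightarrow> p ! i \<noteq> p ! Suc (Suc i)"
proof -
  obtain u xs v where p: "successively nbr p" "distinct (walk_edges p)" "p = u # xs @ [v]"
      "deg G u \<noteq> 2" "deg G v \<noteq> 2" "distinct xs" "\<forall>x \<in> set xs. deg G x = 2"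
    using assms unfolding kappa_walk_iff by blast
  show "2 \<le> length p" "p = hd p # butlast (tl p) @ [last p]"
    "deg G (hd p) \<noteq> 2" "deg G (last p) \<noteq> 2"
    "distinct (butlast (tl p))" "x \<in> set (butlast (tl p)) \<Longrightarrow> deg G x = 2"
    "deg G (p ! 0) \<noteq> 2" "deg G (p ! (length p - 1)) \<noteq> 2"
    using p(3-7) by (auto simp: nth_append)
  show "deg G (p ! i) = 2" if "0 < i" "Suc i < length p"
    using p(3,7) that by (auto simp: nth_append nth_Cons')
  show "nbr (p ! i) (p ! Suc i)" if "Suc i < length p"
    using p(1) that by (simp add: successively_conv_nth)
  show "p ! i \<noteq> p ! Suc (Suc i)" if "Suc (Suc i) < length p"
  proof
    assume "p ! i = p ! Suc (Suc i)"
    then have "walk_edges p ! i = walk_edges p ! Suc i"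
      using that by (simp add: walk_edges_nth insert_commute)
    then show False using p(2) that by (simp add: nth_eq_iff_index_eq)
  qed
qed

text \<open>Since no edge is traversed twice, the walk does not turn back at an inner vertex, and
  degree 2 leaves no neighbour besides its predecessor and successor. All uniqueness statements
  about walks rest on this.\<close>

lemma kappa_walk_nbrs:
  assumes "kappa_walk G p" "Suc (Suc i) < length p"
  shows "nbrs G (p ! Suc i) = {p ! i, p ! Suc (Suc i)}"
  using assms kappa_walkD(9-11)[OF assms(1)]
  by (intro nbrs_deg_2) (auto simp: insert_commute)

text \<open>Go backwards from an edge that both walks traverse in the same direction: at an inner
  vertex the predecessor is forced. Whether a position is an end is visible from the degree, so both
  walks reach their starts simultaneously.\<close>

lemma kappa_walk_agree_start:
  assumes p: "kappa_walk G p" and q: "kappa_walk G q"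
  shows "\<lbrakk>p ! i = q ! j; p ! Suc i = q ! Suc j; Suc i < length p; Suc j < length q\<rbrakk>
    \<Longrightarrow> p ! 0 = q ! 0 \<and> p ! 1 = q ! 1"
proof (induction i arbitrary: j)
  case 0
  then have "j = 0"
    using kappa_walkD(7)[OF p] kappa_walkD(9)[OF q, of j] by (cases j) auto
  then show ?case using 0 by simp
next
  case (Suc i)
  then obtain j' where j: "j = Suc j'"
    using kappa_walkD(7)[OF q] kappa_walkD(9)[OF p, of "Suc i"] by (cases j) auto
  have "{p ! i, p ! Suc (Suc i)} = {q ! j', q ! Suc (Suc j')}"
    using Suc.prems kappa_walk_nbrs[OF p, of i] kappa_walk_nbrs[OF q, of j'] j by simp
  then have "p ! i = q ! j'"
    using Suc.prems(2) j by (auto simp: doubleton_eq_iff)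
  then show ?case using Suc.IH[of j'] Suc.prems j by simp
qed

lemma kappa_walk_agree_forward:
  assumes p: "kappa_walk G p" and q: "kappa_walk G q" and start: "p ! 0 = q ! 0" "p ! 1 = q ! 1"
  shows "Suc m < length p \<Longrightarrow> Suc m < length q \<and> p ! m = q ! m \<and> p ! Suc m = q ! Suc m"
proof (induction m)
  case 0
  then show ?case using start kappa_walkD(1)[OF q] by simp
next
  case (Suc m)
  then have IH: "Suc m < length q" "p ! m = q ! m" "p ! Suc m = q ! Suc m" by simp_all
  have "deg G (q ! Suc m) = 2" using kappa_walkD(9)[OF p, of "Suc m"] Suc.prems IH by simp
  then have "Suc m \<noteq> length q - 1" using kappa_walkD(8)[OF q] by metis
  then have len: "Suc (Suc m) < length q" using IH by simp
  have "{p ! m, p ! Suc (Suc m)} = {q ! m, q ! Suc (Suc m)}"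
    using kappa_walk_nbrs[OF p Suc.prems] kappa_walk_nbrs[OF q len] IH by simp
  then show ?case using IH len by (auto simp: doubleton_eq_iff)
qed

lemma kappa_walk_agree:
  assumes p: "kappa_walk G p" and q: "kappa_walk G q"
    and "p ! i = q ! j" "p ! Suc i = q ! Suc j" "Suc i < length p" "Suc j < length q"
  shows "p = q"
proof -
  have start: "p ! 0 = q ! 0" "p ! 1 = q ! 1" using kappa_walk_agree_start[OF assms] by auto
  note fwd = kappa_walk_agree_forward[OF p q start]
    and bwd = kappa_walk_agree_forward[OF q p start[symmetric]]
  obtain a b where "length p = Suc (Suc a)" "length q = Suc (Suc b)"
    using kappa_walkD(1)[OF p] kappa_walkD(1)[OF q] by (metis add_2_eq_Suc le_Suc_ex)
  then have "length p = length q"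
    using fwd[of a] bwd[of b] by simp
  moreover have "p ! m = q ! m" if "m < length p" for m
    using fwd[of "m - 1"] start(1) that by (cases m) auto
  ultimately show ?thesis by (intro nth_equalityI) auto
qed

lemma in_inner_nth:
  assumes "x \<in> set (butlast (tl p))"
  obtains i where "Suc (Suc i) < length p" "p ! Suc i = x"
proof -
  obtain i where "i < length (butlast (tl p))" "butlast (tl p) ! i = x"
    using assms by (metis in_set_conv_nth)
  then show thesis using that[of i] by (simp add: nth_butlast nth_tl)
qed

text \<open>At a common inner vertex both walks use its only two edges, either in the same or in the
  opposite direction.\<close>

lemma kappa_walk_share:
  assumes p: "kappa_walk G p" and q: "kappa_walk G q"
    and x: "x \<in> set (butlast (tl p))" "x \<in> set (butlast (tl q))"
  shows "q = p \<or> q = rev p"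
proof -
  obtain i where i: "Suc (Suc i) < length p" "p ! Suc i = x" using x(1) by (rule in_inner_nth)
  obtain j where j: "Suc (Suc j) < length q" "q ! Suc j = x" using x(2) by (rule in_inner_nth)
  have "{p ! i, p ! Suc (Suc i)} = {q ! j, q ! Suc (Suc j)}"
    using kappa_walk_nbrs[OF p i(1)] kappa_walk_nbrs[OF q j(1)] i j by simp
  then consider "p ! Suc (Suc i) = q ! Suc (Suc j)" | "p ! Suc (Suc i) = q ! j"
    by (auto simp: doubleton_eq_iff)
  then show ?thesis
  proof cases
    case 1
    then have "p = q" using i j by (intro kappa_walk_agree[OF p q, of "Suc i" "Suc j"]) auto
    then show ?thesis by simp
  next
    case 2
    \<comment> \<open>The position of \<open>q ! Suc j\<close> in the reversed walk.\<close>
    define j' where "j' = length q - Suc (Suc j)"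
    have "rev q ! j' = q ! Suc j" "rev q ! Suc j' = q ! j" "Suc j' < length q"
      using j(1) by (simp_all add: j'_def rev_nth Suc_diff_Suc)
    then have "p = rev q"
      using 2 i j by (intro kappa_walk_agree[OF p kappa_walk_rev[OF q], of "Suc i" j']) auto
    then show ?thesis by simp
  qed
qed

text \<open>From the last vertex there is exactly one way on. It cannot lead back to an inner vertex
  of the path, whose two neighbours are already accounted for, so the path stays simple until a
  vertex of degree other than 2 is met; finiteness of the graph ends the process.\<close>

lemma kappa_walk_extend:
  assumes "successively nbr (u # xs)" "distinct (u # xs)" "xs \<noteq> []" "deg G u \<noteq> 2"
    "\<forall>x \<in> set xs. deg G x = 2"
  shows "\<exists>ys. kappa_walk G (u # xs @ ys)"
  using assms
proof (induction "card (verts G) - length xs" arbitrary: xs rule: less_induct)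
  case less
  have finV: "finite (verts G)" using wf by (simp add: wf_graph_def)
  define p where "p = u # xs"
  define n where "n = length xs"
  have n: "0 < n" "length p = Suc n" using less.prems(3) by (auto simp: n_def p_def)
  then obtain n' where n': "n = Suc n'" using gr0_implies_Suc by blast
  define y w where "y = p ! n" and "w = p ! n'"
  have y: "y = last xs" "y \<in> set xs" "y = last p"
    using n n' by (auto simp: y_def p_def n_def last_conv_nth nth_Cons' less.prems(3))
  have adj: "nbr (p ! k) (p ! Suc k)" if "k < n" for k
    using less.prems(1) that n by (simp add: p_def[symmetric] successively_conv_nth)
  have dist: "distinct p" using less.prems(2) by (simp add: p_def)
  have p_eq: "p = take n' p @ [w, y]"
    using n n' by (intro nth_equalityI) (auto simp: nth_append w_def y_def less_Suc_eq)
  have "w \<in> nbrs G y" using adj[of n'] n' by (simp add: nbrs_def w_def y_def insert_commute)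
  moreover have "card (nbrs G y) = 2" using y less.prems(5) deg_card by metis
  ultimately obtain z where z: "nbrs G y = {w, z}" "z \<noteq> w"
    unfolding card_2_iff by (metis insertE insert_commute singletonD)
  have "nbr y z" using z by (auto simp: nbrs_def)
  then have "z \<noteq> y" using no_loop by auto
  have succ: "successively nbr (u # xs @ [z])"
    using less.prems(1,3) \<open>nbr y z\<close> y by (auto simp: successively_append_iff successively_Cons)
  show ?case
  proof (cases "deg G z = 2")
    \<comment> \<open>The final vertex \<open>z\<close> may be \<open>u\<close> itself, hence only
      the edges are shown to be distinct.\<close>
    case False
    have "{last p, z} \<notin> set (walk_edges p)"
      using new_walk_edge[of "take n' p" w y z, unfolded p_eq[symmetric]] dist z(2) \<open>z \<noteq> y\<close> y
      by simp
    then have "distinct (walk_edges (p @ [z]))"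
      using walk_edges_snoc[of p z] distinct_walk_edges[OF dist] by (simp add: p_def)
    then have "distinct (walk_edges (u # xs @ [z]))" by (simp add: p_def)
    then have "kappa_walk G (u # xs @ [z])"
      unfolding kappa_walk_iff using succ False less.prems by auto
    then show ?thesis by blast
  next
    case True
    \<comment> \<open>If \<open>z\<close> lay on the path, \<open>y\<close> would be one of its two
      neighbours there, which makes \<open>z\<close> the predecessor \<open>w\<close> of
      \<open>y\<close>.\<close>
    have "z \<notin> set xs"
    proof
      assume "z \<in> set xs"
      then obtain k where k: "k < n" "p ! Suc k = z" by (auto simp: in_set_conv_nth n_def p_def)
      then have "Suc k \<noteq> n" using \<open>z \<noteq> y\<close> by (auto simp: y_def)
      then have k': "Suc k < n" using k by simp
      have "p ! k \<noteq> p ! Suc (Suc k)" using dist k' n by (simp add: nth_eq_iff_index_eq)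
      then have "nbrs G z = {p ! k, p ! Suc (Suc k)}"
        using True adj[of k] adj[of "Suc k"] k k' by (intro nbrs_deg_2) (auto simp: insert_commute)
      then have "y = p ! k \<or> y = p ! Suc (Suc k)"
        using \<open>nbr y z\<close> by (auto simp: nbrs_def insert_commute)
      then have "Suc (Suc k) = n" using dist k' n by (auto simp: y_def nth_eq_iff_index_eq)
      then show False using k z(2) n' by (simp add: w_def)
    qed
    moreover have "z \<noteq> u" using True less.prems(4) by auto
    ultimately have dist': "distinct (u # xs @ [z])" using less.prems(2) by auto
    have "set (xs @ [z]) \<subseteq> verts G"
    proof -
      have "x \<in> verts G" if "deg G x = 2" for x
      proof -
        have "nbrs G x \<noteq> {}" using that by (auto simp: deg_card)
        then show ?thesis using wf_graph_edge_verts[OF wf] by (auto simp: nbrs_def)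
      qed
      then show ?thesis using less.prems(5) True by auto
    qed
    then have "length (xs @ [z]) \<le> card (verts G)"
      using dist' finV by (metis card_mono distinct.simps(2) distinct_card)
    then have "\<exists>ys. kappa_walk G (u # (xs @ [z]) @ ys)"
      using succ dist' less.prems True by (intro less.hyps) auto
    then show ?thesis by auto
  qed
qed

lemma kappa_walk_exists:
  assumes "deg G u \<noteq> 2" "nbr u x"
  shows "\<exists>p. kappa_walk G p \<and> x \<in> set p"
proof (cases "deg G x = 2")
  case True
  have "u \<noteq> x" using assms(2) no_loop by auto
  then have "\<exists>ys. kappa_walk G (u # [x] @ ys)"
    using True assms by (intro kappa_walk_extend) auto
  then show ?thesis by auto
next
  case False
  then have "kappa_walk G (u # [] @ [x])"
    using assms unfolding kappa_walk_iff by auto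
  then show ?thesis by (metis append_Nil list.set_intros)
qed

section \<open>Walks up to reversal and components without branch vertices\<close>

definition walk_classes :: "'a list set set" where
  "walk_classes = {{p, rev p} |p. kappa_walk G p}"

text \<open>The choice made inside \<open>kappa\<close>, under a name of its own.\<close>

definition representative :: "'a list set \<Rightarrow> 'a list" where
  "representative c = (SOME p. p \<in> c)"

lemma representative:
  assumes "c \<in> walk_classes"
  shows "kappa_walk G (representative c)" "c = {representative c, rev (representative c)}"
proof -
  obtain p where p: "kappa_walk G p" "c = {p, rev p}" using assms by (auto simp: walk_classes_def)
  then have "p \<in> c" by simp
  then have "representative c \<in> c" unfolding representative_def by (rule someI)
  then show "kappa_walk G (representative c)" "c = {representative c, rev (representative c)}"
    using p kappa_walk_rev by auto
qed

lemma representative_mem: "c \<in> walk_classes \<Longrightarrow> representative c \<in> c"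
  using representative(2)[of c] by (metis insertI1)

lemma kappa_walk_length: "kappa_walk G p \<Longrightarrow> set p \<subseteq> verts G \<and> length p \<le> card (verts G) + 2"
proof -
  assume p: "kappa_walk G p"
  then have sub: "set p \<subseteq> verts G" by (simp add: kappa_walk_def walk_def)
  moreover have "set (butlast (tl p)) \<subseteq> set p"
    using in_set_butlastD list.set_sel(2) by (metis subsetI tl_Nil)
  ultimately have "card (set (butlast (tl p))) \<le> card (verts G)"
    using wf by (intro card_mono) (auto simp: wf_graph_def)
  then show ?thesis using kappa_walkD(5)[OF p] sub by (simp add: distinct_card)
qed

lemma finite_walk_classes: "finite walk_classes"
proof -
  have "walk_classes \<subseteq> (\<lambda>p. {p, rev p}) ` {p. set p \<subseteq> verts G \<and> length p \<le> card (verts G) + 2}"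
    using kappa_walk_length by (auto simp: walk_classes_def)
  moreover have "finite {p. set p \<subseteq> verts G \<and> length p \<le> card (verts G) + 2}"
    using wf by (intro finite_lists_length_le) (simp add: wf_graph_def)
  ultimately show ?thesis by (meson finite_imageI finite_subset)
qed

definition branch_verts :: "'a set" where
  "branch_verts = {v \<in> verts G. deg G v \<noteq> 2}"

text \<open>These vertices make up the components of vertices of degree 2 only, which \<kappa>
  discards.\<close>

definition cycle_verts :: "'a set" where
  "cycle_verts = {v \<in> verts G. deg G v = 2 \<and> (\<nexists>p. kappa_walk G p \<and> v \<in> set p)}"

lemma kappa_walk_nbr_mem:
  assumes p: "kappa_walk G p" and b: "b \<in> set p" "deg G b = 2" and ab: "nbr b a"
  shows "{b, a} \<in> set (walk_edges p)"
proof -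
  have "b \<in> set (butlast (tl p))"
    using kappa_walkD(2-4)[OF p] b by (metis Un_iff empty_iff list.set(1) set_ConsD set_append)
  then obtain i where i: "Suc (Suc i) < length p" "p ! Suc i = b" by (rule in_inner_nth)
  have "a \<in> {p ! i, p ! Suc (Suc i)}"
    using kappa_walk_nbrs[OF p i(1)] ab i(2) by (auto simp: nbrs_def)
  moreover have "{p ! i, p ! Suc i} \<in> set (walk_edges p)" "{p ! Suc i, p ! Suc (Suc i)} \<in> set (walk_edges p)"
    unfolding set_walk_edges_nth using i(1) Suc_lessD by blast+
  ultimately show ?thesis using i(2) by (auto simp: insert_commute)
qed

text \<open>A neighbour of degree other than 2 would be the start of a walk through
  \<open>a\<close>; a walk through a neighbour of degree 2 traverses both edges there, hence also
  meets \<open>a\<close>.\<close>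

lemma cycle_verts_closed:
  assumes "a \<in> cycle_verts" "nbr a b"
  shows "b \<in> cycle_verts"
proof -
  have no: "\<not> (kappa_walk G p \<and> a \<in> set p)" for p using assms(1) by (auto simp: cycle_verts_def)
  have ba: "nbr b a" using assms(2) by (simp add: insert_commute)
  have "deg G b = 2" using kappa_walk_exists[OF _ ba] no by blast
  moreover have "\<not> (kappa_walk G p \<and> b \<in> set p)" for p
  proof
    assume p: "kappa_walk G p \<and> b \<in> set p"
    then have "{b, a} \<in> set (walk_edges p)" using kappa_walk_nbr_mem ba \<open>deg G b = 2\<close> by blast
    then have "a \<in> set p" by (auto simp: set_walk_edges_nth doubleton_eq_iff)
    then show False using p no by blast
  qed
  ultimately show ?thesis
    using wf_graph_edge_verts[OF wf assms(2)] by (auto simp: cycle_verts_def)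
qed

text \<open>Double counting: every vertex of the set has exactly two neighbours, all inside the set.
  Adding the edge inequalities over ordered adjacent pairs gives four times the sum of the
  labels.\<close>

lemma cycle_verts_sum:
  assumes g: "admissible G g"
  shows "sum g cycle_verts \<le> 0"
proof -
  let ?R = cycle_verts
  have fin: "finite ?R" using wf by (simp add: cycle_verts_def wf_graph_def)
  have nb: "{y \<in> ?R. nbr x y} = nbrs G x" if "x \<in> ?R" for x
    using cycle_verts_closed[OF that] by (auto simp: nbrs_def)
  have two: "int (card {y \<in> ?R. nbr x y}) = 2" if "x \<in> ?R" for x
    using that nb[OF that] by (simp add: cycle_verts_def deg_card)
  have "(\<Sum>x \<in> ?R. \<Sum>y \<in> {y \<in> ?R. nbr x y}. g x + g y) \<le> 0"
    using g by (intro sum_nonpos) (auto simp: admissible_def)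
  also have "(\<Sum>x \<in> ?R. \<Sum>y \<in> {y \<in> ?R. nbr x y}. g x + g y) =
    (\<Sum>x \<in> ?R. \<Sum>y \<in> {y \<in> ?R. nbr x y}. g x) + (\<Sum>x \<in> ?R. \<Sum>y \<in> {y \<in> ?R. nbr x y}. g y)"
    by (simp add: sum.distrib)
  also have "(\<Sum>x \<in> ?R. \<Sum>y \<in> {y \<in> ?R. nbr x y}. g y) = (\<Sum>y \<in> ?R. \<Sum>x \<in> {x \<in> ?R. nbr x y}. g y)"
    using fin by (intro sum.swap_restrict)
  also have "\<dots> = (\<Sum>x \<in> ?R. \<Sum>y \<in> {y \<in> ?R. nbr x y}. g x)"
    by (simp add: insert_commute)
  also have "(\<Sum>x \<in> ?R. \<Sum>y \<in> {y \<in> ?R. nbr x y}. g x) = 2 * sum g ?R"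
    using two by (simp add: sum_distrib_left)
  finally show ?thesis by simp
qed

lemma inner_representative:
  "c \<in> walk_classes \<Longrightarrow> representative c =
    hd (representative c) # butlast (tl (representative c)) @ [last (representative c)]"
  using kappa_walkD(2) representative(1) by blast

text \<open>The assumption guarantees that every walk has an inner vertex, as paths without inner
  vertices have no label that could be adapted to the ends.\<close>

lemma path_system_kappa:
  assumes subdivided: "\<And>u v. nbr u v \<Longrightarrow> deg G u = 2 \<or> deg G v = 2"
  shows "path_system G branch_verts cycle_verts walk_classes (\<lambda>c. hd (representative c))
    (\<lambda>c. last (representative c)) (\<lambda>c. butlast (tl (representative c)))"
proof
  show "finite branch_verts" "finite cycle_verts"
    using wf by (simp_all add: branch_verts_def cycle_verts_def wf_graph_def)
  show "finite walk_classes" by (rule finite_walk_classes)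
  show "branch_verts \<inter> cycle_verts = {}" by (auto simp: branch_verts_def cycle_verts_def)
  show "sum g cycle_verts \<le> 0" if "admissible G g" for g using that by (rule cycle_verts_sum)
  fix c assume c: "c \<in> walk_classes"
  note kw = representative(1)[OF c]
  have verts: "set (representative c) \<subseteq> verts G" using kappa_walk_length[OF kw] by simp
  have inner: "set (butlast (tl (representative c))) \<subseteq> set (representative c)"
    using inner_representative[OF c] by (metis Un_upper1 set_append set_subset_Cons subset_trans)
  show "set (butlast (tl (representative c))) \<inter> (branch_verts \<union> cycle_verts) = {}"
    using kw inner kappa_walkD(6)[OF kw] by (auto simp: branch_verts_def cycle_verts_def)
  show "hd (representative c) \<in> branch_verts \<and> last (representative c) \<in> branch_verts"
    using kappa_walkD(3,4)[OF kw] inner_representative[OF c] verts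
    by (metis (mono_tags, lifting) branch_verts_def hd_in_set last_in_set list.discI mem_Collect_eq subsetD)
  show "set (walk_edges (hd (representative c) # butlast (tl (representative c)) @
    [last (representative c)])) \<subseteq> edges G"
    using kw inner_representative[OF c] by (simp add: kappa_walk_def walk_def)
  have "butlast (tl (representative c)) \<noteq> []"
  proof
    assume "butlast (tl (representative c)) = []"
    then have "nbr (hd (representative c)) (last (representative c))"
      using kw inner_representative[OF c] unfolding kappa_walk_iff
      by (metis append_Nil successively.simps(3))
    then show False using subdivided kappa_walkD(3,4)[OF kw] by blast
  qed
  then show "distinct (butlast (tl (representative c))) \<and> butlast (tl (representative c)) \<noteq> []"
    using kappa_walkD(5)[OF kw] by simp
  show "set (butlast (tl (representative c))) \<inter> set (butlast (tl (representative d))) = {}"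
    if d: "d \<in> walk_classes" "c \<noteq> d" for d
  proof (rule ccontr)
    assume "set (butlast (tl (representative c))) \<inter> set (butlast (tl (representative d))) \<noteq> {}"
    then have "representative d = representative c \<or> representative d = rev (representative c)"
      using kappa_walk_share[OF kw representative(1)[OF d(1)]] by blast
    then show False using representative(2)[OF c] representative(2)[OF d(1)] d(2) by auto
  qed
next
  \<comment> \<open>The representative of the class of \<open>p\<close> may be the reversed walk, so
    only sets of vertices and of edges are compared.\<close>
  have repr: "\<exists>c \<in> walk_classes. set (representative c) = set p \<and>
      set (walk_edges (representative c)) = set (walk_edges p)" if "kappa_walk G p" for p
  proof -
    have c: "{p, rev p} \<in> walk_classes" using that by (auto simp: walk_classes_def)
    then have "representative {p, rev p} = p \<or> representative {p, rev p} = rev p"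
      using representative(2)[OF c] by auto
    then show ?thesis using c by (intro bexI[of _ "{p, rev p}"]) (auto simp: walk_edges_rev)
  qed
  show "verts G = branch_verts \<union> (\<Union>c\<in>walk_classes. set (butlast (tl (representative c)))) \<union> cycle_verts"
  proof (intro equalityI subsetI)
    fix v assume v: "v \<in> verts G"
    show "v \<in> branch_verts \<union> (\<Union>c\<in>walk_classes. set (butlast (tl (representative c)))) \<union> cycle_verts"
    proof (cases "deg G v = 2 \<and> v \<notin> cycle_verts")
      case True
      then obtain p where "kappa_walk G p" "v \<in> set p" using v by (auto simp: cycle_verts_def)
      then obtain c where c: "c \<in> walk_classes" "v \<in> set (representative c)" using repr by metis
      then have "v \<in> set (butlast (tl (representative c)))"
        using True inner_representative[OF c(1)] kappa_walkD(3,4)[OF representative(1)[OF c(1)]]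
        by (metis Un_iff empty_iff list.set(1) set_ConsD set_append)
      then show ?thesis using c by blast
    qed (use v in \<open>auto simp: branch_verts_def\<close>)
  next
    fix v assume "v \<in> branch_verts \<union> (\<Union>c\<in>walk_classes. set (butlast (tl (representative c)))) \<union> cycle_verts"
    moreover have "set (butlast (tl (representative c))) \<subseteq> verts G" if "c \<in> walk_classes" for c
      using kappa_walk_length[OF representative(1)[OF that]] inner_representative[OF that]
      by (metis Un_upper1 set_append set_subset_Cons subset_trans)
    ultimately show "v \<in> verts G" by (auto simp: branch_verts_def cycle_verts_def)
  qed
  show "e \<subseteq> cycle_verts \<or> (\<exists>c\<in>walk_classes. e \<in> set (walk_edges (hd (representative c) #
    butlast (tl (representative c)) @ [last (representative c)])))" if e: "e \<in> edges G" for e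
  proof -
    obtain u v where "e = {u, v}" using e wf by (auto simp: wf_graph_def)
    then obtain a b where ab: "e = {a, b}" "deg G a = 2"
      using subdivided[of u v] e by (auto simp: insert_commute)
    show ?thesis
    proof (cases "a \<in> cycle_verts")
      case True
      then show ?thesis using cycle_verts_closed[OF True, of b] ab e by simp
    next
      case False
      then obtain p where p: "kappa_walk G p" "a \<in> set p"
        using ab e wf_graph_edge_verts[OF wf, of a b] by (auto simp: cycle_verts_def)
      then have "e \<in> set (walk_edges p)" using kappa_walk_nbr_mem ab e by blast
      then obtain c where "c \<in> walk_classes" "e \<in> set (walk_edges (representative c))"
        using repr[OF p(1)] by metis
      then show ?thesis using inner_representative by metis
    qed
  qed
qed

end


subsection \<open>Suppressing vertices of degree 2\<close>

lemma loopless_zeta: "wf_mgraph \<Gamma> \<Longrightarrow> loopless_graph (zeta \<Gamma>)"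
  by (intro loopless_graph.intro wf_zeta zeta_no_loop)

definition suppress :: "'v mgraph \<Rightarrow> 'v mgraph" where
  "suppress \<Gamma> = map_mgraph orig (kappa (zeta \<Gamma>))"

lemma tau3_eq: "tau3 \<Gamma> = suppress (delete \<Gamma> (deg_verts 0 \<Gamma>))"
  by (simp add: tau3_def suppress_def)

context
  fixes \<Gamma> :: "'v mgraph"
  assumes wf_\<Gamma>: "wf_mgraph \<Gamma>"
begin

interpretation loopless_graph "zeta \<Gamma>" by (rule loopless_zeta[OF wf_\<Gamma>])

lemma deg_zeta_not_Orig:
  assumes "x \<in> verts (zeta \<Gamma>)" "x \<notin> range Orig"
  shows "deg (zeta \<Gamma>) x = 2"
proof (cases x)
  case (New e i j)
  then show ?thesis using deg_New[of e i j \<Gamma>] assms(1) by blast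
qed (use assms(2) in simp)

lemma branch_Orig: "x \<in> branch_verts \<Longrightarrow> \<exists>v \<in> mverts \<Gamma>. x = Orig v"
  using deg_zeta_not_Orig[of x]
  by (cases "x \<in> range Orig") (auto simp: branch_verts_def Orig_in_verts_zeta)

lemma inj_on_orig: "inj_on orig branch_verts"
  by (auto intro!: inj_onI dest!: branch_Orig)

lemma zeta_subdivided:
  assumes "{u, v} \<in> edges (zeta \<Gamma>)"
  shows "deg (zeta \<Gamma>) u = 2 \<or> deg (zeta \<Gamma>) v = 2"
proof -
  have "u \<notin> range Orig \<or> v \<notin> range Orig" using assms by (auto simp: zeta_no_Orig_edge)
  then show ?thesis
    using deg_zeta_not_Orig wf_graph_edge_verts[OF wf_zeta[OF wf_\<Gamma>] assms] by blast
qed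

interpretation ps: path_system "zeta \<Gamma>" branch_verts cycle_verts walk_classes
  "\<lambda>c. hd (representative c)" "\<lambda>c. last (representative c)" "\<lambda>c. butlast (tl (representative c))"
  by (rule path_system_kappa) (rule zeta_subdivided)

lemma suppress_eq:
  "suppress \<Gamma> = \<lparr>mverts = orig ` branch_verts,
     medges = image_mset (\<lambda>c. ({orig (hd (representative c)), orig (last (representative c))},
       (length (representative c) - 2) mod 2)) (mset_set walk_classes)\<rparr>"
  by (simp add: suppress_def map_mgraph_def kappa_def branch_verts_def walk_classes_def
      representative_def Let_def image_mset.compositionality comp_def)

lemma mverts_suppress: "mverts (suppress \<Gamma>) \<subseteq> mverts \<Gamma>"
  by (auto simp: suppress_eq dest!: branch_Orig)

lemma deg_suppress: "v \<in> mverts (suppress \<Gamma>) \<Longrightarrow> deg (zeta \<Gamma>) (Orig v) \<noteq> 2"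
  using branch_Orig by (fastforce simp: suppress_eq branch_verts_def)

lemma wf_suppress: "wf_mgraph (suppress \<Gamma>)"
  using ps.fin(1) ps.ends finite_walk_classes by (fastforce simp: wf_mgraph_def suppress_eq)

lemma binomial_suppress: "binomial_weights (suppress \<Gamma>)"
  using finite_walk_classes by (auto simp: binomial_weights_def suppress_eq)

lemma potential_suppress:
  "potential (suppress \<Gamma>) g = sum (g \<circ> orig) branch_verts -
    (\<Sum>c \<in> walk_classes. path_cost (length (butlast (tl (representative c))))
      ((g \<circ> orig) (hd (representative c))) ((g \<circ> orig) (last (representative c))))"
proof -
  have "edge_cost g ({orig (hd (representative c)), orig (last (representative c))},
      (length (representative c) - 2) mod 2) =
    path_cost (length (butlast (tl (representative c))))
      ((g \<circ> orig) (hd (representative c))) ((g \<circ> orig) (last (representative c)))" for c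
    by (subst edge_cost_eq[OF fst_conv, where n = "length (butlast (tl (representative c)))"])
      (auto simp: even_iff_mod_2_eq_zero numeral_2_eq_2)
  then have "(\<Sum>e \<in># medges (suppress \<Gamma>). edge_cost g e) =
    (\<Sum>c \<in> walk_classes. path_cost (length (butlast (tl (representative c))))
      ((g \<circ> orig) (hd (representative c))) ((g \<circ> orig) (last (representative c))))"
    by (simp add: suppress_eq image_mset.compositionality comp_def sum_unfold_sum_mset)
  moreover have "sum g (mverts (suppress \<Gamma>)) = sum (g \<circ> orig) branch_verts"
    by (simp add: suppress_eq sum.reindex[OF inj_on_orig])
  ultimately show ?thesis by (simp add: potential_def)
qed

text \<open>Both sides are optima of the same function on the branch vertices of \<zeta>(\<Gamma>):
  one through the potential of the suppressed multigraph, the other through the decomposition of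
  \<zeta>(\<Gamma>) into walks. Subdividing the suppressed multigraph explicitly is thus
  avoided.\<close>

lemma gap_star_suppress: "gap_star (suppress \<Gamma>) = gap_star \<Gamma>"
proof -
  have "k \<le> gap_star (suppress \<Gamma>) \<longleftrightarrow> k \<le> gap_star \<Gamma>" for k
  proof -
    let ?f = "\<lambda>g. sum g branch_verts -
      (\<Sum>c \<in> walk_classes. path_cost (length (butlast (tl (representative c))))
        (g (hd (representative c))) (g (last (representative c))))"
    \<comment> \<open>Branch vertices are original, so passing to names in \<Gamma> and back loses
      nothing.\<close>
    have eq: "?f (g \<circ> Orig \<circ> orig) = ?f g" for g
    proof -
      have "(g \<circ> Orig \<circ> orig) x = g x" if "x \<in> branch_verts" for x
        using branch_Orig[OF that] by auto
      then show ?thesis using ps.ends by (simp cong: sum.cong)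
    qed
    have "(\<exists>g. (\<forall>v. \<bar>g v\<bar> \<le> 1) \<and> k \<le> ?f g) \<longleftrightarrow> (\<exists>g. (\<forall>v. \<bar>g v\<bar> \<le> 1) \<and> k \<le> ?f (g \<circ> orig))"
    proof
      assume "\<exists>g. (\<forall>v. \<bar>g v\<bar> \<le> 1) \<and> k \<le> ?f g"
      then obtain g where g: "\<forall>v. \<bar>g v\<bar> \<le> 1" "k \<le> ?f g" by blast
      have "k \<le> ?f (g \<circ> Orig \<circ> orig)" using g(2) by (simp only: eq)
      moreover have "\<forall>v. \<bar>(g \<circ> Orig) v\<bar> \<le> 1" using g(1) by simp
      ultimately show "\<exists>g. (\<forall>v. \<bar>g v\<bar> \<le> 1) \<and> k \<le> ?f (g \<circ> orig)" by blast
    next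
      assume "\<exists>g. (\<forall>v. \<bar>g v\<bar> \<le> 1) \<and> k \<le> ?f (g \<circ> orig)"
      then obtain g where g: "\<forall>v. \<bar>g v\<bar> \<le> 1" "k \<le> ?f (g \<circ> orig)" by blast
      then have "\<forall>v. \<bar>(g \<circ> orig) v\<bar> \<le> 1" by simp
      then show "\<exists>g. (\<forall>v. \<bar>g v\<bar> \<le> 1) \<and> k \<le> ?f g" using g(2) by blast
    qed
    then show ?thesis
      unfolding le_gap_star_iff[OF wf_suppress] potential_suppress
      unfolding gap_star_def le_gap_iff[OF wf_zeta[OF wf_\<Gamma>] K22_free_zeta[OF wf_\<Gamma>]] ps.admissible_iff
      by blast
  qed
  then show ?thesis by (meson order_antisym order_refl)
qed

section \<open>Multigraphs that suppression leaves unchanged\<close>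

context
  assumes branch: "\<And>v. v \<in> mverts \<Gamma> \<Longrightarrow> deg (zeta \<Gamma>) (Orig v) \<noteq> 2"
begin

text \<open>For a loop the two ends of the path coincide, so distinctness of vertices does not give
  distinctness of edges. The last edge is treated separately; as there are at least two inner
  vertices, it differs from the first one.\<close>

lemma kappa_walk_edge_path:
  assumes "(e, i) \<in> copies \<Gamma>"
  shows "kappa_walk (zeta \<Gamma>) (edge_path e i)"
proof -
  interpret z: path_system "zeta \<Gamma>" "Orig ` mverts \<Gamma>" "{}" "copies \<Gamma>"
    "\<lambda>c. Orig (edge_src (fst c))" "\<lambda>c. Orig (edge_tgt (fst c))" "\<lambda>c. edge_inner (fst c) (snd c)"
    by (rule path_system_zeta[OF wf_\<Gamma>])
  let ?xs = "edge_inner e i"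
  have xs: "distinct ?xs" "set ?xs \<inter> Orig ` mverts \<Gamma> = {}"
    "Orig (edge_src e) \<in> Orig ` mverts \<Gamma>" "Orig (edge_tgt e) \<in> Orig ` mverts \<Gamma>"
    using z.inner[OF assms] z.disj(2)[OF assms] z.ends[OF assms] by auto
  have "2 \<le> length ?xs" using path_len_ge2[of e] by (simp add: edge_inner_def del: upt_Suc)
  then obtain ys w y where ys: "?xs = ys @ [w, y]"
    by (metis Suc_le_length_iff append_Cons append_Nil append_assoc append_butlast_last_id
        length_append_singleton list.size(3) not_less_eq_eq numeral_2_eq_2 rev_exhaust zero_le)
  have dist: "distinct ((Orig (edge_src e) # ys) @ [w, y])" using xs ys by auto
  have "{y, Orig (edge_tgt e)} \<notin> set (walk_edges ((Orig (edge_src e) # ys) @ [w, y]))"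
    using xs ys dist by (intro new_walk_edge) auto
  then have "distinct (walk_edges ((Orig (edge_src e) # ys) @ [w, y] @ [Orig (edge_tgt e)]))"
    using walk_edges_snoc[of "(Orig (edge_src e) # ys) @ [w, y]" "Orig (edge_tgt e)"]
      distinct_walk_edges[OF dist] by simp
  then have "distinct (walk_edges (edge_path e i))" by (simp add: edge_path_eq ys)
  moreover have "successively (\<lambda>x y. {x, y} \<in> edges (zeta \<Gamma>)) (edge_path e i)"
    using z.path_edges[OF assms] unfolding walk_edges_subset_iff edge_path_eq by simp
  moreover have "\<forall>x \<in> set ?xs. deg (zeta \<Gamma>) x = 2"
  proof
    fix x assume x: "x \<in> set ?xs"
    then have "x \<in> verts (zeta \<Gamma>)" using assms by (auto simp: verts_zeta)
    moreover have "x \<notin> range Orig" using x by (auto simp: set_edge_inner)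
    ultimately show "deg (zeta \<Gamma>) x = 2" by (rule deg_zeta_not_Orig)
  qed
  ultimately show ?thesis
    using xs branch unfolding kappa_walk_iff edge_path_eq by blast
qed

lemma New_in_edge_path: "New e i j \<in> set (edge_path e' i') \<Longrightarrow> e = e' \<and> i = i'"
  by (auto simp: edge_path_eq set_edge_inner)

text \<open>Every walk has an inner vertex. Here it must be a new vertex, so it lies on the path of
  some copy of an edge, and walks sharing an inner vertex agree up to reversal.\<close>

lemma walk_classes_edge_paths:
  "walk_classes = (\<lambda>(e, i). {edge_path e i, rev (edge_path e i)}) ` copies \<Gamma>" (is "_ = ?\<phi> ` _")
proof (intro equalityI subsetI)
  fix c assume "c \<in> ?\<phi> ` copies \<Gamma>"
  then show "c \<in> walk_classes" using kappa_walk_edge_path by (auto simp: walk_classes_def)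
next
  fix c assume "c \<in> walk_classes"
  then obtain p where p: "kappa_walk (zeta \<Gamma>) p" "c = {p, rev p}" by (auto simp: walk_classes_def)
  have "butlast (tl p) \<noteq> []"
  proof
    assume "butlast (tl p) = []"
    then have "{hd p, last p} \<in> edges (zeta \<Gamma>)"
      using p(1) kappa_walkD(2)[OF p(1)] unfolding kappa_walk_iff
      by (metis append_Nil successively.simps(3))
    then show False using zeta_subdivided kappa_walkD(3,4)[OF p(1)] by blast
  qed
  then obtain x where x: "x \<in> set (butlast (tl p))" by (meson last_in_set)
  then have deg: "deg (zeta \<Gamma>) x = 2" by (rule kappa_walkD(6)[OF p(1)])
  have "x \<in> verts (zeta \<Gamma>)"
    using kappa_walk_length[OF p(1)] kappa_walkD(2)[OF p(1)] x
    by (metis Un_iff list.set_intros(2) set_append subsetD)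
  then obtain e i j where New: "x = New e i j" "(e, i) \<in> copies \<Gamma>" "1 \<le> j" "j \<le> path_len e"
    using deg branch by (cases x) (auto simp: Orig_in_verts_zeta New_in_verts_zeta)
  then have "x \<in> set (butlast (tl (edge_path e i)))"
    by (auto simp: edge_path_eq set_edge_inner)
  then have "p = edge_path e i \<or> p = rev (edge_path e i)"
    using kappa_walk_share[OF kappa_walk_edge_path[OF New(2)] p(1) _ x] by blast
  then have "c = ?\<phi> (e, i)" using p(2) by auto
  then show "c \<in> ?\<phi> ` copies \<Gamma>" using New(2) by (rule image_eqI)
qed

lemma inj_on_edge_paths:
  "inj_on (\<lambda>(e, i). {edge_path e i, rev (edge_path e i)}) (copies \<Gamma>)"
proof (rule inj_onI, clarify)
  fix e i e' i'
  assume "{edge_path e i, rev (edge_path e i)} = {edge_path e' i', rev (edge_path e' i')}"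
  then have "edge_path e i \<in> {edge_path e' i', rev (edge_path e' i')}" by blast
  then have "set (edge_path e i) = set (edge_path e' i')" by auto
  moreover have "New e i 1 \<in> set (edge_path e i)"
    using path_len_ge2[of e] by (auto simp: edge_path_eq set_edge_inner)
  ultimately show "e = e' \<and> i = i'" using New_in_edge_path by metis
qed

lemma image_mset_copies: "image_mset fst (mset_set (copies \<Gamma>)) = medges \<Gamma>"
proof (rule multiset_eqI)
  fix e
  have "count (image_mset fst (mset_set (copies \<Gamma>))) e = card (fst -` {e} \<inter> copies \<Gamma>)"
    by (simp add: count_image_mset)
  also have "fst -` {e} \<inter> copies \<Gamma> = Pair e ` {..<count (medges \<Gamma>) e}"
    by (auto simp: copies_def simp flip: count_greater_zero_iff)
  finally show "count (image_mset fst (mset_set (copies \<Gamma>))) e = count (medges \<Gamma>) e"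
    by (simp add: card_image inj_on_def)
qed

text \<open>The stopping test compares multigraphs literally. This lemma shows that the third
  operation really returns its input once it removes no vertex.\<close>

lemma suppress_id:
  assumes "binomial_weights \<Gamma>"
  shows "suppress \<Gamma> = \<Gamma>"
proof -
  let ?F = "\<lambda>c. ({orig (hd (representative c)), orig (last (representative c))},
       (length (representative c) - 2) mod 2)"
  let ?\<phi> = "\<lambda>(e, i). {edge_path e i, rev (edge_path e i)}"
  have "branch_verts = Orig ` mverts \<Gamma>"
    using branch_Orig branch by (auto simp: branch_verts_def Orig_in_verts_zeta)
  then have V: "orig ` branch_verts = mverts \<Gamma>" by (simp add: image_image)
  have F: "?F (?\<phi> (e, i)) = e" if ei: "(e, i) \<in> copies \<Gamma>" for e i
  proof -
    have e: "e \<in># medges \<Gamma>" using ei by (rule copies_edge)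
    have "?\<phi> (e, i) \<in> walk_classes" using ei by (subst walk_classes_edge_paths) (rule imageI)
    then have "representative (?\<phi> (e, i)) \<in> ?\<phi> (e, i)" by (rule representative_mem)
    then have "representative (?\<phi> (e, i)) = edge_path e i \<or> representative (?\<phi> (e, i)) = rev (edge_path e i)"
      by simp
    then have "?F (?\<phi> (e, i)) = ({edge_src e, edge_tgt e}, path_len e mod 2)"
    proof
      assume "representative (?\<phi> (e, i)) = edge_path e i"
      then show ?thesis by (simp add: edge_path_eq edge_inner_def)
    next
      assume "representative (?\<phi> (e, i)) = rev (edge_path e i)"
      then show ?thesis by (simp add: edge_path_eq edge_inner_def insert_commute)
    qed
    \<comment> \<open>The numbers 2, 3, 5 of inner vertices have the parity of the weights 0, 1, 1
      that they encode.\<close>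
    also have "\<dots> = (fst e, snd e)"
      using wf_mgraph_ends(1)[OF wf_\<Gamma> e] assms e by (auto simp: path_len_def binomial_weights_def)
    finally show ?thesis by simp
  qed
  have "image_mset ?F (mset_set walk_classes) = image_mset ?F (image_mset ?\<phi> (mset_set (copies \<Gamma>)))"
    unfolding walk_classes_edge_paths using inj_on_edge_paths by (subst image_mset_mset_set) auto
  also have "\<dots> = image_mset fst (mset_set (copies \<Gamma>))"
    unfolding image_mset.compositionality using F by (intro image_mset_cong) (auto simp del: prod.case)
  finally show ?thesis unfolding suppress_eq V image_mset_copies by simp
qed

end

end


subsection \<open>Spanning trees of 1-components\<close>

text \<open>Trees built by attaching leaves to \<open>r\<close>, along edges from \<open>E\<close>.
  In this form both acyclicity and the estimate of labels along the tree are inductions over the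
  attached leaves.\<close>

inductive grown_tree :: "'v set set \<Rightarrow> 'v \<Rightarrow> 'v set \<Rightarrow> 'v set set \<Rightarrow> bool" for E r where
  root: "grown_tree E r {r} {}"
| leaf: "\<lbrakk>grown_tree E r W F; u \<in> W; x \<notin> W; {u, x} \<in> E\<rbrakk> \<Longrightarrow>
    grown_tree E r (insert x W) (insert {u, x} F)"

lemma grown_tree_basic:
  assumes "grown_tree E r W F"
  shows "r \<in> W" "finite W" "finite F" "F \<subseteq> E" "e \<in> F \<Longrightarrow> e \<subseteq> W \<and> e \<noteq> {}"
    "e \<in> F \<Longrightarrow> \<exists>u \<in> W. \<exists>v \<in> W. e = {u, v}"
proof -
  have "r \<in> W \<and> finite W \<and> finite F \<and> F \<subseteq> E \<and> (\<forall>e \<in> F. \<exists>u \<in> W. \<exists>v \<in> W. e = {u, v})"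
    using assms
  proof (induction rule: grown_tree.induct)
    case (leaf W F u x)
    have "\<exists>a \<in> insert x W. \<exists>b \<in> insert x W. e = {a, b}" if e: "e \<in> insert {u, x} F" for e
    proof (cases "e \<in> F")
      case True
      then obtain a b where "a \<in> W" "b \<in> W" "e = {a, b}" using leaf.IH by blast
      then show ?thesis by blast
    next
      case False
      then show ?thesis using e leaf.hyps(2) by (intro bexI[of _ u] bexI[of _ x]) auto
    qed
    then show ?case using leaf.IH leaf.hyps(4) by simp
  qed simp
  then show "r \<in> W" "finite W" "finite F" "F \<subseteq> E" "e \<in> F \<Longrightarrow> e \<subseteq> W \<and> e \<noteq> {}"
    "e \<in> F \<Longrightarrow> \<exists>u \<in> W. \<exists>v \<in> W. e = {u, v}" by auto
qed

lemma grown_tree_connected: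
  assumes "grown_tree E r W F"
  shows "w \<in> W \<Longrightarrow> (r, w) \<in> {(a, b). {a, b} \<in> F}\<^sup>*"
  using assms
proof (induction arbitrary: w rule: grown_tree.induct)
  case (leaf W F u x)
  have mono: "{(a, b). {a, b} \<in> F}\<^sup>* \<subseteq> {(a, b). {a, b} \<in> insert {u, x} F}\<^sup>*"
    by (rule rtrancl_mono) auto
  have "(u, x) \<in> {(a, b). {a, b} \<in> insert {u, x} F}" by simp
  moreover have "(r, u) \<in> {(a, b). {a, b} \<in> insert {u, x} F}\<^sup>*"
    using leaf.IH[OF leaf.hyps(2)] mono by blast
  ultimately have "(r, x) \<in> {(a, b). {a, b} \<in> insert {u, x} F}\<^sup>*" by (rule rtrancl_into_rtrancl[rotated])
  then show ?case using leaf.IH leaf.prems mono by blast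
qed simp

lemma walk_of_rtrancl:
  assumes "wf_graph G" "a \<in> verts G" "(a, b) \<in> {(a, b). {a, b} \<in> edges G}\<^sup>*"
  shows "\<exists>xs. walk G xs \<and> hd xs = a \<and> last xs = b"
  using assms(3)
proof (induction rule: rtrancl_induct)
  case base
  then show ?case using assms(2) by (intro exI[of _ "[a]"]) (simp add: walk_def)
next
  case (step b c)
  then obtain xs where xs: "walk G xs" "hd xs = a" "last xs = b" by blast
  then have "walk G (xs @ [c])"
    using step(2) wf_graph_edge_verts[OF assms(1)] walk_edges_snoc[of xs c] by (auto simp: walk_def)
  then show ?case using xs by (intro exI[of _ "xs @ [c]"]) (auto simp: walk_def)
qed

text \<open>A cycle through the new leaf would traverse the edge at the leaf twice.\<close>

lemma no_cycle_leaf: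
  assumes nc: "\<And>xs. \<not> cycle \<lparr>verts = W, edges = F\<rparr> xs"
    and F: "\<And>e. e \<in> F \<Longrightarrow> e \<subseteq> W" and u: "u \<in> W" and x: "x \<notin> W"
  shows "\<not> cycle \<lparr>verts = insert x W, edges = insert {u, x} F\<rparr> xs"
proof
  assume c: "cycle \<lparr>verts = insert x W, edges = insert {u, x} F\<rparr> xs"
  define n where "n = length xs"
  have E: "set (walk_edges xs) \<subseteq> insert {u, x} F" and V: "set xs \<subseteq> insert x W" and ne: "xs \<noteq> []"
    and n2: "2 \<le> n" and closed: "hd xs = last xs" and dist: "distinct (walk_edges xs)"
    and dist': "distinct (tl xs)"
    using c by (auto simp: cycle_def walk_def n_def)
  show False
  proof (cases "x \<in> set xs")
    case False
    then have "set (walk_edges xs) \<subseteq> F" using E walk_edge_subset[of "{u, x}" xs] by blast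
    moreover have "set xs \<subseteq> W" using False V by blast
    ultimately have "cycle \<lparr>verts = W, edges = F\<rparr> xs"
      using n2 ne closed dist dist' by (simp add: cycle_def walk_def n_def)
    then show False using nc by blast
  next
    case True
    have at: "walk_edges xs ! i = {u, x}" if "Suc i < n" "x = xs ! i \<or> x = xs ! Suc i" for i
    proof -
      have "walk_edges xs ! i \<in> insert {u, x} F"
        using E that(1) nth_mem[of i "walk_edges xs"] by (simp add: n_def less_diff_conv subset_iff)
      moreover have "x \<in> walk_edges xs ! i" using that by (auto simp: walk_edges_nth n_def)
      ultimately show ?thesis using F x by blast
    qed
    have twice: "a = b" if "walk_edges xs ! a = {u, x}" "walk_edges xs ! b = {u, x}" "Suc a < n" "Suc b < n" for a b
    proof -
      have "a < length (walk_edges xs)" "b < length (walk_edges xs)"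
        using that(3,4) by (simp_all add: n_def less_diff_conv)
      then show ?thesis using that(1,2) dist nth_eq_iff_index_eq by metis
    qed
    obtain i where i: "i < n" "xs ! i = x" using True by (auto simp: in_set_conv_nth n_def)
    show False
    proof (cases "0 < i \<and> Suc i < n")
      case True
      then obtain k where "i = Suc k" using gr0_implies_Suc by blast
      then show False using at[of k] at[of i] twice[of k i] True i by simp
    next
      \<comment> \<open>Here \<open>x\<close> is the base point of the closed walk. The first and
        the last edge both equal \<open>{u, x}\<close>, so they are the same edge, and the walk is a
        loop at \<open>x\<close>.\<close>
      case False
      obtain k where k: "n = Suc (Suc k)" using n2 by (metis add_2_eq_Suc le_Suc_ex)
      have "xs ! 0 = xs ! Suc k" using closed ne k by (simp add: hd_conv_nth last_conv_nth n_def)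
      moreover have "i = 0 \<or> i = Suc k" using False i k by auto
      ultimately have ends: "xs ! 0 = x" "xs ! Suc k = x" using i by auto
      then have "walk_edges xs ! 0 = {u, x}" "walk_edges xs ! k = {u, x}"
        using at[of 0] at[of k] k by auto
      then have "k = 0" using twice[of 0 k] k by simp
      then have "walk_edges xs ! 0 = {x}" using ends k by (simp add: walk_edges_nth n_def)
      then show False using \<open>walk_edges xs ! 0 = {u, x}\<close> u x by (auto simp: doubleton_eq_iff)
    qed
  qed
qed

lemma grown_tree_no_cycle:
  assumes "grown_tree E r W F"
  shows "\<not> cycle \<lparr>verts = W, edges = F\<rparr> xs"
  using assms
proof (induction arbitrary: xs rule: grown_tree.induct)
  case root
  have "set (walk_edges xs) \<noteq> {}" if "2 \<le> length xs"
    using that by (cases xs; cases "tl xs") auto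
  then show ?case by (auto simp: cycle_def walk_def)
next
  case (leaf W F u x)
  then show ?case using grown_tree_basic(5)[OF leaf.hyps(1)] by (intro no_cycle_leaf) auto
qed

lemma tree_grown_tree:
  assumes "grown_tree E r W F"
  shows "tree \<lparr>verts = W, edges = F\<rparr>"
proof -
  let ?T = "\<lparr>verts = W, edges = F\<rparr>" and ?R = "{(a, b). {a, b} \<in> F}"
  have wf: "wf_graph ?T"
    using grown_tree_basic[OF assms] by (auto simp: wf_graph_def)
  have "sym ?R" by (auto simp: sym_def insert_commute)
  then have "(a, b) \<in> ?R\<^sup>*" if "a \<in> W" "b \<in> W" for a b
    using grown_tree_connected[OF assms] that by (meson rtrancl_trans symD sym_rtrancl)
  then have "connected_graph ?T"
    using walk_of_rtrancl[OF wf] grown_tree_basic(1)[OF assms] by (auto simp: connected_graph_def)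
  then show ?thesis using wf grown_tree_no_cycle[OF assms] by (simp add: tree_def)
qed

text \<open>Each vertex other than the root is charged to the edge by which it was attached.\<close>

lemma grown_tree_sum:
  fixes h :: "'v \<Rightarrow> int"
  assumes "grown_tree E r W F" "\<And>v. v \<in> W \<Longrightarrow> 0 \<le> h v" "h r = 0"
  shows "sum h W \<le> (\<Sum>e \<in> F. Max (h ` e))"
  using assms(1,2)
proof (induction rule: grown_tree.induct)
  case (leaf W F u x)
  have "{u, x} \<notin> F" using grown_tree_basic(5)[OF leaf.hyps(1)] leaf.hyps(3) by auto
  moreover have "h x \<le> Max (h ` {u, x})" by simp
  ultimately show ?case
    using leaf grown_tree_basic[OF leaf.hyps(1)] by simp
qed (simp add: assms(3))

lemma rtrancl_crossing:
  assumes "(a, b) \<in> R\<^sup>*" "a \<in> W" "b \<notin> W"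
  shows "\<exists>u \<in> W. \<exists>x. x \<notin> W \<and> (u, x) \<in> R \<and> (a, x) \<in> R\<^sup>*"
  using assms by (induction rule: rtrancl_induct) (auto intro: rtrancl_into_rtrancl)

text \<open>As long as a reachable vertex is missing, some edge of \<open>E\<close> leaves the tree
  and can be attached.\<close>

lemma grown_tree_spanning:
  assumes "finite W\<^sub>0" "W\<^sub>0 = {w. (r, w) \<in> {(a, b). {a, b} \<in> E}\<^sup>*}"
  shows "\<exists>F. grown_tree E r W\<^sub>0 F"
proof -
  have "\<exists>F. grown_tree E r W\<^sub>0 F" if "grown_tree E r W F" "W \<subseteq> W\<^sub>0" for W F
    using that
  proof (induction "card (W\<^sub>0 - W)" arbitrary: W F rule: less_induct)
    case less
    show ?case
    proof (cases "W = W\<^sub>0")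
      case False
      then obtain w where "w \<in> W\<^sub>0" "w \<notin> W" using less.prems(2) by blast
      then obtain u x where ux: "u \<in> W" "x \<notin> W" "{u, x} \<in> E" "x \<in> W\<^sub>0"
        using rtrancl_crossing[of r w "{(a, b). {a, b} \<in> E}" W] grown_tree_basic(1)[OF less.prems(1)] assms(2) by auto
      have "card (W\<^sub>0 - insert x W) < card (W\<^sub>0 - W)"
        using ux assms(1) by (intro psubset_card_mono) auto
      then show ?thesis
        using less.hyps[OF _ grown_tree.leaf[OF less.prems(1) ux(1-3)]] ux(4) less.prems(2) by simp
    qed (use less.prems in blast)
  qed
  moreover have "grown_tree E r {r} {}" by (rule grown_tree.root)
  moreover have "{r} \<subseteq> W\<^sub>0" using assms(2) by simp
  ultimately show ?thesis by blast
qed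

section \<open>1-components as reachability classes\<close>

definition one_rel :: "'v mgraph \<Rightarrow> 'v rel" where
  "one_rel \<Gamma> = {(u, v). ({u, v}, 1) \<in># medges \<Gamma>}"

definition one_class :: "'v mgraph \<Rightarrow> 'v \<Rightarrow> 'v set" where
  "one_class \<Gamma> v = {w. (v, w) \<in> (one_rel \<Gamma>)\<^sup>*}"

definition one_classes :: "'v mgraph \<Rightarrow> 'v set set" where
  "one_classes \<Gamma> = one_class \<Gamma> ` mverts \<Gamma>"

definition induced :: "'v mgraph \<Rightarrow> 'v set \<Rightarrow> 'v mgraph" where
  "induced \<Gamma> W = delete \<Gamma> (mverts \<Gamma> - W)"

definition one_edges :: "'v mgraph \<Rightarrow> 'v set \<Rightarrow> ('v set \<times> nat) multiset" where
  "one_edges \<Gamma> W = {#e \<in># medges \<Gamma>. snd e = 1 \<and> fst e \<subseteq> W#}"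

text \<open>The coefficient of the common label when a class carries a constant labelling. Its
  negative is the quantity summed in \<open>t1\<close>.\<close>

definition excess :: "'v mgraph \<Rightarrow> 'v set \<Rightarrow> int" where
  "excess \<Gamma> W = int (card W) - int (size (one_edges \<Gamma> W))"

lemma sym_one_rel: "sym (one_rel \<Gamma>)"
  by (auto simp: sym_def one_rel_def insert_commute)

lemma one_class_self: "v \<in> one_class \<Gamma> v"
  by (simp add: one_class_def)

lemma one_class_eq: "w \<in> one_class \<Gamma> v \<Longrightarrow> one_class \<Gamma> w = one_class \<Gamma> v"
  unfolding one_class_def
  by (auto intro: rtrancl_trans dest: symD[OF sym_rtrancl[OF sym_one_rel]])

lemma one_classes_mem: "W \<in> one_classes \<Gamma> \<Longrightarrow> x \<in> W \<Longrightarrow> W = one_class \<Gamma> x"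
  by (auto simp: one_classes_def dest: one_class_eq)

lemma one_edge_class: "({u, v}, 1) \<in># medges \<Gamma> \<Longrightarrow> one_class \<Gamma> u = one_class \<Gamma> v"
  by (rule one_class_eq[symmetric]) (auto simp: one_class_def one_rel_def)

lemma sum_mset_partition:
  fixes f :: "'a \<Rightarrow> int"
  assumes "finite C" "\<And>x. x \<in># M \<Longrightarrow> \<exists>!W. W \<in> C \<and> P W x"
  shows "(\<Sum>x \<in># M. f x) = (\<Sum>W \<in> C. \<Sum>x \<in># filter_mset (P W) M. f x)"
  using assms(2)
proof (induction M)
  case (add y M)
  obtain W\<^sub>0 where W\<^sub>0: "\<And>W. W \<in> C \<Longrightarrow> P W y \<longleftrightarrow> W = W\<^sub>0" "W\<^sub>0 \<in> C" using add.prems[of y] by auto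
  have "(\<Sum>W \<in> C. \<Sum>x \<in># filter_mset (P W) (add_mset y M). f x) =
    (\<Sum>W \<in> C. (if W = W\<^sub>0 then f y else 0) + (\<Sum>x \<in># filter_mset (P W) M. f x))"
    using W\<^sub>0(1) by (intro sum.cong) auto
  then show ?case using add W\<^sub>0(2) assms(1) by (simp add: sum.distrib)
qed simp

lemma wf_mgraph_edge_verts:
  "wf_mgraph \<Gamma> \<Longrightarrow> ({u, v}, w) \<in># medges \<Gamma> \<Longrightarrow> u \<in> mverts \<Gamma> \<and> v \<in> mverts \<Gamma>"
  by (fastforce simp: wf_mgraph_def doubleton_eq_iff)

locale binomial_mgraph =
  fixes \<Gamma> :: "'v mgraph"
  assumes wf_\<Gamma>: "wf_mgraph \<Gamma>" and bin: "binomial_weights \<Gamma>"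
begin

lemma fin_verts: "finite (mverts \<Gamma>)"
  using wf_\<Gamma> by (simp add: wf_mgraph_def)

lemmas edge_verts = wf_mgraph_edge_verts[OF wf_\<Gamma>]

lemma one_class_subset: "v \<in> mverts \<Gamma> \<Longrightarrow> one_class \<Gamma> v \<subseteq> mverts \<Gamma>"
proof
  fix w assume "v \<in> mverts \<Gamma>" "w \<in> one_class \<Gamma> v"
  then have "(v, w) \<in> (one_rel \<Gamma>)\<^sup>*" by (simp add: one_class_def)
  then show "w \<in> mverts \<Gamma>"
    using \<open>v \<in> mverts \<Gamma>\<close> edge_verts by (induction rule: rtrancl_induct) (auto simp: one_rel_def)
qed

lemma one_classes_subset: "W \<in> one_classes \<Gamma> \<Longrightarrow> W \<subseteq> mverts \<Gamma> \<and> W \<noteq> {} \<and> finite W"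
  using one_class_subset one_class_self fin_verts finite_subset by (fastforce simp: one_classes_def)

lemma one_classes_disjoint:
  "W \<in> one_classes \<Gamma> \<Longrightarrow> W' \<in> one_classes \<Gamma> \<Longrightarrow> x \<in> W \<Longrightarrow> x \<in> W' \<Longrightarrow> W = W'"
  using one_classes_mem by metis

lemma finite_one_classes: "finite (one_classes \<Gamma>)"
  using fin_verts by (simp add: one_classes_def)

lemma mverts_induced: "W \<subseteq> mverts \<Gamma> \<Longrightarrow> mverts (induced \<Gamma> W) = W"
  by (auto simp: induced_def delete_def)

lemma medges_induced: "W \<subseteq> mverts \<Gamma> \<Longrightarrow> medges (induced \<Gamma> W) = {#e \<in># medges \<Gamma>. fst e \<subseteq> W#}"
proof -
  have "fst e \<inter> (mverts \<Gamma> - W) = {} \<longleftrightarrow> fst e \<subseteq> W" if "e \<in># medges \<Gamma>" for e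
    using wf_\<Gamma> that by (fastforce simp: wf_mgraph_def)
  then have "{#e \<in># medges \<Gamma>. fst e \<inter> (mverts \<Gamma> - W) = {}#} = {#e \<in># medges \<Gamma>. fst e \<subseteq> W#}"
    by (intro filter_mset_cong refl)
  then show ?thesis by (simp add: induced_def delete_def)
qed

lemma eps1_induced: "W \<subseteq> mverts \<Gamma> \<Longrightarrow> eps1 (induced \<Gamma> W) = size (one_edges \<Gamma> W)"
  by (simp add: eps1_def medges_induced one_edges_def filter_filter_mset conj_commute)

lemma spanning_tree:
  assumes "W \<in> one_classes \<Gamma>" "r \<in> W"
  shows "\<exists>F. grown_tree {s. (s, 1) \<in># medges \<Gamma>} r W F"
proof (rule grown_tree_spanning)
  show "finite W" using one_classes_subset[OF assms(1)] by simp
  show "W = {w. (r, w) \<in> {(a, b). {a, b} \<in> {s. (s, 1) \<in># medges \<Gamma>}}\<^sup>*}"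
    using one_classes_mem[OF assms] by (simp add: one_class_def one_rel_def)
qed

text \<open>The spanning tree joins all vertices by edges of weight 1, and no such edge crosses the
  border, so the vertex set is a full reachability class. Conversely, a class is spanned by a grown
  tree.\<close>

lemma one_component_iff: "one_component \<Gamma> \<Gamma>' \<longleftrightarrow> (\<exists>W \<in> one_classes \<Gamma>. \<Gamma>' = induced \<Gamma> W)"
proof
  assume c: "one_component \<Gamma> \<Gamma>'"
  let ?W = "mverts \<Gamma>'"
  have sub: "?W \<subseteq> mverts \<Gamma>" and ind: "\<Gamma>' = induced \<Gamma> ?W"
    using c by (auto simp: one_component_def induced_def)
  obtain T where T: "tree T" "verts T = ?W" "\<forall>s \<in> edges T. (s, 1) \<in># medges \<Gamma>'"
    using c by (auto simp: one_component_def)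
  have cross: "snd e = 0" if "e \<in># medges \<Gamma>" "fst e \<inter> ?W \<noteq> {}" "fst e - ?W \<noteq> {}" for e
    using c that by (auto simp: one_component_def)
  obtain v where v: "v \<in> ?W" using T by (auto simp: tree_def connected_graph_def)
  have "w \<in> one_class \<Gamma> v" if w: "w \<in> ?W" for w
  proof -
    obtain xs where xs: "walk T xs" "hd xs = v" "last xs = w"
      using T(1,2) v w unfolding tree_def connected_graph_def by blast
    have "(s, 1) \<in># medges \<Gamma>" if "s \<in> edges T" for s
      using T(3) that medges_induced[OF sub] ind by (metis filter_mset_eq_conv multiset_filter_subset mset_subset_eqD)
    then have "successively (\<lambda>a b. (a, b) \<in> one_rel \<Gamma>) xs"
      using xs(1) unfolding walk_def walk_edges_subset_iff one_rel_def
      by (auto elim: successively_mono)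
    moreover have "xs \<noteq> []" using xs(1) by (simp add: walk_def)
    ultimately have "(hd xs, last xs) \<in> (one_rel \<Gamma>)\<^sup>*"
      by (induction xs rule: induct_list012) (auto intro: converse_rtrancl_into_rtrancl)
    then show ?thesis using xs by (simp add: one_class_def)
  qed
  moreover have "w \<in> ?W" if "w \<in> one_class \<Gamma> v" for w
  proof -
    have "(v, w) \<in> (one_rel \<Gamma>)\<^sup>*" using that by (simp add: one_class_def)
    then show ?thesis
    proof (induction rule: rtrancl_induct)
      case (step a b)
      show ?case
      proof (rule ccontr)
        assume "b \<notin> ?W"
        then show False using step cross[of "({a, b}, 1)"] by (auto simp: one_rel_def)
      qed
    qed (rule v)
  qed
  ultimately have "?W = one_class \<Gamma> v" by blast
  then show "\<exists>W \<in> one_classes \<Gamma>. \<Gamma>' = induced \<Gamma> W"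
    using ind v sub by (auto simp: one_classes_def)
next
  assume "\<exists>W \<in> one_classes \<Gamma>. \<Gamma>' = induced \<Gamma> W"
  then obtain W where W: "W \<in> one_classes \<Gamma>" "\<Gamma>' = induced \<Gamma> W" by blast
  have sub: "W \<subseteq> mverts \<Gamma>" "W \<noteq> {}" using one_classes_subset[OF W(1)] by auto
  then obtain r where r: "r \<in> W" by blast
  obtain F where F: "grown_tree {s. (s, 1) \<in># medges \<Gamma>} r W F" using spanning_tree[OF W(1) r] by blast
  have "tree \<lparr>verts = W, edges = F\<rparr>" by (rule tree_grown_tree[OF F])
  moreover have "\<forall>s \<in> F. (s, 1) \<in># medges \<Gamma>'"
    using grown_tree_basic(4,5)[OF F] W(2) medges_induced[OF sub(1)] by auto
  ultimately have T: "\<exists>T. tree T \<and> verts T = W \<and> (\<forall>s \<in> edges T. (s, 1) \<in># medges \<Gamma>')"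
    by (intro exI[of _ "\<lparr>verts = W, edges = F\<rparr>"]) simp
  have "snd e = 0" if e: "e \<in># medges \<Gamma>" "fst e \<inter> W \<noteq> {}" "fst e - W \<noteq> {}" for e
  proof (rule ccontr)
    assume "snd e \<noteq> 0"
    then have w1: "snd e = 1" using bin e(1) by (auto simp: binomial_weights_def)
    obtain a b where ab: "fst e = {a, b}" using wf_\<Gamma> e(1) by (auto simp: wf_mgraph_def)
    then have "({a, b}, 1) \<in># medges \<Gamma>" using e(1) w1 by (metis prod.collapse)
    then have "one_class \<Gamma> a = one_class \<Gamma> b" by (rule one_edge_class)
    then have "a \<in> W \<longleftrightarrow> b \<in> W" using one_classes_mem[OF W(1)] one_class_self by metis
    then show False using e ab by auto
  qed
  then show "one_component \<Gamma> \<Gamma>'"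
    using T sub(1) mverts_induced[OF sub(1)] W(2) unfolding one_component_def induced_def by simp
qed

text \<open>The right-hand side is the value of the class under the constant label
  \<open>g r\<close>. Whatever the labels exceed this minimum by is paid for by the edges of a
  spanning tree.\<close>

lemma one_edges_cost:
  assumes W: "W \<in> one_classes \<Gamma>" and r: "r \<in> W" "\<And>v. v \<in> W \<Longrightarrow> g r \<le> g v"
  shows "sum g W - (\<Sum>e \<in># one_edges \<Gamma> W. edge_cost g e) \<le> g r * excess \<Gamma> W"
proof -
  let ?M = "one_edges \<Gamma> W" and ?h = "\<lambda>v. g v - g r"
  have fin: "finite W" using one_classes_subset[OF W] by simp
  obtain F where F: "grown_tree {s. (s, 1) \<in># medges \<Gamma>} r W F" using spanning_tree[OF W r(1)] by blast
  note Fb = grown_tree_basic[OF F]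
  let ?F = "(\<lambda>s. (s, 1 :: nat)) ` F"
  have cost: "edge_cost g e = Max (g ` fst e)" "g r \<le> Max (g ` fst e)" if "e \<in># ?M" for e
  proof -
    have e: "e \<in># medges \<Gamma>" "snd e = 1" "fst e \<subseteq> W" using that by (auto simp: one_edges_def)
    then show "edge_cost g e = Max (g ` fst e)" by (simp add: edge_cost_def)
    obtain a b where "fst e = {a, b}" using wf_\<Gamma> e(1) by (auto simp: wf_mgraph_def)
    then show "g r \<le> Max (g ` fst e)" using r(2)[of a] e(3) by simp
  qed
  \<comment> \<open>Each tree edge is taken with multiplicity one; further parallel copies, loops
    and other edges outside the tree stay in the difference of the multisets.\<close>
  have sub: "mset_set ?F \<subseteq># ?M"
  proof -
    have "?F \<subseteq> set_mset ?M"
    proof (rule image_subsetI)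
      fix s assume s: "s \<in> F"
      then have "(s, 1) \<in># medges \<Gamma>" using Fb(4) by auto
      then show "(s, 1) \<in> set_mset ?M" using Fb(5)[OF s] by (simp add: one_edges_def)
    qed
    then have "mset_set ?F \<subseteq># mset_set (set_mset ?M)" using Fb(3) by (intro subset_imp_msubset_mset_set) auto
    then show ?thesis using mset_set_set_mset_msubset subset_mset.order_trans by blast
  qed
  have "sum ?h W \<le> (\<Sum>s \<in> F. Max (?h ` s))"
    by (rule grown_tree_sum[OF F]) (use r in auto)
  also have "\<dots> = (\<Sum>s \<in> F. Max (g ` s) - g r)"
  proof (rule sum.cong[OF refl])
    fix s assume "s \<in> F"
    then have "finite (g ` s)" "g ` s \<noteq> {}" using Fb(5)[of s] fin finite_subset by auto
    then have "Max ((\<lambda>x. x - g r) ` (g ` s)) = Max (g ` s) - g r"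
      by (intro mono_Max_commute[symmetric]) (auto simp: mono_def)
    then show "Max (?h ` s) = Max (g ` s) - g r" by (simp add: image_image)
  qed
  also have "\<dots> = (\<Sum>e \<in># mset_set ?F. Max (g ` fst e) - g r)"
    by (subst sum_unfold_sum_mset[symmetric]) (simp add: sum.reindex inj_on_def)
  \<comment> \<open>An edge outside the tree costs at least the minimum \<open>g r\<close>.\<close>
  also have "\<dots> \<le> (\<Sum>e \<in># mset_set ?F. Max (g ` fst e) - g r) + (\<Sum>e \<in># ?M - mset_set ?F. Max (g ` fst e) - g r)"
  proof -
    have "(\<Sum>e \<in># ?M - mset_set ?F. 0) \<le> (\<Sum>e \<in># ?M - mset_set ?F. Max (g ` fst e) - g r)"
      by (rule sum_mset_mono) (use cost(2) in \<open>auto dest: in_diffD\<close>)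
    then show ?thesis by simp
  qed
  also have "\<dots> = (\<Sum>e \<in># ?M. Max (g ` fst e) - g r)"
    using sub by (simp flip: image_mset_union sum_mset.union)
  also have "\<dots> = (\<Sum>e \<in># ?M. edge_cost g e - g r)"
    using cost(1) by (metis (mono_tags, lifting) image_mset_cong)
  also have "\<dots> = (\<Sum>e \<in># ?M. edge_cost g e) - g r * int (size ?M)"
    by (simp add: sum_mset.distrib[where g = "\<lambda>_. - g r", simplified] algebra_simps)
  finally show ?thesis by (simp add: sum_subtractf excess_def algebra_simps)
qed

text \<open>A connected class has at least \<open>card W - 1\<close> edges. Instead of a count,
  \<open>one_edges_cost\<close> is applied to the labelling that is 0 at \<open>r\<close> and 1
  elsewhere, under which each edge costs at most 1.\<close>

lemma excess_le_1:
  assumes W: "W \<in> one_classes \<Gamma>" shows "excess \<Gamma> W \<le> 1"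
proof -
  obtain r where r: "r \<in> W" using one_classes_subset[OF W] by blast
  have fin: "finite W" using one_classes_subset[OF W] by simp
  let ?g = "\<lambda>v. of_bool (v \<noteq> r) :: int"
  have "sum ?g W - (\<Sum>e \<in># one_edges \<Gamma> W. edge_cost ?g e) \<le> ?g r * excess \<Gamma> W"
    by (rule one_edges_cost[OF W r]) auto
  moreover have "(\<Sum>e \<in># one_edges \<Gamma> W. edge_cost ?g e) \<le> (\<Sum>e \<in># one_edges \<Gamma> W. 1)"
  proof (rule sum_mset_mono)
    fix e assume "e \<in># one_edges \<Gamma> W"
    then have e: "e \<in># medges \<Gamma>" "snd e = 1" by (auto simp: one_edges_def)
    then obtain a b where "fst e = {a, b}" using wf_\<Gamma> by (auto simp: wf_mgraph_def)
    then show "edge_cost ?g e \<le> 1" using e(2) by (simp add: edge_cost_def)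
  qed
  moreover have "sum ?g W = int (card W) - 1"
  proof -
    have "sum ?g W = sum ?g (W - {r})" by (subst sum.remove[OF fin r]) simp
    also have "\<dots> = (\<Sum>v \<in> W - {r}. 1)" by (intro sum.cong) auto
    finally have "sum ?g W = int (card (W - {r}))" by simp
    then show ?thesis using card_Suc_Diff1[OF fin r] by linarith
  qed
  ultimately show ?thesis by (simp add: excess_def)
qed

lemma one_classes_partition: "e \<in># {#e \<in># medges \<Gamma>. snd e = 1#} \<Longrightarrow> \<exists>!W. W \<in> one_classes \<Gamma> \<and> fst e \<subseteq> W"
proof -
  assume "e \<in># {#e \<in># medges \<Gamma>. snd e = 1#}"
  then have e: "e \<in># medges \<Gamma>" "snd e = 1" by auto
  obtain a b where ab: "fst e = {a, b}" "a \<in> mverts \<Gamma>" using wf_\<Gamma> e(1) by (auto simp: wf_mgraph_def)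
  then have "({a, b}, 1) \<in># medges \<Gamma>" using e by (metis prod.collapse)
  then have "b \<in> one_class \<Gamma> a" using one_edge_class one_class_self by metis
  show ?thesis
  proof (rule ex1I)
    show "one_class \<Gamma> a \<in> one_classes \<Gamma> \<and> fst e \<subseteq> one_class \<Gamma> a"
      using ab \<open>b \<in> one_class \<Gamma> a\<close> by (simp add: one_classes_def one_class_self)
    show "W = one_class \<Gamma> a" if "W \<in> one_classes \<Gamma> \<and> fst e \<subseteq> W" for W
      using that ab(1) by (intro one_classes_mem) auto
  qed
qed

lemma potential_classes:
  "potential \<Gamma> g = (\<Sum>W \<in> one_classes \<Gamma>. sum g W - (\<Sum>e \<in># one_edges \<Gamma> W. edge_cost g e)) -
    (\<Sum>e \<in># {#e \<in># medges \<Gamma>. snd e = 0#}. edge_cost g e)"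
proof -
  let ?M = "medges \<Gamma>"
  have "?M = {#e \<in># ?M. snd e = 1#} + {#e \<in># ?M. \<not> snd e = 1#}" by (rule multiset_partition)
  also have "{#e \<in># ?M. \<not> snd e = 1#} = {#e \<in># ?M. snd e = 0#}"
    using bin by (intro filter_mset_cong) (auto simp: binomial_weights_def)
  finally have M: "?M = {#e \<in># ?M. snd e = 1#} + {#e \<in># ?M. snd e = 0#}" .
  have one: "(\<Sum>e \<in># {#e \<in># ?M. snd e = 1#}. edge_cost g e) =
    (\<Sum>W \<in> one_classes \<Gamma>. \<Sum>e \<in># one_edges \<Gamma> W. edge_cost g e)"
    by (subst sum_mset_partition[OF finite_one_classes one_classes_partition])
      (auto simp: one_edges_def filter_filter_mset)
  have "sum g (mverts \<Gamma>) = sum g (\<Union>(one_classes \<Gamma>))"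
  proof -
    have "\<Union>(one_classes \<Gamma>) = mverts \<Gamma>"
    proof
      show "\<Union>(one_classes \<Gamma>) \<subseteq> mverts \<Gamma>" using one_classes_subset by blast
      show "mverts \<Gamma> \<subseteq> \<Union>(one_classes \<Gamma>)" unfolding one_classes_def using one_class_self by (intro subsetI UN_I) auto
    qed
    then show ?thesis by simp
  qed
  also have "\<dots> = (\<Sum>W \<in> one_classes \<Gamma>. sum g W)"
  proof -
    have "\<forall>A \<in> one_classes \<Gamma>. \<forall>B \<in> one_classes \<Gamma>. A \<noteq> B \<longrightarrow> A \<inter> B = {}"
      using one_classes_disjoint by blast
    then show ?thesis using sum.Union_disjoint[of "one_classes \<Gamma>" g] one_classes_subset by simp
  qed
  finally have verts: "sum g (mverts \<Gamma>) = (\<Sum>W \<in> one_classes \<Gamma>. sum g W)" .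
  have "(\<Sum>e \<in># ?M. edge_cost g e) =
    (\<Sum>W \<in> one_classes \<Gamma>. \<Sum>e \<in># one_edges \<Gamma> W. edge_cost g e) +
    (\<Sum>e \<in># {#e \<in># ?M. snd e = 0#}. edge_cost g e)"
    by (subst M) (simp only: image_mset_union sum_mset.union one)
  then show ?thesis by (simp add: potential_def verts sum_subtractf)
qed

end


subsection \<open>The operation \<open>\<tau>\<^sub>1\<close>\<close>

text \<open>The analogue of \<open>admissible\<close> on the multigraph itself. When all weights are
  0, these are the labellings that pay no penalty, whatever the multiplicities of the edges.\<close>

definition feasible :: "'v mgraph \<Rightarrow> ('v \<Rightarrow> int) \<Rightarrow> bool" where
  "feasible \<Gamma> g \<longleftrightarrow> (\<forall>v. \<bar>g v\<bar> \<le> 1) \<and> (\<forall>u v w. ({u, v}, w) \<in># medges \<Gamma> \<longrightarrow> g u + g v \<le> 0)"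

definition zero_weights :: "'v mgraph \<Rightarrow> bool" where
  "zero_weights \<Gamma> \<longleftrightarrow> (\<forall>e \<in># medges \<Gamma>. snd e = 0)"

lemma edge_cost_0: "edge_cost g ({u, v}, 0) = max 0 (g u + g v)"
  using edge_cost_eq[of "({u, v}, 0)" u v 0 g] by (simp add: path_cost_def)

lemma wf_mgraph_edge:
  assumes "wf_mgraph \<Gamma>" "e \<in># medges \<Gamma>"
  obtains u v where "e = ({u, v}, snd e)" "u \<in> mverts \<Gamma>" "v \<in> mverts \<Gamma>"
  using assms by (metis prod.collapse wf_mgraph_def)

lemma feasibleD: "feasible \<Gamma> g \<Longrightarrow> ({u, v}, w) \<in># medges \<Gamma> \<Longrightarrow> g u + g v \<le> 0"
  unfolding feasible_def by blast

lemma sum_mset_eq_0: "(\<And>x. x \<in># M \<Longrightarrow> f x = 0) \<Longrightarrow> (\<Sum>x \<in># M. f x) = (0 :: int)"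
  by (induction M) auto

lemma potential_feasible:
  assumes "wf_mgraph \<Gamma>" "zero_weights \<Gamma>" "feasible \<Gamma> g"
  shows "potential \<Gamma> g = sum g (mverts \<Gamma>)"
proof -
  have "edge_cost g e = 0" if "e \<in># medges \<Gamma>" for e
  proof -
    obtain u v where e: "e = ({u, v}, snd e)"
      using wf_mgraph_edge[OF assms(1) \<open>e \<in># medges \<Gamma>\<close>] by metis
    then have "e = ({u, v}, 0)" using assms(2) that by (metis zero_weights_def)
    then show ?thesis using feasibleD[OF assms(3), of u v 0] that by (simp add: edge_cost_0)
  qed
  then show ?thesis by (simp add: potential_def sum_mset_eq_0)
qed

text \<open>Lowering the label 1 at an end of a violated edge costs no more than the penalty it saves.\<close>

lemma zero_weights_feasible:
  assumes wf: "wf_mgraph \<Gamma>" and zero: "zero_weights \<Gamma>" and g: "\<forall>v. \<bar>g v\<bar> \<le> 1"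
  shows "\<exists>f. feasible \<Gamma> f \<and> potential \<Gamma> g \<le> sum f (mverts \<Gamma>)"
  using g
proof (induction "nat (\<Sum>v \<in> mverts \<Gamma>. g v + 1)" arbitrary: g rule: less_induct)
  case less
  have fin: "finite (mverts \<Gamma>)" using wf by (simp add: wf_mgraph_def)
  show ?case
  proof (cases "feasible \<Gamma> g")
    case True
    have "potential \<Gamma> g = sum g (mverts \<Gamma>)" by (rule potential_feasible[OF wf zero True])
    then show ?thesis using True by (intro exI[of _ g]) simp
  next
    case False
    then obtain a b w where ab: "({a, b}, w) \<in># medges \<Gamma>" "g a + g b > 0"
      using less.prems by (auto simp: feasible_def not_le)
    \<comment> \<open>A positive sum forces an end with positive label; this end is called
      \<open>u\<close>. On a loop, \<open>u = v\<close>.\<close>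
    define u v where "u = (if g a > 0 then a else b)" and "v = (if g a > 0 then b else a)"
    have uv: "({u, v}, w) \<in># medges \<Gamma>" "g u + g v > 0" "g u > 0"
      using ab by (auto simp: u_def v_def insert_commute)
    have w: "w = 0" using zero uv(1) by (auto simp: zero_weights_def)
    have u: "u \<in> mverts \<Gamma>" using wf_mgraph_edge_verts[OF wf uv(1)] by simp
    define f where "f = g(u := g u - 1)"
    have f: "\<forall>x. \<bar>f x\<bar> \<le> 1" using less.prems less.prems[rule_format, of u] uv(3) by (auto simp: f_def)
    have f_le: "f x \<le> g x" for x by (simp add: f_def)
    have sum_f: "sum f (mverts \<Gamma>) = sum g (mverts \<Gamma>) - 1"
      using u fin by (simp add: f_def sum.remove[of _ u])
    obtain M where M: "medges \<Gamma> = add_mset ({u, v}, 0) M" using uv(1) w by (metis multi_member_split)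
    have "edge_cost f e \<le> edge_cost g e" if "e \<in># M" for e
    proof -
      have e': "e \<in># medges \<Gamma>" using that M by simp
      obtain x y where e: "e = ({x, y}, snd e)" using wf_mgraph_edge[OF wf e'] by metis
      then have "e = ({x, y}, 0)" using zero e' by (metis zero_weights_def)
      then show ?thesis using f_le[of x] f_le[of y] by (simp add: edge_cost_0)
    qed
    then have "(\<Sum>e \<in># M. edge_cost f e) \<le> (\<Sum>e \<in># M. edge_cost g e)" by (rule sum_mset_mono)
    \<comment> \<open>The saving of 1 balances the loss at the vertex \<open>u\<close>; on a loop
      even 2 is saved.\<close>
    moreover have "edge_cost f ({u, v}, 0) \<le> edge_cost g ({u, v}, 0) - 1"
      using uv by (auto simp: edge_cost_0 f_def)
    ultimately have pot: "potential \<Gamma> g \<le> potential \<Gamma> f"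
      by (simp add: potential_def sum_f M)
    have "0 \<le> f x + 1" for x using f[rule_format, of x] by simp
    then have "0 \<le> (\<Sum>v \<in> mverts \<Gamma>. f v + 1)" by (intro sum_nonneg)
    then have "nat (\<Sum>v \<in> mverts \<Gamma>. f v + 1) < nat (\<Sum>v \<in> mverts \<Gamma>. g v + 1)"
      by (simp add: sum.distrib sum_f)
    then show ?thesis using less.hyps[OF _ f] pot by fastforce
  qed
qed

lemma le_gap_star_zero_iff:
  assumes "wf_mgraph \<Gamma>" "zero_weights \<Gamma>"
  shows "k \<le> gap_star \<Gamma> \<longleftrightarrow> (\<exists>g. feasible \<Gamma> g \<and> k \<le> sum g (mverts \<Gamma>))"
  unfolding le_gap_star_iff[OF assms(1)]
proof
  assume "\<exists>g. (\<forall>v. \<bar>g v\<bar> \<le> 1) \<and> k \<le> potential \<Gamma> g"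
  then show "\<exists>g. feasible \<Gamma> g \<and> k \<le> sum g (mverts \<Gamma>)"
    using zero_weights_feasible[OF assms] by (meson order_trans)
next
  assume "\<exists>g. feasible \<Gamma> g \<and> k \<le> sum g (mverts \<Gamma>)"
  then show "\<exists>g. (\<forall>v. \<bar>g v\<bar> \<le> 1) \<and> k \<le> potential \<Gamma> g"
    using potential_feasible[OF assms] by (metis feasible_def)
qed

section \<open>Contracting tree classes and dropping cyclic classes\<close>

context binomial_mgraph
begin

abbreviation root :: "'v set \<Rightarrow> 'v" where "root W \<equiv> rep (induced \<Gamma> W)"

definition tree_classes :: "'v set set" where
  "tree_classes = {W \<in> one_classes \<Gamma>. excess \<Gamma> W = 1}"

definition cyclic_classes :: "'v set set" where
  "cyclic_classes = {W \<in> one_classes \<Gamma>. excess \<Gamma> W \<le> 0}"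

lemma root_in: "W \<in> one_classes \<Gamma> \<Longrightarrow> root W \<in> W"
  using one_classes_subset[of W] by (auto simp: rep_def mverts_induced intro: someI_ex)

lemma inj_on_root: "inj_on root (one_classes \<Gamma>)"
  using root_in one_classes_disjoint by (intro inj_onI) metis

lemma one_class_root: "W \<in> one_classes \<Gamma> \<Longrightarrow> one_class \<Gamma> (root W) = W"
  using one_classes_mem[OF _ root_in] by simp

lemma inj_on_induced: "inj_on (induced \<Gamma>) (one_classes \<Gamma>)"
  using mverts_induced one_classes_subset by (intro inj_onI) metis

lemma tree_components_eq: "tree_components \<Gamma> = induced \<Gamma> ` tree_classes"
proof -
  have "int (eps1 (induced \<Gamma> W)) = int (card (mverts (induced \<Gamma> W))) - 1 \<longleftrightarrow> excess \<Gamma> W = 1"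
    if "W \<in> one_classes \<Gamma>" for W
    using one_classes_subset[OF that] by (auto simp: eps1_induced mverts_induced excess_def)
  then show ?thesis
    by (auto simp: tree_components_def one_component_iff tree_classes_def)
qed

lemma cyclic_components_eq: "cyclic_components \<Gamma> = induced \<Gamma> ` cyclic_classes"
proof -
  have "eps1 (induced \<Gamma> W) \<ge> card (mverts (induced \<Gamma> W)) \<longleftrightarrow> excess \<Gamma> W \<le> 0"
    if "W \<in> one_classes \<Gamma>" for W
    using one_classes_subset[OF that] by (auto simp: eps1_induced mverts_induced excess_def)
  then show ?thesis
    by (auto simp: cyclic_components_def one_component_iff cyclic_classes_def)
qed

lemma t1_eq: "t1 \<Gamma> = (\<Sum>W \<in> cyclic_classes. - excess \<Gamma> W)"
proof -
  have "inj_on (induced \<Gamma>) cyclic_classes"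
    using inj_on_induced by (rule inj_on_subset) (auto simp: cyclic_classes_def)
  moreover have "int (eps1 (induced \<Gamma> W)) - int (card (mverts (induced \<Gamma> W))) = - excess \<Gamma> W"
    if "W \<in> cyclic_classes" for W
    using that one_classes_subset[of W]
    by (simp add: cyclic_classes_def eps1_induced mverts_induced excess_def)
  ultimately show ?thesis unfolding t1_def cyclic_components_eq by (simp add: sum.reindex)
qed

lemma mverts_tau1: "mverts (tau1 \<Gamma>) = root ` tree_classes"
  by (simp add: tau1_def tree_components_eq image_image)

definition tau1_edges :: "('v set \<times> nat) set" where
  "tau1_edges = {({root A, root B}, 0) |A B. A \<in> tree_classes \<and> B \<in> tree_classes \<and>
     (\<exists>a \<in> A. \<exists>b \<in> B. ({a, b}, 0) \<in># medges \<Gamma>)}"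

lemma finite_tree_classes: "finite tree_classes"
  using finite_one_classes by (simp add: tree_classes_def)

lemma finite_tau1_edges: "finite tau1_edges"
proof -
  have "tau1_edges \<subseteq> (\<lambda>(A, B). ({root A, root B}, 0)) ` (tree_classes \<times> tree_classes)"
    by (auto simp: tau1_edges_def)
  then show ?thesis using finite_tree_classes by (meson finite_SigmaI finite_imageI finite_subset)
qed

lemma medges_tau1: "medges (tau1 \<Gamma>) = mset_set tau1_edges"
proof -
  have mv: "mverts (induced \<Gamma> W) = W" if "W \<in> tree_classes" for W
    using that one_classes_subset mverts_induced by (auto simp: tree_classes_def)
  have "{({rep A, rep B}, 0 :: nat) |A B. A \<in> induced \<Gamma> ` tree_classes \<and> B \<in> induced \<Gamma> ` tree_classes \<and>
        (\<exists>a \<in> mverts A. \<exists>b \<in> mverts B. ({a, b}, 0) \<in># medges \<Gamma>)} = tau1_edges"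
    unfolding tau1_edges_def by (intro Collect_cong) (auto simp: mv, (metis mv imageI)+)
  then show ?thesis by (simp add: tau1_def tree_components_eq)
qed

lemma mverts_tau1_subset: "mverts (tau1 \<Gamma>) \<subseteq> mverts \<Gamma>"
  using root_in one_classes_subset by (fastforce simp: mverts_tau1 tree_classes_def)

lemma wf_tau1: "wf_mgraph (tau1 \<Gamma>)"
  using finite_tree_classes finite_tau1_edges
  by (fastforce simp: wf_mgraph_def mverts_tau1 medges_tau1 tau1_edges_def)

lemma zero_weights_tau1: "zero_weights (tau1 \<Gamma>)"
  using finite_tau1_edges by (auto simp: zero_weights_def medges_tau1 tau1_edges_def)

lemma sum_one_classes:
  fixes f :: "'v set \<Rightarrow> int"
  shows "sum f (one_classes \<Gamma>) = sum f tree_classes + sum f cyclic_classes"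
proof -
  have "excess \<Gamma> W = 1 \<or> excess \<Gamma> W \<le> 0" if "W \<in> one_classes \<Gamma>" for W
    using excess_le_1[OF that] by linarith
  then have "one_classes \<Gamma> = tree_classes \<union> cyclic_classes"
    unfolding tree_classes_def cyclic_classes_def by blast
  moreover have "finite tree_classes" "finite cyclic_classes" "tree_classes \<inter> cyclic_classes = {}"
    using finite_one_classes by (auto simp: tree_classes_def cyclic_classes_def)
  ultimately show ?thesis by (simp add: sum.union_disjoint)
qed

lemma sum_mverts_tau1:
  fixes f :: "'v \<Rightarrow> int"
  shows "sum f (mverts (tau1 \<Gamma>)) = (\<Sum>W \<in> tree_classes. f (root W))"
  unfolding mverts_tau1
  by (subst sum.reindex) (auto intro: inj_on_subset[OF inj_on_root] simp: tree_classes_def)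

text \<open>Each class takes its minimal label. By \<open>one_edges_cost\<close> this does not
  decrease the value inside classes, and smaller labels only reduce penalties of weight-0 edges. The
  surviving edges of weight 0 are then merged, which drops nonnegative penalties.\<close>

lemma potential_le_tau1:
  assumes g: "\<forall>v. \<bar>g v\<bar> \<le> 1"
  shows "\<exists>f. (\<forall>v. \<bar>f v\<bar> \<le> 1) \<and> potential \<Gamma> g \<le> potential (tau1 \<Gamma>) f + t1 \<Gamma>"
proof (intro exI conjI)
  define f where "f v = (if v \<in> mverts \<Gamma> then Min (g ` one_class \<Gamma> v) else 0)" for v
  have fin: "finite (g ` one_class \<Gamma> v)" "g ` one_class \<Gamma> v \<noteq> {}" if "v \<in> mverts \<Gamma>" for v
    using one_class_subset[OF that] fin_verts one_class_self[of v \<Gamma>] by (auto intro: finite_subset)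
  have f_le: "f v \<le> g w" if "v \<in> mverts \<Gamma>" "w \<in> one_class \<Gamma> v" for v w
    using fin[OF that(1)] that by (simp add: f_def)
  have f_attained: "\<exists>w \<in> one_class \<Gamma> v. f v = g w" if "v \<in> mverts \<Gamma>" for v
    using Min_in[OF fin[OF that]] that by (auto simp: f_def)
  have f1: "\<bar>f v\<bar> \<le> 1" for v
  proof (cases "v \<in> mverts \<Gamma>")
    case True
    then show ?thesis using f_attained g by metis
  qed (simp add: f_def)
  then show "\<forall>v. \<bar>f v\<bar> \<le> 1" ..
  have root_verts: "root W \<in> mverts \<Gamma>" if "W \<in> one_classes \<Gamma>" for W
    using root_in[OF that] one_classes_subset[OF that] by auto
  have on_class: "sum g W - (\<Sum>e \<in># one_edges \<Gamma> W. edge_cost g e) \<le> f (root W) * excess \<Gamma> W"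
    if W: "W \<in> one_classes \<Gamma>" for W
  proof -
    obtain r where r: "r \<in> W" "f (root W) = g r"
      using f_attained[OF root_verts[OF W]] one_class_root[OF W] by auto
    have "g r \<le> g v" if "v \<in> W" for v
      using f_le[OF root_verts[OF W], of v] that one_class_root[OF W] r(2) by simp
    then show ?thesis using one_edges_cost[OF W r(1)] r(2) by simp
  qed
  have "(\<Sum>W \<in> one_classes \<Gamma>. sum g W - (\<Sum>e \<in># one_edges \<Gamma> W. edge_cost g e)) \<le>
    (\<Sum>W \<in> one_classes \<Gamma>. f (root W) * excess \<Gamma> W)"
    using on_class by (rule sum_mono)
  also have "\<dots> = (\<Sum>W \<in> tree_classes. f (root W) * excess \<Gamma> W) + (\<Sum>W \<in> cyclic_classes. f (root W) * excess \<Gamma> W)"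
    by (rule sum_one_classes)
  also have "(\<Sum>W \<in> tree_classes. f (root W) * excess \<Gamma> W) = sum f (mverts (tau1 \<Gamma>))"
    unfolding sum_mverts_tau1 by (intro sum.cong) (auto simp: tree_classes_def)
  \<comment> \<open>As the excess is at most 0, the value is largest for the label -1.\<close>
  also have "(\<Sum>W \<in> cyclic_classes. f (root W) * excess \<Gamma> W) \<le> t1 \<Gamma>"
    unfolding t1_eq
  proof (rule sum_mono)
    fix W assume "W \<in> cyclic_classes"
    moreover have "- 1 \<le> f (root W)" using f1[of "root W"] by simp
    ultimately have "(f (root W) + 1) * excess \<Gamma> W \<le> 0"
      by (simp add: cyclic_classes_def mult_nonneg_nonpos)
    then show "f (root W) * excess \<Gamma> W \<le> - excess \<Gamma> W" by (simp add: algebra_simps)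
  qed
  finally have verts: "(\<Sum>W \<in> one_classes \<Gamma>. sum g W - (\<Sum>e \<in># one_edges \<Gamma> W. edge_cost g e)) \<le>
    sum f (mverts (tau1 \<Gamma>)) + t1 \<Gamma>" by simp
  let ?M = "{#e \<in># medges \<Gamma>. snd e = 0#}"
  \<comment> \<open>\<open>D\<close> consists of the weight-0 edges between tree classes, without
    multiplicity, and \<open>\<pi>\<close> sends each to the edge it induces between roots. Every
    edge of \<open>tau1\<close> arises in this way, in general from several edges.\<close>
  define D where "D = {e \<in> set_mset ?M. \<forall>v \<in> fst e. one_class \<Gamma> v \<in> tree_classes}"
  define \<pi> where "\<pi> e = ((\<lambda>v. root (one_class \<Gamma> v)) ` fst e, 0 :: nat)" for e :: "'v set \<times> nat"
  have finD: "finite D" by (simp add: D_def)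
  have nonneg: "0 \<le> edge_cost h e" if "snd e = 0" for h and e :: "'v set \<times> nat"
    using that by (simp add: edge_cost_def)
  have "(\<Sum>e \<in># medges (tau1 \<Gamma>). edge_cost f e) = (\<Sum>e \<in> tau1_edges. edge_cost f e)"
    by (simp add: medges_tau1 sum_unfold_sum_mset)
  also have "\<dots> \<le> (\<Sum>e \<in> \<pi> ` D. edge_cost f e)"
  proof (rule sum_mono2)
    show "finite (\<pi> ` D)" using finD by simp
    show "tau1_edges \<subseteq> \<pi> ` D"
    proof
      fix s assume "s \<in> tau1_edges"
      then obtain A B a b where s: "s = ({root A, root B}, 0)" "A \<in> tree_classes" "B \<in> tree_classes"
        "a \<in> A" "b \<in> B" "({a, b}, 0) \<in># medges \<Gamma>" by (auto simp: tau1_edges_def)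
      then have "A = one_class \<Gamma> a" "B = one_class \<Gamma> b"
        using one_classes_mem[of A \<Gamma> a] one_classes_mem[of B \<Gamma> b] by (simp_all add: tree_classes_def)
      then have "s = \<pi> ({a, b}, 0)" "({a, b}, 0) \<in> D" using s by (auto simp: \<pi>_def D_def)
      then show "s \<in> \<pi> ` D" by (rule image_eqI)
    qed
    show "0 \<le> edge_cost f e" if "e \<in> \<pi> ` D - tau1_edges" for e
      using that by (intro nonneg) (auto simp: \<pi>_def)
  qed
  also have "\<dots> \<le> (\<Sum>e \<in> D. edge_cost f (\<pi> e))"
    using sum_image_le[OF finD, of "edge_cost f" \<pi>] nonneg by (simp add: \<pi>_def comp_def)
  also have "\<dots> \<le> (\<Sum>e \<in> D. edge_cost g e)"
  proof (rule sum_mono)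
    fix e assume e: "e \<in> D"
    then have "e \<in># medges \<Gamma>" "snd e = 0" by (auto simp: D_def)
    then obtain a b where ab: "e = ({a, b}, 0)" "a \<in> mverts \<Gamma>" "b \<in> mverts \<Gamma>"
      using wf_mgraph_edge[OF wf_\<Gamma>] by metis
    have "f (root (one_class \<Gamma> v)) \<le> g v" if "v \<in> mverts \<Gamma>" for v
    proof (rule f_le)
      have W: "one_class \<Gamma> v \<in> one_classes \<Gamma>" using that by (simp add: one_classes_def)
      show "root (one_class \<Gamma> v) \<in> mverts \<Gamma>" by (rule root_verts[OF W])
      show "v \<in> one_class \<Gamma> (root (one_class \<Gamma> v))" using one_class_root[OF W] one_class_self by metis
    qed
    then show "edge_cost f (\<pi> e) \<le> edge_cost g e"
      using ab by (simp add: \<pi>_def edge_cost_0) (smt (verit, best))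
  qed
  also have "\<dots> \<le> (\<Sum>e \<in> set_mset ?M. edge_cost g e)"
    using nonneg by (intro sum_mono2) (auto simp: D_def)
  also have "\<dots> \<le> (\<Sum>e \<in> set_mset ?M. int (count ?M e) * edge_cost g e)"
  proof (rule sum_mono)
    fix e assume e: "e \<in> set_mset ?M"
    then have "1 \<le> int (count ?M e)" by (simp add: Suc_le_eq flip: count_greater_zero_iff)
    moreover have "0 \<le> edge_cost g e" using e by (intro nonneg) simp
    ultimately show "edge_cost g e \<le> int (count ?M e) * edge_cost g e"
      using mult_right_mono[of 1 "int (count ?M e)" "edge_cost g e"] by simp
  qed
  also have "\<dots> = (\<Sum>e \<in># ?M. edge_cost g e)"
    by (rule sum_mset_conv_count[symmetric]) auto
  finally have "(\<Sum>e \<in># medges (tau1 \<Gamma>). edge_cost f e) \<le> (\<Sum>e \<in># ?M. edge_cost g e)" .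
  then show "potential \<Gamma> g \<le> potential (tau1 \<Gamma>) f + t1 \<Gamma>"
    using verts unfolding potential_classes potential_def[of "tau1 \<Gamma>"] by simp
qed

text \<open>Tree classes keep the label of their root, cyclic classes get -1. Feasibility matters: a
  penalty paid once in \<open>tau1 \<Gamma>\<close> might be paid several times by parallel edges of
  \<Gamma>, whereas without penalties the values agree exactly.\<close>

lemma feasible_tau1_lift:
  assumes f: "feasible (tau1 \<Gamma>) f"
  shows "\<exists>g. (\<forall>v. \<bar>g v\<bar> \<le> 1) \<and> sum f (mverts (tau1 \<Gamma>)) + t1 \<Gamma> = potential \<Gamma> g"
proof (intro exI conjI)
  define c where "c W = (if excess \<Gamma> W = 1 then f (root W) else -1)" for W
  define g where "g v = c (one_class \<Gamma> v)" for v
  have f1: "\<bar>f v\<bar> \<le> 1" for v using f by (simp add: feasible_def)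
  then show "\<forall>v. \<bar>g v\<bar> \<le> 1" by (simp add: g_def c_def)
  have g_class: "g v = c W" if "W \<in> one_classes \<Gamma>" "v \<in> W" for v W
    using one_classes_mem[OF that] by (simp add: g_def)
  have on_class: "sum g W - (\<Sum>e \<in># one_edges \<Gamma> W. edge_cost g e) = c W * excess \<Gamma> W"
    if W: "W \<in> one_classes \<Gamma>" for W
  proof -
    have "edge_cost g e = c W" if e: "e \<in># one_edges \<Gamma> W" for e
    proof -
      have "e \<in># medges \<Gamma>" "snd e = 1" "fst e \<subseteq> W" using e by (auto simp: one_edges_def)
      then obtain a b where "fst e = {a, b}" "a \<in> W" "b \<in> W"
        using wf_mgraph_edge[OF wf_\<Gamma>] by (metis fst_conv insert_subset)
      then show ?thesis using g_class[OF W] \<open>snd e = 1\<close> by (simp add: edge_cost_def)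
    qed
    then have "(\<Sum>e \<in># one_edges \<Gamma> W. edge_cost g e) = (\<Sum>e \<in># one_edges \<Gamma> W. c W)"
      by (metis (mono_tags, lifting) image_mset_cong)
    moreover have "sum g W = int (card W) * c W" using g_class[OF W] by simp
    ultimately show ?thesis by (simp add: excess_def algebra_simps)
  qed
  have "edge_cost g e = 0" if "e \<in># {#e \<in># medges \<Gamma>. snd e = 0#}" for e
  proof -
    have e: "e \<in># medges \<Gamma>" "snd e = 0" using that by auto
    obtain a b where ab: "e = ({a, b}, 0)" "a \<in> mverts \<Gamma>" "b \<in> mverts \<Gamma>"
      using wf_mgraph_edge[OF wf_\<Gamma> e(1)] e(2) by metis
    let ?A = "one_class \<Gamma> a" and ?B = "one_class \<Gamma> b"
    have "g a + g b \<le> 0"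
    proof (cases "excess \<Gamma> ?A = 1 \<and> excess \<Gamma> ?B = 1")
      case True
      then have "?A \<in> tree_classes" "?B \<in> tree_classes" using ab by (auto simp: tree_classes_def one_classes_def)
      then have "({root ?A, root ?B}, 0) \<in> tau1_edges"
        using ab e one_class_self[of a \<Gamma>] one_class_self[of b \<Gamma>] unfolding tau1_edges_def by blast
      then have "({root ?A, root ?B}, 0) \<in># medges (tau1 \<Gamma>)"
        using finite_tau1_edges by (simp add: medges_tau1)
      then show ?thesis using feasibleD[OF f] True by (simp add: g_def c_def)
    next
      case False
      then have "g a = -1 \<or> g b = -1" by (auto simp: g_def c_def)
      moreover have "g a \<le> 1" "g b \<le> 1" using f1 by (auto simp: g_def c_def abs_le_iff)
      ultimately show ?thesis by linarith
    qed
    then show ?thesis using ab by (simp add: edge_cost_0)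
  qed
  then have "(\<Sum>e \<in># {#e \<in># medges \<Gamma>. snd e = 0#}. edge_cost g e) = 0"
    by (rule sum_mset_eq_0)
  then have "potential \<Gamma> g = (\<Sum>W \<in> one_classes \<Gamma>. c W * excess \<Gamma> W)"
    unfolding potential_classes using on_class by simp
  also have "\<dots> = (\<Sum>W \<in> tree_classes. c W * excess \<Gamma> W) + (\<Sum>W \<in> cyclic_classes. c W * excess \<Gamma> W)"
    by (rule sum_one_classes)
  also have "(\<Sum>W \<in> tree_classes. c W * excess \<Gamma> W) = sum f (mverts (tau1 \<Gamma>))"
    unfolding sum_mverts_tau1 by (intro sum.cong) (auto simp: tree_classes_def c_def)
  also have "(\<Sum>W \<in> cyclic_classes. c W * excess \<Gamma> W) = t1 \<Gamma>"
    unfolding t1_eq by (intro sum.cong) (auto simp: cyclic_classes_def c_def)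
  finally show "sum f (mverts (tau1 \<Gamma>)) + t1 \<Gamma> = potential \<Gamma> g" by simp
qed

lemma gap_star_tau1: "gap_star \<Gamma> = gap_star (tau1 \<Gamma>) + t1 \<Gamma>"
proof -
  have "k \<le> gap_star \<Gamma> \<longleftrightarrow> k - t1 \<Gamma> \<le> gap_star (tau1 \<Gamma>)" for k
  proof
    assume "k \<le> gap_star \<Gamma>"
    then obtain g where g: "\<forall>v. \<bar>g v\<bar> \<le> 1" "k \<le> potential \<Gamma> g"
      unfolding le_gap_star_iff[OF wf_\<Gamma>] by blast
    obtain f where "\<forall>v. \<bar>f v\<bar> \<le> 1" "potential \<Gamma> g \<le> potential (tau1 \<Gamma>) f + t1 \<Gamma>"
      using potential_le_tau1[OF g(1)] by blast
    then show "k - t1 \<Gamma> \<le> gap_star (tau1 \<Gamma>)"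
      unfolding le_gap_star_iff[OF wf_tau1] using g(2) by (intro exI[of _ f]) auto
  next
    assume "k - t1 \<Gamma> \<le> gap_star (tau1 \<Gamma>)"
    then obtain f where f: "feasible (tau1 \<Gamma>) f" "k - t1 \<Gamma> \<le> sum f (mverts (tau1 \<Gamma>))"
      unfolding le_gap_star_zero_iff[OF wf_tau1 zero_weights_tau1] by blast
    obtain g where "\<forall>v. \<bar>g v\<bar> \<le> 1" "sum f (mverts (tau1 \<Gamma>)) + t1 \<Gamma> = potential \<Gamma> g"
      using feasible_tau1_lift[OF f(1)] by blast
    then show "k \<le> gap_star \<Gamma>"
      unfolding le_gap_star_iff[OF wf_\<Gamma>] using f(2) by (intro exI[of _ g]) auto
  qed
  from this[of "gap_star \<Gamma>"] this[of "gap_star (tau1 \<Gamma>) + t1 \<Gamma>"] show ?thesis by simp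
qed

text \<open>If no vertex is lost, every vertex is a root and every class a single vertex, so
  contraction only discards edges. This is what makes the number of edges usable for
  termination.\<close>

lemma medges_tau1_subset:
  assumes "mverts (tau1 \<Gamma>) = mverts \<Gamma>"
  shows "medges (tau1 \<Gamma>) \<subseteq># medges \<Gamma>"
proof -
  have single: "a = root A" if "A \<in> tree_classes" "a \<in> A" for a A
  proof -
    have A: "A \<in> one_classes \<Gamma>" using that by (simp add: tree_classes_def)
    then have "a \<in> root ` tree_classes"
      using that(2) one_classes_subset assms mverts_tau1 by blast
    then obtain B where B: "B \<in> one_classes \<Gamma>" "a = root B" by (auto simp: tree_classes_def)
    then have "A = B" using one_classes_disjoint[OF A B(1) that(2)] root_in by simp
    then show ?thesis using B by simp
  qed
  have "tau1_edges \<subseteq> set_mset (medges \<Gamma>)"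
  proof
    fix s assume "s \<in> tau1_edges"
    then obtain A B a b where s: "s = ({root A, root B}, 0)" "A \<in> tree_classes" "B \<in> tree_classes"
      "a \<in> A" "b \<in> B" "({a, b}, 0) \<in># medges \<Gamma>" by (auto simp: tau1_edges_def)
    then show "s \<in> set_mset (medges \<Gamma>)"
      using single[of A a] single[of B b] by simp
  qed
  then have "mset_set tau1_edges \<subseteq># mset_set (set_mset (medges \<Gamma>))"
    by (intro subset_imp_msubset_mset_set) auto
  then show ?thesis
    unfolding medges_tau1 using mset_set_set_mset_msubset subset_mset.order_trans by blast
qed

end


subsection \<open>The operations \<open>\<tau>\<^sub>2\<close> and \<open>\<tau>\<^sub>3\<close>\<close>

lemma wf_delete: "wf_mgraph \<Gamma> \<Longrightarrow> wf_mgraph (delete \<Gamma> S)"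
  by (fastforce simp: wf_mgraph_def delete_def)

lemma mverts_delete [simp]: "mverts (delete \<Gamma> S) = mverts \<Gamma> - S"
  by (simp add: delete_def)

lemma zero_weights_delete: "zero_weights \<Gamma> \<Longrightarrow> zero_weights (delete \<Gamma> S)"
  by (auto simp: zero_weights_def delete_def)

lemma delete_empty [simp]: "delete \<Gamma> {} = \<Gamma>"
  by (simp add: delete_def)

lemma zero_weights_binomial: "zero_weights \<Gamma> \<Longrightarrow> binomial_weights \<Gamma>"
  by (simp add: zero_weights_def binomial_weights_def)

lemma edge_delete:
  "({u, v}, w) \<in># medges (delete \<Gamma> S) \<longleftrightarrow> ({u, v}, w) \<in># medges \<Gamma> \<and> u \<notin> S \<and> v \<notin> S"
  by (auto simp: delete_def)

section \<open>Leaves and their neighbours\<close>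

locale zero_mgraph =
  fixes \<Gamma> :: "'v mgraph"
  assumes wf_\<Gamma>: "wf_mgraph \<Gamma>" and zero: "zero_weights \<Gamma>"
begin

abbreviation leaves :: "'v set" where "leaves \<equiv> deg_verts 1 \<Gamma>"

lemma finite_leaves: "finite leaves"
  using wf_\<Gamma> by (simp add: deg_verts_def wf_mgraph_def)

text \<open>A loop contributes 2 to the degree, so a vertex of degree 1 has exactly one incident
  edge, and this edge is not a loop.\<close>

lemma leaf_nbr_ex1:
  assumes "v \<in> leaves"
  shows "\<exists>n. n \<noteq> v \<and> n \<in> mverts \<Gamma> \<and> (\<exists>w. ({v, n}, w) \<in># medges \<Gamma>) \<and>
    (\<forall>u w. ({v, u}, w) \<in># medges \<Gamma> \<longrightarrow> u = n)"
proof -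
  let ?A = "{#e \<in># medges \<Gamma>. v \<in> fst e#}" and ?B = "{#e \<in># medges \<Gamma>. fst e = {v}#}"
  have deg: "size ?A + size ?B = 1" using assms by (simp add: deg_verts_def mdeg_def)
  have "?B = {#e \<in># ?A. fst e = {v}#}"
    unfolding filter_filter_mset by (intro filter_mset_cong) auto
  then have "size ?B \<le> size ?A" by (metis size_filter_mset_lesseq)
  then have sizes: "size ?A = 1" "size ?B = 0" using deg by linarith+
  obtain e where A: "?A = {#e#}" using size_1_singleton_mset[OF sizes(1)] by blast
  have B: "?B = {#}" using sizes(2) by (simp only: size_eq_0_iff_empty)
  have "e \<in># ?A" unfolding A by simp
  then have e: "e \<in># medges \<Gamma>" "v \<in> fst e" by (simp_all only: set_mset_filter mem_Collect_eq)
  then obtain a b where ab: "e = ({a, b}, snd e)" "a \<in> mverts \<Gamma>" "b \<in> mverts \<Gamma>"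
    using wf_mgraph_edge[OF wf_\<Gamma>] by metis
  define n where "n = (if v = a then b else a)"
  have en: "e = ({v, n}, snd e)" "n \<in> mverts \<Gamma>"
    using ab e(2) by (metis fst_conv insert_commute insert_iff n_def singletonD, simp add: n_def)
  have "n \<noteq> v"
  proof
    assume "n = v"
    then have "e \<in># ?B" using en e(1) by (metis (mono_tags, lifting) fst_conv insert_absorb2 mem_Collect_eq set_mset_filter)
    then show False using B by simp
  qed
  moreover have "u = n" if "({v, u}, w) \<in># medges \<Gamma>" for u w
  proof -
    have "({v, u}, w) \<in># ?A" using that by simp
    then have "({v, u}, w) = e" using A by simp
    then have "{v, u} = {v, n}" using en(1) by (metis fst_conv)
    then show ?thesis by (auto simp: doubleton_eq_iff)
  qed
  ultimately show ?thesis using en e(1) by metis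
qed

definition leaf_nbr :: "'v \<Rightarrow> 'v" where
  "leaf_nbr v = (SOME n. n \<noteq> v \<and> n \<in> mverts \<Gamma> \<and> (\<exists>w. ({v, n}, w) \<in># medges \<Gamma>) \<and>
    (\<forall>u w. ({v, u}, w) \<in># medges \<Gamma> \<longrightarrow> u = n))"

lemma leaf_nbr:
  assumes "v \<in> leaves"
  shows "leaf_nbr v \<noteq> v" "leaf_nbr v \<in> mverts \<Gamma>" "\<exists>w. ({v, leaf_nbr v}, w) \<in># medges \<Gamma>"
    "({v, u}, w) \<in># medges \<Gamma> \<Longrightarrow> u = leaf_nbr v"
  using someI_ex[OF leaf_nbr_ex1[OF assms]] unfolding leaf_nbr_def[symmetric] by blast+

lemma leaf_nbrs_eq: "leaf_nbrs \<Gamma> = leaf_nbr ` leaves"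
proof -
  have "mnbrs \<Gamma> v = {leaf_nbr v}" if "v \<in> leaves" for v
  proof (intro equalityI subsetI)
    fix u assume "u \<in> mnbrs \<Gamma> v"
    then obtain e where "e \<in># medges \<Gamma>" "fst e = {v, u}" by (auto simp: mnbrs_def)
    then have "({v, u}, snd e) \<in># medges \<Gamma>" by (metis prod.collapse)
    then show "u \<in> {leaf_nbr v}" using leaf_nbr(4)[OF that] by simp
  next
    show "u \<in> mnbrs \<Gamma> v" if "u \<in> {leaf_nbr v}" for u
      using leaf_nbr(3)[OF \<open>v \<in> leaves\<close>] that by (force simp: mnbrs_def)
  qed
  then show ?thesis by (auto simp: leaf_nbrs_def)
qed

lemma leaf_nbr_leaf:
  assumes "v \<in> leaves" "leaf_nbr v \<in> leaves"
  shows "leaf_nbr (leaf_nbr v) = v"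
proof -
  obtain w where "({v, leaf_nbr v}, w) \<in># medges \<Gamma>" using leaf_nbr(3)[OF assms(1)] by blast
  then have "({leaf_nbr v, v}, w) \<in># medges \<Gamma>" by (simp add: insert_commute)
  then show ?thesis using leaf_nbr(4)[OF assms(2)] by simp
qed

text \<open>A leaf is a neighbour of a leaf exactly in the components that consist of one edge.
  There both vertices are counted in both terms of \<open>t2\<close> and cancel, so these components
  are separated off.\<close>

lemma leaf_in_leaf_nbrs:
  assumes "v \<in> leaves"
  shows "v \<in> leaf_nbrs \<Gamma> \<longleftrightarrow> leaf_nbr v \<in> leaves"
proof
  assume "v \<in> leaf_nbrs \<Gamma>"
  then obtain l where "l \<in> leaves" "v = leaf_nbr l" unfolding leaf_nbrs_eq by blast
  then show "leaf_nbr v \<in> leaves" using leaf_nbr_leaf[of l] assms by simp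
next
  assume "leaf_nbr v \<in> leaves"
  then have "leaf_nbr (leaf_nbr v) \<in> leaf_nbrs \<Gamma>" unfolding leaf_nbrs_eq by (rule imageI)
  then show "v \<in> leaf_nbrs \<Gamma>" using leaf_nbr_leaf[OF assms \<open>leaf_nbr v \<in> leaves\<close>] by simp
qed

lemma feasible_leaf: "feasible \<Gamma> g \<Longrightarrow> v \<in> leaves \<Longrightarrow> g v + g (leaf_nbr v) \<le> 0"
  using leaf_nbr(3) feasibleD by metis

lemma finite_leaf_nbrs: "finite (leaf_nbrs \<Gamma>)"
  using finite_leaves by (simp add: leaf_nbrs_eq)

lemma t2_eq: "t2 \<Gamma> = int (card (leaves - leaf_nbrs \<Gamma>)) - int (card (leaf_nbrs \<Gamma> - leaves))"
proof -
  let ?L = leaves and ?N = "leaf_nbrs \<Gamma>"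
  have "card ?L = card (?L - ?N) + card (?L \<inter> ?N)" "card ?N = card (?N - ?L) + card (?N \<inter> ?L)"
    using finite_leaves finite_leaf_nbrs
    by (metis add.commute card_Int_Diff)+
  then show ?thesis by (simp add: t2_def Int_commute)
qed

lemma sum_leaves_split:
  fixes g :: "'v \<Rightarrow> int"
  shows "sum g (leaves \<union> leaf_nbrs \<Gamma>) = sum g (leaves \<inter> leaf_nbrs \<Gamma>) +
    (sum g (leaves - leaf_nbrs \<Gamma>) + sum g (leaf_nbrs \<Gamma> - leaves))"
  (is "sum g (?L \<union> ?N) = _")
proof -
  have "?L \<union> ?N = (?L \<inter> ?N) \<union> ((?L - ?N) \<union> (?N - ?L))" by blast
  then have "sum g (?L \<union> ?N) = sum g ((?L \<inter> ?N) \<union> ((?L - ?N) \<union> (?N - ?L)))" by simp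
  also have "\<dots> = sum g (?L \<inter> ?N) + (sum g (?L - ?N) + sum g (?N - ?L))"
    using finite_leaves finite_leaf_nbrs by (subst sum.union_disjoint, auto)+
  finally show ?thesis .
qed

text \<open>In a single-edge component the labels sum to at most 0. Every other neighbour of a leaf
  is paired with one of its leaves, again with sum at most 0. The unpaired leaves have label at most
  1, and their number is \<open>t2 \<Gamma>\<close>.\<close>

lemma leaf_sum_le:
  assumes g: "feasible \<Gamma> g"
  shows "sum g (leaves \<union> leaf_nbrs \<Gamma>) \<le> t2 \<Gamma>"
proof -
  let ?L = leaves and ?N = "leaf_nbrs \<Gamma>"
  \<comment> \<open>On single-edge components \<open>leaf_nbr\<close> exchanges the two ends, so
    averaging over this involution turns edge inequalities into a bound on the sum.\<close>
  have "sum g (?L \<inter> ?N) = (\<Sum>v \<in> ?L \<inter> ?N. g (leaf_nbr v))"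
    by (rule sum.reindex_bij_witness[of _ leaf_nbr leaf_nbr])
      (auto simp: leaf_in_leaf_nbrs leaf_nbr_leaf)
  then have "2 * sum g (?L \<inter> ?N) = (\<Sum>v \<in> ?L \<inter> ?N. g v + g (leaf_nbr v))"
    by (simp add: sum.distrib)
  also have "\<dots> \<le> 0" using feasible_leaf[OF g] by (intro sum_nonpos) auto
  finally have both: "sum g (?L \<inter> ?N) \<le> 0" by simp
  \<comment> \<open>\<open>\<phi>\<close> selects one leaf at each neighbour of leaves.\<close>
  define \<phi> where "\<phi> = inv_into ?L leaf_nbr"
  have \<phi>: "\<phi> x \<in> ?L" "leaf_nbr (\<phi> x) = x" if "x \<in> ?N" for x
    using that by (simp_all add: leaf_nbrs_eq \<phi>_def inv_into_into f_inv_into_f)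
  have inj: "inj_on \<phi> (?N - ?L)" using \<phi>(2) by (intro inj_onI) (metis DiffD1)
  have sub: "\<phi> ` (?N - ?L) \<subseteq> ?L - ?N"
    using \<phi> leaf_in_leaf_nbrs by auto
  have "sum g (?L - ?N) = sum g (?L - ?N - \<phi> ` (?N - ?L)) + sum g (\<phi> ` (?N - ?L))"
    using sub finite_leaves by (intro sum.subset_diff) auto
  also have "sum g (\<phi> ` (?N - ?L)) = (\<Sum>x \<in> ?N - ?L. g (\<phi> x))"
    using inj by (simp add: sum.reindex)
  finally have split: "sum g (?L - ?N) = sum g (?L - ?N - \<phi> ` (?N - ?L)) + (\<Sum>x \<in> ?N - ?L. g (\<phi> x))" .
  have "sum g (?L - ?N - \<phi> ` (?N - ?L)) \<le> (\<Sum>x \<in> ?L - ?N - \<phi> ` (?N - ?L). 1)"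
    using g by (intro sum_mono) (auto simp: feasible_def abs_le_iff)
  also have "\<dots> = int (card (?L - ?N) - card (?N - ?L))"
    using sub finite_leaf_nbrs inj by (simp add: card_Diff_subset card_image)
  also have "\<dots> = t2 \<Gamma>"
  proof -
    have "card (?N - ?L) \<le> card (?L - ?N)"
      using card_mono[OF _ sub] finite_leaves inj by (simp add: card_image)
    then show ?thesis by (simp add: t2_eq of_nat_diff)
  qed
  finally have rest: "sum g (?L - ?N - \<phi> ` (?N - ?L)) \<le> t2 \<Gamma>" .
  have "(\<Sum>x \<in> ?N - ?L. g (\<phi> x) + g x) \<le> 0"
    using feasible_leaf[OF g] \<phi> by (intro sum_nonpos) (metis DiffD1)
  then have pairs: "(\<Sum>x \<in> ?N - ?L. g (\<phi> x)) + sum g (?N - ?L) \<le> 0" by (simp add: sum.distrib)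
  show ?thesis unfolding sum_leaves_split using both split rest pairs by simp
qed

lemma leaf_nbrs_subset: "leaf_nbrs \<Gamma> \<subseteq> mverts \<Gamma>"
  using leaf_nbr(2) by (auto simp: leaf_nbrs_eq)

lemma leaves_subset: "leaves \<subseteq> mverts \<Gamma>"
  by (auto simp: deg_verts_def)

lemma sum_mverts_tau2:
  fixes g :: "'v \<Rightarrow> int"
  shows "sum g (mverts \<Gamma>) = sum g (mverts (tau2 \<Gamma>)) + sum g (leaves \<union> leaf_nbrs \<Gamma>)"
  unfolding tau2_def mverts_delete
  using wf_\<Gamma> leaves_subset leaf_nbrs_subset by (intro sum.subset_diff) (auto simp: wf_mgraph_def)

lemma feasible_tau2_extend:
  assumes g: "feasible (tau2 \<Gamma>) g"
  shows "\<exists>f. feasible \<Gamma> f \<and> sum f (mverts \<Gamma>) = sum g (mverts (tau2 \<Gamma>)) + t2 \<Gamma>"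
proof (intro exI conjI)
  let ?L = leaves and ?N = "leaf_nbrs \<Gamma>"
  \<comment> \<open>Single-edge components get 0, other leaves 1 and their neighbours -1. The label
    -1 makes all remaining edges at these neighbours harmless, so that \<open>g\<close> can be kept
    elsewhere.\<close>
  define f where "f v = (if v \<in> ?L \<inter> ?N then 0 else if v \<in> ?L then 1 else if v \<in> ?N then -1 else g v)" for v
  have f1: "\<bar>f v\<bar> \<le> 1" for v using g by (auto simp: f_def feasible_def)
  have half: "f u + f v \<le> 0" if uv: "({u, v}, w) \<in># medges \<Gamma>" "u \<in> ?L \<union> ?N" for u v w
  proof (cases "u \<in> ?L")
    case True
    then have v: "v = leaf_nbr u" using leaf_nbr(4) uv(1) by blast
    then have "v \<in> ?N" using True by (simp add: leaf_nbrs_eq)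
    show ?thesis
    proof (cases "u \<in> ?N")
      case True
      then have "v \<in> ?L" using v \<open>u \<in> ?L\<close> leaf_in_leaf_nbrs by simp
      then show ?thesis using \<open>v \<in> ?N\<close> True \<open>u \<in> ?L\<close> by (simp add: f_def)
    next
      case False
      then have "v \<notin> ?L" using v \<open>u \<in> ?L\<close> leaf_in_leaf_nbrs by simp
      then show ?thesis using \<open>v \<in> ?N\<close> False \<open>u \<in> ?L\<close> by (simp add: f_def)
    qed
  next
    case False
    then have "f u = -1" using uv(2) by (simp add: f_def)
    then show ?thesis using f1[of v] by simp
  qed
  have "f u + f v \<le> 0" if uv: "({u, v}, w) \<in># medges \<Gamma>" for u v w
  proof (cases "u \<in> ?L \<union> ?N \<or> v \<in> ?L \<union> ?N")
    case True
    moreover have "({v, u}, w) \<in># medges \<Gamma>" using uv by (simp add: insert_commute)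
    ultimately show ?thesis using half[of u v w] half[of v u w] uv by auto
  next
    case False
    then have "({u, v}, w) \<in># medges (tau2 \<Gamma>)" using uv by (simp add: tau2_def edge_delete)
    then show ?thesis using feasibleD[OF g] False by (auto simp: f_def)
  qed
  then show "feasible \<Gamma> f" using f1 by (simp add: feasible_def)
  have "sum f (?L \<union> ?N) = sum f (?L \<inter> ?N) + (sum f (?L - ?N) + sum f (?N - ?L))"
    by (rule sum_leaves_split)
  also have "\<dots> = t2 \<Gamma>"
  proof -
    have "sum f (?L \<inter> ?N) = 0" by (simp add: f_def)
    moreover have "sum f (?L - ?N) = (\<Sum>v \<in> ?L - ?N. 1)" by (intro sum.cong) (auto simp: f_def)
    moreover have "sum f (?N - ?L) = (\<Sum>v \<in> ?N - ?L. - 1)" by (intro sum.cong) (auto simp: f_def)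
    ultimately show ?thesis by (simp add: t2_eq)
  qed
  finally have "sum f (?L \<union> ?N) = t2 \<Gamma>" .
  moreover have "sum f (mverts (tau2 \<Gamma>)) = sum g (mverts (tau2 \<Gamma>))"
    by (intro sum.cong) (auto simp: tau2_def f_def)
  ultimately show "sum f (mverts \<Gamma>) = sum g (mverts (tau2 \<Gamma>)) + t2 \<Gamma>"
    by (simp add: sum_mverts_tau2)
qed

lemma wf_tau2: "wf_mgraph (tau2 \<Gamma>)" and zero_weights_tau2: "zero_weights (tau2 \<Gamma>)"
  using wf_\<Gamma> zero by (simp_all add: tau2_def wf_delete zero_weights_delete)

lemma gap_star_tau2: "gap_star \<Gamma> = gap_star (tau2 \<Gamma>) + t2 \<Gamma>"
proof -
  have "k \<le> gap_star \<Gamma> \<longleftrightarrow> k - t2 \<Gamma> \<le> gap_star (tau2 \<Gamma>)" for k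
    unfolding le_gap_star_zero_iff[OF wf_\<Gamma> zero] le_gap_star_zero_iff[OF wf_tau2 zero_weights_tau2]
  proof
    assume "\<exists>g. feasible \<Gamma> g \<and> k \<le> sum g (mverts \<Gamma>)"
    then obtain g where g: "feasible \<Gamma> g" "k \<le> sum g (mverts \<Gamma>)" by blast
    then have "feasible (tau2 \<Gamma>) g" by (auto simp: feasible_def tau2_def edge_delete)
    moreover have "k - t2 \<Gamma> \<le> sum g (mverts (tau2 \<Gamma>))"
      using g leaf_sum_le[OF g(1)] by (simp add: sum_mverts_tau2)
    ultimately show "\<exists>g. feasible (tau2 \<Gamma>) g \<and> k - t2 \<Gamma> \<le> sum g (mverts (tau2 \<Gamma>))" by blast
  next
    assume "\<exists>g. feasible (tau2 \<Gamma>) g \<and> k - t2 \<Gamma> \<le> sum g (mverts (tau2 \<Gamma>))"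
    then show "\<exists>g. feasible \<Gamma> g \<and> k \<le> sum g (mverts \<Gamma>)"
      using feasible_tau2_extend by (metis diff_le_eq)
  qed
  from this[of "gap_star \<Gamma>"] this[of "gap_star (tau2 \<Gamma>) + t2 \<Gamma>"] show ?thesis by simp
qed

end

section \<open>Isolated vertices and the third operation\<close>

lemma gap_star_delete_isolated:
  assumes wf: "wf_mgraph \<Gamma>"
  shows "gap_star \<Gamma> = gap_star (delete \<Gamma> (deg_verts 0 \<Gamma>)) + t3 \<Gamma>"
proof -
  let ?I = "deg_verts 0 \<Gamma>"
  let ?\<Delta> = "delete \<Gamma> ?I"
  have fin: "finite (mverts \<Gamma>)" using wf by (simp add: wf_mgraph_def)
  have I: "?I \<subseteq> mverts \<Gamma>" by (auto simp: deg_verts_def)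
  have iso: "fst e \<inter> ?I = {}" if "e \<in># medges \<Gamma>" for e
  proof -
    have "v \<notin> fst e" if "v \<in> ?I" for v
    proof -
      have "{#e \<in># medges \<Gamma>. v \<in> fst e#} = {#}"
        using that unfolding deg_verts_def mdeg_def by (simp only: mem_Collect_eq add_is_0 size_eq_0_iff_empty)
      then have "e \<notin># {#e \<in># medges \<Gamma>. v \<in> fst e#}" by (simp only: set_mset_empty empty_iff not_False_eq_True)
      then show ?thesis using \<open>e \<in># medges \<Gamma>\<close> by simp
    qed
    then show ?thesis by blast
  qed
  then have "medges ?\<Delta> = medges \<Gamma>" by (simp add: delete_def filter_mset_eq_conv)
  then have pot: "potential \<Gamma> g = potential ?\<Delta> g + sum g ?I" for g
    using sum.subset_diff[OF I fin, of g] by (simp add: potential_def)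
  have "k \<le> gap_star \<Gamma> \<longleftrightarrow> k - t3 \<Gamma> \<le> gap_star ?\<Delta>" for k
    unfolding le_gap_star_iff[OF wf] le_gap_star_iff[OF wf_delete[OF wf]]
  proof
    assume "\<exists>g. (\<forall>v. \<bar>g v\<bar> \<le> 1) \<and> k \<le> potential \<Gamma> g"
    then obtain g where g: "\<forall>v. \<bar>g v\<bar> \<le> 1" "k \<le> potential \<Gamma> g" by blast
    have "sum g ?I \<le> (\<Sum>v \<in> ?I. 1)" using g(1) by (intro sum_mono) (auto simp: abs_le_iff)
    then have "k - t3 \<Gamma> \<le> potential ?\<Delta> g" using g(2) by (simp add: pot t3_def)
    then show "\<exists>g. (\<forall>v. \<bar>g v\<bar> \<le> 1) \<and> k - t3 \<Gamma> \<le> potential ?\<Delta> g" using g(1) by blast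
  next
    assume "\<exists>g. (\<forall>v. \<bar>g v\<bar> \<le> 1) \<and> k - t3 \<Gamma> \<le> potential ?\<Delta> g"
    then obtain g where g: "\<forall>v. \<bar>g v\<bar> \<le> 1" "k - t3 \<Gamma> \<le> potential ?\<Delta> g" by blast
    \<comment> \<open>No edge restricts an isolated vertex, so it takes the maximal label 1.\<close>
    define f where "f v = (if v \<in> ?I then 1 else g v)" for v
    have "edge_cost f e = edge_cost g e" if "e \<in># medges ?\<Delta>" for e
    proof -
      have "f ` fst e = g ` fst e"
        using that by (intro image_cong) (auto simp: f_def delete_def)
      then show ?thesis by (simp add: edge_cost_def)
    qed
    then have "(\<Sum>e \<in># medges ?\<Delta>. edge_cost f e) = (\<Sum>e \<in># medges ?\<Delta>. edge_cost g e)"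
      by (metis (mono_tags, lifting) image_mset_cong)
    moreover have "sum f (mverts ?\<Delta>) = sum g (mverts ?\<Delta>)" by (intro sum.cong) (auto simp: f_def)
    ultimately have "potential ?\<Delta> f = potential ?\<Delta> g" by (simp add: potential_def)
    moreover have "sum f ?I = t3 \<Gamma>" by (simp add: f_def t3_def)
    ultimately have "k \<le> potential \<Gamma> f" using g(2) by (simp add: pot)
    moreover have "\<forall>v. \<bar>f v\<bar> \<le> 1" using g(1) by (simp add: f_def)
    ultimately show "\<exists>g. (\<forall>v. \<bar>g v\<bar> \<le> 1) \<and> k \<le> potential \<Gamma> g" by blast
  qed
  from this[of "gap_star \<Gamma>"] this[of "gap_star ?\<Delta> + t3 \<Gamma>"] show ?thesis by simp
qed

lemma gap_star_tau3: "wf_mgraph \<Gamma> \<Longrightarrow> gap_star \<Gamma> = gap_star (tau3 \<Gamma>) + t3 \<Gamma>"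
  using gap_star_delete_isolated gap_star_suppress wf_delete by (metis tau3_eq)

lemma wf_tau3: "wf_mgraph \<Gamma> \<Longrightarrow> wf_mgraph (tau3 \<Gamma>)"
  by (simp add: tau3_eq wf_suppress wf_delete)

lemma binomial_tau3: "wf_mgraph \<Gamma> \<Longrightarrow> binomial_weights (tau3 \<Gamma>)"
  by (simp add: tau3_eq binomial_suppress wf_delete)

section \<open>One pass and termination of the loop\<close>

definition pass_graph :: "'v mgraph \<Rightarrow> 'v mgraph" where
  "pass_graph \<Gamma> = tau3 (tau2 (tau1 \<Gamma>))"

definition pass_count :: "'v mgraph \<Rightarrow> int" where
  "pass_count \<Gamma> = t1 \<Gamma> + t2 (tau1 \<Gamma>) + t3 (tau2 (tau1 \<Gamma>))"

lemma pass_eq: "pass (\<Gamma>, t) = (pass_graph \<Gamma>, t + pass_count \<Gamma>)"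
  by (simp add: pass_def pass_graph_def pass_count_def Let_def)

context binomial_mgraph
begin

interpretation tau1: zero_mgraph "tau1 \<Gamma>"
  by unfold_locales (rule wf_tau1, rule zero_weights_tau1)

lemma gap_star_pass: "gap_star \<Gamma> = gap_star (pass_graph \<Gamma>) + pass_count \<Gamma>"
  unfolding pass_graph_def pass_count_def
  using gap_star_tau1 tau1.gap_star_tau2 gap_star_tau3[OF tau1.wf_tau2] by simp

lemma wf_pass: "wf_mgraph (pass_graph \<Gamma>)" and binomial_pass: "binomial_weights (pass_graph \<Gamma>)"
  by (simp_all add: pass_graph_def wf_tau3 binomial_tau3 tau1.wf_tau2)

lemma mverts_pass_chain:
  "mverts (pass_graph \<Gamma>) \<subseteq> mverts (tau2 (tau1 \<Gamma>)) - deg_verts 0 (tau2 (tau1 \<Gamma>))"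
  using mverts_suppress[OF wf_delete[OF tau1.wf_tau2]] by (simp add: pass_graph_def tau3_eq)

lemma mverts_pass: "mverts (pass_graph \<Gamma>) \<subseteq> mverts \<Gamma>"
  using mverts_pass_chain mverts_tau1_subset by (auto simp: tau2_def)

text \<open>No operation creates vertices. If none disappears, then there are no leaves to remove,
  no isolated vertices, and no original vertices of degree 2 to suppress, so the second and third
  operations act as the identity.\<close>

lemma pass_same_verts:
  assumes same: "mverts (pass_graph \<Gamma>) = mverts \<Gamma>"
  shows "pass_graph \<Gamma> = tau1 \<Gamma>" "mverts (tau1 \<Gamma>) = mverts \<Gamma>"
proof -
  have sub2: "mverts (tau2 (tau1 \<Gamma>)) = mverts (tau1 \<Gamma>) - (deg_verts 1 (tau1 \<Gamma>) \<union> leaf_nbrs (tau1 \<Gamma>))"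
    by (simp add: tau2_def)
  then show V1: "mverts (tau1 \<Gamma>) = mverts \<Gamma>"
    using same mverts_pass_chain mverts_tau1_subset by blast
  then have "deg_verts 1 (tau1 \<Gamma>) = {}"
    using same mverts_pass_chain sub2 tau1.leaves_subset by blast
  then have tau2: "tau2 (tau1 \<Gamma>) = tau1 \<Gamma>" by (simp add: tau2_def leaf_nbrs_def)
  have "deg_verts 0 (tau1 \<Gamma>) \<subseteq> mverts (tau1 \<Gamma>)" by (auto simp: deg_verts_def)
  then have "deg_verts 0 (tau1 \<Gamma>) = {}"
    using same mverts_pass_chain V1 unfolding tau2 by blast
  then have pass: "pass_graph \<Gamma> = suppress (tau1 \<Gamma>)" by (simp add: pass_graph_def tau2 tau3_eq)
  have "deg (zeta (tau1 \<Gamma>)) (Orig v) \<noteq> 2" if "v \<in> mverts (tau1 \<Gamma>)" for v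
    using deg_suppress[OF wf_tau1] that same V1 pass by metis
  then show "pass_graph \<Gamma> = tau1 \<Gamma>"
    unfolding pass using suppress_id[OF wf_tau1 _ zero_weights_binomial[OF zero_weights_tau1]] by blast
qed

text \<open>Lexicographic descent: either a vertex is lost, or the pass reduces to
  \<open>tau1\<close>, which then yields a proper sub-multiset of the edges.\<close>

lemma pass_decreases:
  assumes "pass_graph \<Gamma> \<noteq> \<Gamma>"
  shows "(pass_graph \<Gamma>, \<Gamma>) \<in> measures [\<lambda>\<Gamma>. card (mverts \<Gamma>), \<lambda>\<Gamma>. size (medges \<Gamma>)]"
proof (cases "mverts (pass_graph \<Gamma>) = mverts \<Gamma>")
  case True
  note same = pass_same_verts[OF True]
  have "medges (tau1 \<Gamma>) \<noteq> medges \<Gamma>"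
    using assms same by (metis mgraph.equality old.unit.exhaust)
  then have "medges (tau1 \<Gamma>) \<subset># medges \<Gamma>"
    using medges_tau1_subset[OF same(2)] by (simp add: subset_mset.order_iff_strict)
  then show ?thesis using True same(1) by (simp add: mset_subset_size)
next
  case False
  then have "card (mverts (pass_graph \<Gamma>)) < card (mverts \<Gamma>)"
    using mverts_pass fin_verts by (intro psubset_card_mono) auto
  then show ?thesis by simp
qed

end

text \<open>The recursion equation of \<open>repeat_pass\<close> holds unconditionally, so
  termination enters only as the well-founded induction. The accumulator \<open>t\<close> is general
  because every pass changes it.\<close>

lemma gap_star_repeat_pass:
  assumes "wf_mgraph \<Gamma>" "binomial_weights \<Gamma>"
  shows "gap_star \<Gamma> + t = gap_star (fst (repeat_pass (\<Gamma>, t))) + snd (repeat_pass (\<Gamma>, t))"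
  using assms
proof (induction \<Gamma> arbitrary: t
    rule: wf_induct_rule[OF wf_measures[of "[\<lambda>\<Gamma>. card (mverts \<Gamma>), \<lambda>\<Gamma>. size (medges \<Gamma>)]"]])
  case (1 \<Gamma>)
  interpret binomial_mgraph \<Gamma> using 1(2,3) by unfold_locales
  show ?case
  proof (cases "pass_graph \<Gamma> = \<Gamma>")
    case True
    \<comment> \<open>The last pass still adds its count; invariance of the gap under a pass forces
      this count to be 0.\<close>
    then have "repeat_pass (\<Gamma>, t) = (pass_graph \<Gamma>, t + pass_count \<Gamma>)"
      by (subst repeat_pass.simps) (simp add: pass_eq)
    then show ?thesis using gap_star_pass by simp
  next
    case False
    then have "repeat_pass (\<Gamma>, t) = repeat_pass (pass_graph \<Gamma>, t + pass_count \<Gamma>)"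
      by (subst repeat_pass.simps) (simp add: pass_eq)
    then show ?thesis
      using 1(1)[OF pass_decreases[OF False] wf_pass binomial_pass, of "t + pass_count \<Gamma>"] gap_star_pass
      by simp
  qed
qed

theorem theorem6p12:
  fixes \<Gamma> :: "'v mgraph"
  assumes "wf_mgraph \<Gamma>" and "binomial_weights \<Gamma>"
  shows "gap_star \<Gamma> = gap_star (tau \<Gamma>) + tau_t \<Gamma>"
  using gap_star_repeat_pass[OF assms, of 0] by (simp add: tau_def tau_t_def)

end
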